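(* Let $m,n\ge1$ be integers, let $I\lhd\mathcal{P}_0^m(\mathbb{R}^n)$ be an ideal and let $p\in\mathcal{P}_0^m(\mathbb{R}^n)$. If $I$ strongly implies $p$ in the direction $\omega$ for every $\omega\in Allow(I)$, then $I$ implies $p$.
   Context: Jets: $\mathcal{P}^m(\mathbb{R}^n)$ is the ring of real polynomials in $n$ variables of degree at most $m$, with multiplication of $P$ and $Q$ given by $J^m(PQ)$, where $J^m$ denotes the Taylor polynomial of degree at most $m$ at the origin. $\mathcal{P}_0^m(\mathbb{R}^n)$ is the subset of those with zero constant term. "Ideal $I\lhd\mathcal{P}_0^m(\mathbb{R}^n)$" means an ideal of $\mathcal{P}^m(\mathbb{R}^n)$ contained in $\mathcal{P}_0^m(\mathbb{R}^n)$ (in particular a real vector subspace). Geometry: $\mathrm{dist}(x,Y)=\inf_{y\in Y}|x-y|$ for $Y\ne\emptyset$ and $\mathrm{dist}(x,\emptyset)=+\infty$. For $\Omega\subset S^{n-1}$, $\delta,r>0$: $D(\Omega,\delta)=\{\omega\in S^{n-1}:\mathrm{dist}(\omega,\Omega)<\delta\}$ and $\Gamma(\Omega,\delta,r)=\{x\in\mathbb{R}^n: 0<|x|<r,\ \mathrm{dist}(x/|x|,\Omega)<\delta\}$ (both empty if $\Omega=\emptyset$); for a single direction write $D(\omega,\delta)$, $\Gamma(\omega,\delta,r)$. For $K\ge 1$, $\rho>0$: $\mathrm{Ann}_K(\rho)=\{x\in\mathbb{R}^n:\rho/K<|x|<K\rho\}$. Allowed directions: $\omega\in S^{n-1}$ is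 forbidden for $I$ if there exist $p_1,\dots,p_L\in I$ and $c,\delta,r>0$ such that $|p_1(x)|+\dots+|p_L(x)|>c|x|^m$ for all $x\in\Gamma(\omega,\delta,r)$; otherwise it is allowed. $Allow(I)\subset S^{n-1}$ is the set of allowed directions. Implied jets: with $\Omega:=Allow(I)$, the ideal $I$ implies $p\in\mathcal{P}_0^m(\mathbb{R}^n)$ if there exist $A>0$ and $Q_1,\dots,Q_L\in I$ such that: for any $\epsilon>0$ there exist $\delta,r>0$ such that for any $0<\rho\le r$ there exist $F,S_1,\dots,S_L\in C^m(\mathrm{Ann}_4(\rho))$ with (i) $|\partial^\alpha F(x)|\le\epsilon\rho^{m-|\alpha|}$ for all $x\in\mathrm{Ann}_4(\rho)$, $|\alpha|\le m$; (ii) $|\partial^\alpha S_l(x)|\le A\rho^{-|\alpha|}$ for all $x\in\mathrm{Ann}_4(\rho)$, $|\alpha|\le m$, $1\le l\le L$; (iii) $p(x)=F(x)+\sum_{l=1}^L S_l(x)Q_l(x)$ (ordinary products of functions) for all $x\in\mathrm{Ann}_2(\rho)$ with $\mathrm{dist}(x/|x|,\Omega)<\delta$. Negligible functions: for $U\subset\mathbb{R}^n$ open and $\Omega\subset S^{n-1}$, a function $F\in C^m(U)$ is negligible for $\Omega$ if for all $\epsilon>0$ there exist $\delta,r>0$ such that: $\Gamma(\Omega,\delta,r)\subset U$; $|\partial^\alpha F(x)|\le\epsilon|x|^{m-|\alpha|}$ for all $x\in\Gamma(\Omega,\delta,r)$, $|\alpha|\le m$; and $\big|\partial^\alpha F(x)-\sum_{|\gamma|\le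 m-|\alpha|}\frac{1}{\gamma!}\partial^{\alpha+\gamma}F(y)(x-y)^\gamma\big|\le\epsilon|x-y|^{m-|\alpha|}$ for all distinct $x,y\in\Gamma(\Omega,\delta,r)$, $|\alpha|\le m$. Strong directional implication: $I$ strongly implies $p$ in the direction $\omega\in S^{n-1}$ if there exist $\delta_\omega,r_\omega>0$, $Q_1,\dots,Q_L\in I$, functions $F,S_1,\dots,S_L\in C^m(\Gamma(\omega,\delta_\omega,r_\omega))$ and constants $C_1,\dots,C_L>0$ such that: $F$ is negligible for $Allow(I)\cap D(\omega,\delta_\omega)$; $|\partial^\alpha S_l(x)|\le C_l|x|^{-|\alpha|}$ for all $|\alpha|\le m$, $1\le l\le L$, $x\in\Gamma(\omega,\delta_\omega,r_\omega)$; and $p(x)=\sum_{l=1}^L S_l(x)Q_l(x)+F(x)$ for all $x\in\Gamma(\omega,\delta_\omega,r_\omega)$. *)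

theory Defs
  imports
    "HOL-Analysis.Analysis"
    "HOL-Library.Poly_Mapping"
    "HOL-Algebra.Ideal"
begin

section \<open>Jets\<close>

text \<open>
  \<open>\<real>\<^sup>n\<close> is \<open>real ^ 'n\<close>. Multi-indices are finitely supported functions into the naturals, so that
  \<open>\<alpha> + \<gamma>\<close> is their pointwise sum, and multiplication of polynomials is the convolution product of
  \<^theory>\<open>HOL-Library.Poly_Mapping\<close>.
\<close>

type_synonym 'n multiindex = "'n \<Rightarrow>\<^sub>0 nat"
type_synonym 'n rpoly = "'n multiindex \<Rightarrow>\<^sub>0 real"

definition mi_deg :: "'n::finite multiindex \<Rightarrow> nat" where
  "mi_deg \<alpha> = (\<Sum>i\<in>UNIV. Poly_Mapping.lookup \<alpha> i)"

definition mi_fact :: "'n::finite multiindex \<Rightarrow> real" where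
  "mi_fact \<alpha> = (\<Prod>i\<in>UNIV. fact (Poly_Mapping.lookup \<alpha> i))"

definition mi_power :: "real ^ 'n \<Rightarrow> 'n::finite multiindex \<Rightarrow> real" where
  "mi_power x \<alpha> = (\<Prod>i\<in>UNIV. (x $ i) ^ Poly_Mapping.lookup \<alpha> i)"

definition poly_eval :: "'n::finite rpoly \<Rightarrow> real ^ 'n \<Rightarrow> real" where
  "poly_eval p x = (\<Sum>\<alpha>\<in>Poly_Mapping.keys p. Poly_Mapping.lookup p \<alpha> * mi_power x \<alpha>)"

definition jets :: "nat \<Rightarrow> 'n::finite rpoly set" where
  "jets m = {p. \<forall>\<alpha>\<in>Poly_Mapping.keys p. mi_deg \<alpha> \<le> m}"

definition jets0 :: "nat \<Rightarrow> 'n::finite rpoly set" where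
  "jets0 m = {p \<in> jets m. Poly_Mapping.lookup p 0 = 0}"

text \<open>The Taylor polynomial of degree at most \<open>m\<close> at the origin of a polynomial is its truncation.\<close>

definition jet_trunc :: "nat \<Rightarrow> 'n::finite rpoly \<Rightarrow> 'n rpoly" where
  "jet_trunc m p =
     (\<Sum>\<alpha> | \<alpha> \<in> Poly_Mapping.keys p \<and> mi_deg \<alpha> \<le> m.
        Poly_Mapping.single \<alpha> (Poly_Mapping.lookup p \<alpha>))"

definition jet_ring :: "nat \<Rightarrow> 'n::finite rpoly ring" where
  "jet_ring m =
     \<lparr>carrier = jets m, mult = (\<lambda>p q. jet_trunc m (p * q)), one = 1, zero = 0, add = (+)\<rparr>"

lemma mi_deg_add: "mi_deg (\<alpha> + \<beta>) = mi_deg \<alpha> + mi_deg \<beta>"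
  by (simp add: mi_deg_def lookup_add sum.distrib)

lemma lookup_jet_trunc:
  "Poly_Mapping.lookup (jet_trunc m p) \<alpha> = (if mi_deg \<alpha> \<le> m then Poly_Mapping.lookup p \<alpha> else 0)"
  by (auto simp: jet_trunc_def lookup_sum lookup_single when_def sum.delta in_keys_iff)

lemma jets_iff: "p \<in> jets m \<longleftrightarrow> (\<forall>\<alpha>. m < mi_deg \<alpha> \<longrightarrow> Poly_Mapping.lookup p \<alpha> = 0)"
  unfolding jets_def Ball_def by (simp add: in_keys_iff) (meson leD leI)

lemma jet_trunc_in_jets: "jet_trunc m p \<in> jets m"
  by (simp add: jets_iff lookup_jet_trunc)

lemma jet_trunc_ident: "p \<in> jets m \<Longrightarrow> jet_trunc m p = p"
  by (rule poly_mapping_eqI) (auto simp: jets_iff lookup_jet_trunc)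

lemma jet_trunc_add: "jet_trunc m (p + q) = jet_trunc m p + jet_trunc m q"
  by (rule poly_mapping_eqI) (auto simp: lookup_jet_trunc lookup_add)

lemma jet_trunc_high_mult:
  assumes "jet_trunc m p = 0"
  shows "jet_trunc m (p * q) = 0"
proof (rule poly_mapping_eqI)
  fix \<alpha>
  have "m < mi_deg \<beta>" if "\<beta> \<in> Poly_Mapping.keys p" for \<beta>
  proof (rule ccontr)
    assume "\<not> m < mi_deg \<beta>"
    then have "Poly_Mapping.lookup (jet_trunc m p) \<beta> = Poly_Mapping.lookup p \<beta>"
      by (simp add: lookup_jet_trunc)
    with assms that show False by (simp add: in_keys_iff)
  qed
  then have "m < mi_deg \<beta>" if "\<beta> \<in> Poly_Mapping.keys (p * q)" for \<beta>
    using keys_mult[of p q] that by (fastforce simp: mi_deg_add)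
  then show "Poly_Mapping.lookup (jet_trunc m (p * q)) \<alpha> = Poly_Mapping.lookup 0 \<alpha>"
    by (auto simp: lookup_jet_trunc in_keys_iff not_less[symmetric])
qed

lemma jet_trunc_mult_left: "jet_trunc m (jet_trunc m p * q) = jet_trunc m (p * q)"
proof -
  have "jet_trunc m (p - jet_trunc m p) = 0"
    by (rule poly_mapping_eqI) (simp add: lookup_jet_trunc lookup_minus)
  then have "jet_trunc m ((p - jet_trunc m p) * q) = 0"
    by (rule jet_trunc_high_mult)
  then show ?thesis
    using jet_trunc_add[of m "jet_trunc m p * q" "(p - jet_trunc m p) * q"]
    by (simp add: algebra_simps)
qed

lemma jet_trunc_mult_right: "jet_trunc m (p * jet_trunc m q) = jet_trunc m (p * q)"
  using jet_trunc_mult_left[of m q p] by (simp add: mult.commute)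

lemma cring_jet_ring: "cring (jet_ring m)"
proof (rule cringI)
  show "abelian_group (jet_ring m)"
  proof (rule abelian_groupI)
    fix p assume "p \<in> carrier (jet_ring m)"
    then show "\<exists>q\<in>carrier (jet_ring m). q \<oplus>\<^bsub>jet_ring m\<^esub> p = \<zero>\<^bsub>jet_ring m\<^esub>"
      by (intro bexI[of _ "- p"]) (auto simp: jet_ring_def jets_iff)
  qed (auto simp: jet_ring_def jets_iff lookup_add add_ac)
  show "comm_monoid (jet_ring m)"
  proof (rule comm_monoidI)
    have "1 \<in> jets m"
      by (auto simp: jets_iff lookup_one when_def mi_deg_def)
    then show "\<one>\<^bsub>jet_ring m\<^esub> \<in> carrier (jet_ring m)"
      by (simp add: jet_ring_def)
  qed (auto simp: jet_ring_def jet_trunc_in_jets jet_trunc_mult_left jet_trunc_mult_right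
        jet_trunc_ident mult_ac)
qed (auto simp: jet_ring_def distrib_right jet_trunc_add)


section \<open>Geometry\<close>

text \<open>Unlike \<^const>\<open>infdist\<close>, this distance to the empty set is \<open>\<infinity>\<close>.\<close>

definition set_edist :: "'a::metric_space \<Rightarrow> 'a set \<Rightarrow> ereal" where
  "set_edist x Y = (INF y\<in>Y. ereal (dist x y))"

definition dir_nbhd :: "(real ^ 'n::finite) set \<Rightarrow> real \<Rightarrow> (real ^ 'n) set" where
  "dir_nbhd \<Omega> \<delta> = {\<omega> \<in> sphere 0 1. set_edist \<omega> \<Omega> < ereal \<delta>}"

definition cone :: "(real ^ 'n::finite) set \<Rightarrow> real \<Rightarrow> real \<Rightarrow> (real ^ 'n) set" where
  "cone \<Omega> \<delta> r = {x. 0 < norm x \<and> norm x < r \<and> set_edist (x /\<^sub>R norm x) \<Omega> < ereal \<delta>}"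

definition annulus :: "real \<Rightarrow> real \<Rightarrow> (real ^ 'n::finite) set" where
  "annulus K \<rho> = {x. \<rho> / K < norm x \<and> norm x < K * \<rho>}"


section \<open>Functions of class \<open>C\<^sup>m\<close>\<close>

definition partial_deriv :: "'n::finite \<Rightarrow> (real ^ 'n \<Rightarrow> real) \<Rightarrow> real ^ 'n \<Rightarrow> real" where
  "partial_deriv i f x = frechet_derivative f (at x) (axis i 1)"

text \<open>To be used for open \<open>U\<close> only; the values of \<open>f\<close> outside \<open>U\<close> are then irrelevant.\<close>

primrec Cm_on :: "nat \<Rightarrow> (real ^ 'n::finite) set \<Rightarrow> (real ^ 'n \<Rightarrow> real) \<Rightarrow> bool" where
  "Cm_on 0 U f \<longleftrightarrow> continuous_on U f"
| "Cm_on (Suc k) U f \<longleftrightarrow>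
     (\<forall>x\<in>U. f differentiable at x) \<and> (\<forall>i. Cm_on k U (partial_deriv i f))"

text \<open>
  The order in which the partial derivatives are taken is arbitrary but fixed. It is irrelevant for
  functions of class \<open>C\<^sup>m\<close> and derivatives of order at most \<open>m\<close>.
\<close>

definition coord_list :: "'n::finite list" where
  "coord_list = (SOME is. distinct is \<and> set is = UNIV)"

definition mi_deriv :: "'n::finite multiindex \<Rightarrow> (real ^ 'n \<Rightarrow> real) \<Rightarrow> real ^ 'n \<Rightarrow> real" where
  "mi_deriv \<alpha> f = foldr (\<lambda>i. partial_deriv i ^^ Poly_Mapping.lookup \<alpha> i) coord_list f"


section \<open>Allowed directions and implied jets\<close>

definition forbidden_dir :: "nat \<Rightarrow> 'n::finite rpoly set \<Rightarrow> real ^ 'n \<Rightarrow> bool" where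
  "forbidden_dir m I \<omega> \<longleftrightarrow>
     (\<exists>L P c \<delta> r. (\<forall>l\<in>{1..L::nat}. P l \<in> I) \<and> c > 0 \<and> \<delta> > 0 \<and> r > 0 \<and>
        (\<forall>x\<in>cone {\<omega>} \<delta> r. (\<Sum>l=1..L. \<bar>poly_eval (P l) x\<bar>) > c * norm x ^ m))"

definition Allow :: "nat \<Rightarrow> 'n::finite rpoly set \<Rightarrow> (real ^ 'n) set" where
  "Allow m I = {\<omega> \<in> sphere 0 1. \<not> forbidden_dir m I \<omega>}"

definition implies_jet :: "nat \<Rightarrow> 'n::finite rpoly set \<Rightarrow> 'n rpoly \<Rightarrow> bool" where
  "implies_jet m I p \<longleftrightarrow>
     (\<exists>A L Q. A > 0 \<and> (\<forall>l\<in>{1..L::nat}. Q l \<in> I) \<and>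
       (\<forall>\<epsilon>>0. \<exists>\<delta> r. \<delta> > 0 \<and> r > 0 \<and> (\<forall>\<rho>. 0 < \<rho> \<and> \<rho> \<le> r \<longrightarrow>
         (\<exists>F S. Cm_on m (annulus 4 \<rho>) F \<and> (\<forall>l\<in>{1..L}. Cm_on m (annulus 4 \<rho>) (S l)) \<and>
           (\<forall>x\<in>annulus 4 \<rho>. \<forall>\<alpha>. mi_deg \<alpha> \<le> m \<longrightarrow>
              \<bar>mi_deriv \<alpha> F x\<bar> \<le> \<epsilon> * \<rho> ^ (m - mi_deg \<alpha>)) \<and>
           (\<forall>x\<in>annulus 4 \<rho>. \<forall>\<alpha>. \<forall>l\<in>{1..L}. mi_deg \<alpha> \<le> m \<longrightarrow>
              \<bar>mi_deriv \<alpha> (S l) x\<bar> \<le> A / \<rho> ^ mi_deg \<alpha>) \<and>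
           (\<forall>x\<in>annulus 2 \<rho>. set_edist (x /\<^sub>R norm x) (Allow m I) < ereal \<delta> \<longrightarrow>
              poly_eval p x = F x + (\<Sum>l=1..L. S l x * poly_eval (Q l) x))))))"

definition negligible_for ::
  "nat \<Rightarrow> (real ^ 'n::finite) set \<Rightarrow> (real ^ 'n) set \<Rightarrow> (real ^ 'n \<Rightarrow> real) \<Rightarrow> bool" where
  "negligible_for m U \<Omega> F \<longleftrightarrow>
     Cm_on m U F \<and>
     (\<forall>\<epsilon>>0. \<exists>\<delta> r. \<delta> > 0 \<and> r > 0 \<and> cone \<Omega> \<delta> r \<subseteq> U \<and>
       (\<forall>x\<in>cone \<Omega> \<delta> r. \<forall>\<alpha>. mi_deg \<alpha> \<le> m \<longrightarrow>
          \<bar>mi_deriv \<alpha> F x\<bar> \<le> \<epsilon> * norm x ^ (m - mi_deg \<alpha>)) \<and>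
       (\<forall>x\<in>cone \<Omega> \<delta> r. \<forall>y\<in>cone \<Omega> \<delta> r. \<forall>\<alpha>. x \<noteq> y \<and> mi_deg \<alpha> \<le> m \<longrightarrow>
          \<bar>mi_deriv \<alpha> F x -
            (\<Sum>\<gamma> | mi_deg \<gamma> \<le> m - mi_deg \<alpha>.
               1 / mi_fact \<gamma> * mi_deriv (\<alpha> + \<gamma>) F y * mi_power (x - y) \<gamma>)\<bar>
          \<le> \<epsilon> * norm (x - y) ^ (m - mi_deg \<alpha>)))"

text \<open>The sum over \<open>\<gamma>\<close> in the preceding definition ranges over a finite set.\<close>

lemma finite_mi_deg_le: "finite {\<gamma> :: 'n::finite multiindex. mi_deg \<gamma> \<le> k}"
proof -
  have "Poly_Mapping.lookup ` {\<gamma> :: 'n multiindex. mi_deg \<gamma> \<le> k} \<subseteq> UNIV \<rightarrow>\<^sub>E {..k}"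
  proof (clarsimp simp: PiE_def)
    fix \<gamma> :: "'n multiindex" and i
    assume "mi_deg \<gamma> \<le> k"
    moreover have "Poly_Mapping.lookup \<gamma> i \<le> mi_deg \<gamma>"
      unfolding mi_deg_def by (rule member_le_sum) auto
    ultimately show "Poly_Mapping.lookup \<gamma> i \<le> k" by simp
  qed
  moreover have "finite (UNIV \<rightarrow>\<^sub>E {..k} :: ('n \<Rightarrow> nat) set)"
    by (intro finite_PiE) auto
  ultimately have "finite (Poly_Mapping.lookup ` {\<gamma> :: 'n multiindex. mi_deg \<gamma> \<le> k})"
    by (rule finite_subset)
  then show ?thesis
    by (rule finite_imageD) (auto intro: inj_onI poly_mapping_eqI)
qed

definition strongly_implies ::
  "nat \<Rightarrow> 'n::finite rpoly set \<Rightarrow> 'n rpoly \<Rightarrow> real ^ 'n \<Rightarrow> bool" where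
  "strongly_implies m I p \<omega> \<longleftrightarrow>
     (\<exists>\<delta> r L Q F S C. \<delta> > 0 \<and> r > 0 \<and> (\<forall>l\<in>{1..L::nat}. Q l \<in> I \<and> C l > 0) \<and>
        Cm_on m (cone {\<omega>} \<delta> r) F \<and> (\<forall>l\<in>{1..L}. Cm_on m (cone {\<omega>} \<delta> r) (S l)) \<and>
        negligible_for m (cone {\<omega>} \<delta> r) (Allow m I \<inter> dir_nbhd {\<omega>} \<delta>) F \<and>
        (\<forall>\<alpha>. \<forall>l\<in>{1..L}. \<forall>x\<in>cone {\<omega>} \<delta> r. mi_deg \<alpha> \<le> m \<longrightarrow>
           \<bar>mi_deriv \<alpha> (S l) x\<bar> \<le> C l / norm x ^ mi_deg \<alpha>) \<and>
        (\<forall>x\<in>cone {\<omega>} \<delta> r.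
           poly_eval p x = (\<Sum>l=1..L. S l x * poly_eval (Q l) x) + F x))"

end

theory Submission
  imports Defs "HOL-Library.Sublist"
begin

text \<open>
  The set of allowed directions is compact, so finitely many of the neighbourhoods given by strong
  directional implication cover it. A partition of unity subordinate to this cover, taken on a grid
  of mesh comparable to \<open>\<rho>\<close>, glues the local representations of \<open>p\<close> on the annulus of radius
  \<open>\<rho>\<close>. The remainders \<open>F\<close> are small only on a thin cone whose width depends on \<open>\<epsilon>\<close>, so they cannot be
  cut off directly; the Whitney estimates in the definition of negligibility allow one to replace
  each of them by a function that agrees with it on a still thinner cone and is small on all of
  \<open>\<real>\<^sup>n\<close>.

  As \<open>F\<close> is already defined on a neighbourhood of the cone, finitely many dyadic scales suffice in
  the Whitney extension: starting from \<open>F\<close> at the finest scale, one glues on, at each scale, a layer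
  of averaged Taylor polynomials, with bounds independent of the number of scales.
\<close>

section \<open>Calculus of \<open>C\<^sup>m\<close> functions\<close>

text \<open>Nothing relates the width \<delta> of the thin cone to \<epsilon>: differentiating a
  cutoff of width \<open>\<delta> * \<rho>\<close> up to \<open>m\<close> times costs a factor
  \<delta>^(-m), and \<epsilon> * \<delta>^(-m) need not be small. The Whitney estimates repair
  this: at distance about s from the cone, F differs from its Taylor polynomial at a point of the
  cone by \<epsilon> * s^m as a jet at scale s, which is what a cutoff at scale s can afford.
  Cutoffs at the scales s, 2 s, 4 s, ... are harmless because each passes between two functions
  close to the same Taylor polynomial.

  The order of the quantifiers shapes the rest. The constant \<open>A\<close> and the polynomials
  from the ideal come before \<epsilon>, so the patches that carry the multipliers need a mesh that
  is a multiple of \<rho> fixed by the finite cover alone; the fine scale s occurs only in the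
  treatment of the remainders.\<close>

lemma partial_deriv_cong:
  assumes "open U" "x \<in> U" "\<And>y. y \<in> U \<Longrightarrow> f y = g y"
  shows "partial_deriv i f x = partial_deriv i g x"
proof -
  \<comment> \<open>\<open>frechet_derivative\<close> is a choice among the derivatives at the
    point, so it suffices that both functions have the same ones, possibly none.\<close>
  have "(f has_derivative D) (at x) \<longleftrightarrow> (g has_derivative D) (at x)" for D
    using has_derivative_transform_within_open[of f D x UNIV U g]
      has_derivative_transform_within_open[of g D x UNIV U f] assms by auto
  then show ?thesis
    by (simp add: partial_deriv_def frechet_derivative_def)
qed

lemma partial_deriv_add:
  assumes "f differentiable at x" "g differentiable at x"
  shows "partial_deriv i (\<lambda>x. f x + g x) x = partial_deriv i f x + partial_deriv i g x"
proof -
  have "((\<lambda>x. f x + g x) has_derivative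
      (\<lambda>h. frechet_derivative f (at x) h + frechet_derivative g (at x) h)) (at x)"
    using assms by (intro has_derivative_add) (simp_all flip: frechet_derivative_works)
  from frechet_derivative_at[OF this, symmetric] show ?thesis
    by (simp add: partial_deriv_def)
qed

lemma partial_deriv_mult:
  assumes "f differentiable at x" "g differentiable at x"
  shows "partial_deriv i (\<lambda>x. f x * g x) x
    = partial_deriv i f x * g x + f x * partial_deriv i g x"
proof -
  have "((\<lambda>x. f x * g x) has_derivative
      (\<lambda>h. f x * frechet_derivative g (at x) h + frechet_derivative f (at x) h * g x)) (at x)"
    using assms by (intro has_derivative_mult) (simp_all flip: frechet_derivative_works)
  from frechet_derivative_at[OF this, symmetric] show ?thesis
    by (simp add: partial_deriv_def)
qed

lemma partial_deriv_const [simp]: "partial_deriv i (\<lambda>x. c) = (\<lambda>x. 0)"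
  by (simp add: partial_deriv_def fun_eq_iff)

lemma Cm_on_cong:
  assumes "open U" "\<And>x. x \<in> U \<Longrightarrow> f x = g x" "Cm_on k U f"
  shows "Cm_on k U g"
  using assms(2,3)
proof (induction k arbitrary: f g)
  case 0
  then show ?case
    by (simp cong: continuous_on_cong)
next
  case (Suc k)
  have "g differentiable at x" if "x \<in> U" for x
    using Suc.prems(1,2) that has_derivative_transform_within_open[of f _ x UNIV U g] assms(1)
    by (simp add: differentiable_def) blast
  moreover have "Cm_on k U (partial_deriv i g)" for i
  proof (rule Suc.IH)
    show "partial_deriv i f x = partial_deriv i g x" if "x \<in> U" for x
      using assms(1) that Suc.prems(1) by (rule partial_deriv_cong)
  qed (use Suc.prems(2) in simp)
  ultimately show ?case by simp
qed

lemma Cm_on_subset: "Cm_on k U f \<Longrightarrow> V \<subseteq> U \<Longrightarrow> Cm_on k V f"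
  by (induction k arbitrary: f) (auto intro: continuous_on_subset)

lemma Cm_on_SucD: "Cm_on (Suc k) U f \<Longrightarrow> Cm_on k U f"
proof (induction k arbitrary: f)
  case 0
  then show ?case
    by (auto intro!: continuous_at_imp_continuous_on differentiable_imp_continuous_within)
qed simp

lemma Cm_on_le: "Cm_on m U f \<Longrightarrow> k \<le> m \<Longrightarrow> Cm_on k U f"
  by (induction m) (auto simp: le_Suc_eq simp del: Cm_on.simps dest: Cm_on_SucD)

lemma Cm_on_const [simp]: "Cm_on k U (\<lambda>x. c)"
  by (induction k arbitrary: c) auto

lemma Cm_on_add:
  assumes "open U" "Cm_on k U f" "Cm_on k U g"
  shows "Cm_on k U (\<lambda>x. f x + g x)"
  using assms(2,3)
proof (induction k arbitrary: f g)
  case 0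
  then show ?case by (auto intro: continuous_intros)
next
  case (Suc k)
  have "Cm_on k U (partial_deriv i (\<lambda>x. f x + g x))" for i
    by (rule Cm_on_cong[OF assms(1) _ Suc.IH[of "partial_deriv i f" "partial_deriv i g"]])
      (use Suc.prems in \<open>simp_all add: partial_deriv_add\<close>)
  with Suc.prems show ?case by simp
qed

lemma Cm_on_mult:
  assumes "open U" "Cm_on k U f" "Cm_on k U g"
  shows "Cm_on k U (\<lambda>x. f x * g x)"
  using assms(2,3)
proof (induction k arbitrary: f g)
  case 0
  then show ?case by (auto intro: continuous_intros)
next
  case (Suc k)
  have "Cm_on k U (partial_deriv i (\<lambda>x. f x * g x))" for i
  proof (rule Cm_on_cong[OF assms(1)])
    show "Cm_on k U (\<lambda>x. partial_deriv i f x * g x + f x * partial_deriv i g x)"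
      using Suc.prems Suc.prems[THEN Cm_on_SucD]
      by (intro Cm_on_add[OF assms(1)] Suc.IH) simp_all
  qed (use Suc.prems in \<open>simp add: partial_deriv_mult\<close>)
  with Suc.prems show ?case by simp
qed

lemma Cm_on_sum:
  assumes "open U" "\<And>a. a \<in> A \<Longrightarrow> Cm_on k U (f a)"
  shows "Cm_on k U (\<lambda>x. \<Sum>a\<in>A. f a x)"
  using assms(2)
  by (induction A rule: infinite_finite_induct) (simp_all add: Cm_on_add[OF assms(1)])

lemma Cm_on_prod:
  assumes "open U" "\<And>a. a \<in> A \<Longrightarrow> Cm_on k U (f a)"
  shows "Cm_on k U (\<lambda>x. \<Prod>a\<in>A. f a x)"
  using assms(2)
  by (induction A rule: infinite_finite_induct) (simp_all add: Cm_on_mult[OF assms(1)])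

lemma Cm_on_diff:
  assumes "open U" "Cm_on k U f" "Cm_on k U g"
  shows "Cm_on k U (\<lambda>x. f x - g x)"
  using Cm_on_add[OF assms(1,2) Cm_on_mult[OF assms(1) Cm_on_const[of _ _ "-1"] assms(3)]]
  by simp

lemma Cm_on_Un:
  assumes "open U" "open V" "Cm_on k U f" "Cm_on k V f"
  shows "Cm_on k (U \<union> V) f"
  using assms(3,4)
  by (induction k arbitrary: f) (auto intro: continuous_on_open_Un assms(1,2))

text \<open>The open sets \<open>U\<close> and \<open>- K\<close> cover the space, and the extension
  is of class C^m on each. Every cutoff carries a closed \<open>K\<close> inside \<open>U\<close>
  for this purpose: the value 0 outside \<open>U\<close> alone would not control derivatives on the
  boundary of \<open>U\<close>.\<close>

lemma Cm_on_extend_zero: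
  assumes "open U" "closed K" "K \<subseteq> U" "Cm_on k U f" "\<And>x. x \<in> U - K \<Longrightarrow> f x = 0"
  shows "Cm_on k UNIV (\<lambda>x. if x \<in> U then f x else 0)"
proof -
  have "Cm_on k (- K) (\<lambda>x. if x \<in> U then f x else 0)"
    by (rule Cm_on_cong[of _ "\<lambda>_. 0"]) (use assms in auto)
  moreover have "Cm_on k U (\<lambda>x. if x \<in> U then f x else 0)"
    by (rule Cm_on_cong[of _ f]) (use assms in auto)
  ultimately have "Cm_on k (- K \<union> U) (\<lambda>x. if x \<in> U then f x else 0)"
    using assms by (intro Cm_on_Un) auto
  moreover have "- K \<union> U = UNIV" using assms by auto
  ultimately show ?thesis by simp
qed


subsection \<open>Derivatives along words\<close>

text \<open>
  \<^const>\<open>mi_deriv\<close> takes the derivatives in the order of a word of coordinates. The words of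
  multi-indices are closed under subsequences, so the Leibniz rule holds within them and the symmetry
  of mixed partial derivatives is never needed.
\<close>

definition mi_word :: "'n::finite multiindex \<Rightarrow> 'n list" where
  "mi_word \<alpha> = concat (map (\<lambda>i. replicate (Poly_Mapping.lookup \<alpha> i) i) coord_list)"

definition wderiv :: "'n::finite list \<Rightarrow> (real ^ 'n \<Rightarrow> real) \<Rightarrow> real ^ 'n \<Rightarrow> real" where
  "wderiv w f = foldr partial_deriv w f"

lemma wderiv_simps [simp]:
  "wderiv [] f = f"
  "wderiv (i # w) f = partial_deriv i (wderiv w f)"
  "wderiv (w @ v) f = wderiv w (wderiv v f)"
  by (simp_all add: wderiv_def)

lemma mi_deriv_eq_wderiv: "mi_deriv \<alpha> f = wderiv (mi_word \<alpha>) f"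
proof -
  have "wderiv (replicate k i) g = (partial_deriv i ^^ k) g" for k i and g :: "real ^ 'a \<Rightarrow> real"
    by (induction k) auto
  then have "foldr (\<lambda>i. partial_deriv i ^^ Poly_Mapping.lookup \<alpha> i) cs f
      = wderiv (concat (map (\<lambda>i. replicate (Poly_Mapping.lookup \<alpha> i) i) cs)) f" for cs
    by (induction cs) auto
  then show ?thesis by (simp add: mi_deriv_def mi_word_def)
qed

lemma coord_list:
  shows distinct_coord_list: "distinct (coord_list :: 'n::finite list)"
    and set_coord_list: "set (coord_list :: 'n list) = UNIV"
proof -
  have "distinct (coord_list :: 'n list) \<and> set (coord_list :: 'n list) = UNIV"
    unfolding coord_list_def
    by (rule someI_ex) (use finite_distinct_list[of "UNIV :: 'n set"] in auto)
  then show "distinct (coord_list :: 'n list)" "set (coord_list :: 'n list) = UNIV" by auto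
qed

lemma length_mi_word [simp]: "length (mi_word \<alpha>) = mi_deg \<alpha>"
  by (simp add: mi_word_def mi_deg_def length_concat comp_def sum_list_distinct_conv_sum_set coord_list)

lemma subseq_replicateE:
  assumes "subseq u (replicate k a)"
  obtains l where "u = replicate l a"
proof -
  have "x = a" if "x \<in> set u" for x
    using list_emb_set[OF assms that] by auto
  then have "u = replicate (length u) a"
    by (intro replicate_eqI) auto
  then show thesis by (rule that)
qed

text \<open>Deleting letters from a word sorted into blocks only shortens the blocks, so the result
  is again sorted in the order of \<open>coord_list\<close>.\<close>

lemma subseq_mi_wordE:
  assumes "subseq u (mi_word \<alpha>)"
  obtains \<beta> where "u = mi_word \<beta>"
proof -
  have "\<exists>b. u = concat (map (\<lambda>i. replicate (b i) i) cs)"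
    if "subseq u (concat (map (\<lambda>i. replicate (a i) i) cs))" "distinct cs" for a cs u
    using that
  proof (induction cs arbitrary: u)
    case Nil
    then show ?case by simp
  next
    case (Cons c cs)
    from Cons.prems(1)
    have "subseq u (replicate (a c) c @ concat (map (\<lambda>i. replicate (a i) i) cs))" by simp
    then obtain u1 u2 where u: "u = u1 @ u2" "subseq u1 (replicate (a c) c)"
        "subseq u2 (concat (map (\<lambda>i. replicate (a i) i) cs))"
      by (auto simp: subseq_append_iff)
    obtain l where l: "u1 = replicate l c" using u(2) by (rule subseq_replicateE)
    obtain b where b: "u2 = concat (map (\<lambda>i. replicate (b i) i) cs)"
      using Cons u by auto
    \<comment> \<open>\<open>c\<close> does not occur in \<open>cs\<close>, so the update leaves the
      other blocks alone.\<close>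
    have "map (\<lambda>i. replicate ((b(c := l)) i) i) cs = map (\<lambda>i. replicate (b i) i) cs"
      using Cons.prems by (intro map_cong) auto
    then have "concat (map (\<lambda>i. replicate ((b(c := l)) i) i) (c # cs)) = u"
      unfolding u(1) l b by (simp only: list.map concat.simps fun_upd_same)
    then show ?case by (intro exI[of _ "b(c := l)"]) (rule sym)
  qed
  from this[OF assms[unfolded mi_word_def] coord_list(1)] obtain b
    where "u = concat (map (\<lambda>i. replicate (b i) i) coord_list)" by blast
  then have "u = mi_word (Abs_poly_mapping b)"
    by (simp add: mi_word_def)
  then show thesis by (rule that)
qed

section \<open>Locality and additivity of iterated derivatives\<close>

lemma wderiv_cong:
  assumes "open U" "x \<in> U" "\<And>y. y \<in> U \<Longrightarrow> f y = g y"
  shows "wderiv w f x = wderiv w g x"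
  using assms(2)
proof (induction w arbitrary: x)
  case (Cons i w)
  then show ?case
    using partial_deriv_cong[OF assms(1) Cons.prems, of "wderiv w f" "wderiv w g"] by simp
qed (simp add: assms(3))

text \<open>Induction removes the innermost derivative: \<open>Cm_on\<close> unfolds at the function
  itself, so its hypotheses pass from \<open>f\<close> to \<open>partial_deriv i f\<close>.\<close>

lemma wderiv_add:
  assumes "open U" "x \<in> U" "Cm_on (length w) U f" "Cm_on (length w) U g"
  shows "wderiv w (\<lambda>x. f x + g x) x = wderiv w f x + wderiv w g x"
  using assms(3,4)
proof (induction w arbitrary: f g rule: rev_induct)
  case (snoc i w)
  have "wderiv (w @ [i]) (\<lambda>x. f x + g x) x
      = wderiv w (\<lambda>x. partial_deriv i f x + partial_deriv i g x) x"
    using snoc.prems by (simp, intro wderiv_cong[OF assms(1,2)] partial_deriv_add) auto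
  also have "\<dots> = wderiv (w @ [i]) f x + wderiv (w @ [i]) g x"
    using snoc.prems by (simp add: snoc.IH)
  finally show ?case .
qed simp

lemma wderiv_zero [simp]: "wderiv w (\<lambda>x. 0) x = 0"
proof -
  have "wderiv w (\<lambda>x. 0) = (\<lambda>x. 0)" by (induction w) auto
  then show ?thesis by simp
qed

lemma mi_deriv_cong:
  assumes "open U" "x \<in> U" "\<And>y. y \<in> U \<Longrightarrow> f y = g y"
  shows "mi_deriv \<alpha> f x = mi_deriv \<alpha> g x"
  unfolding mi_deriv_eq_wderiv by (rule wderiv_cong[OF assms])

lemma mi_deriv_0 [simp]: "mi_deriv 0 f = f"
proof -
  have "length (mi_word (0 :: 'a multiindex)) = 0" by (simp add: mi_deg_def)
  then have "mi_word (0 :: 'a multiindex) = []" by (simp only: length_0_conv)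
  then show ?thesis by (simp add: mi_deriv_eq_wderiv)
qed

lemma mi_deriv_zero [simp]: "mi_deriv \<alpha> (\<lambda>x. 0) x = 0"
  by (simp add: mi_deriv_eq_wderiv)

lemma mi_deriv_add:
  assumes "open U" "x \<in> U" "Cm_on m U f" "Cm_on m U g" "mi_deg \<alpha> \<le> m"
  shows "mi_deriv \<alpha> (\<lambda>x. f x + g x) x = mi_deriv \<alpha> f x + mi_deriv \<alpha> g x"
  unfolding mi_deriv_eq_wderiv
  by (rule wderiv_add[OF assms(1,2)]) (use assms Cm_on_le in auto)

lemma mi_deriv_diff:
  assumes "open U" "x \<in> U" "Cm_on m U f" "Cm_on m U g" "mi_deg \<alpha> \<le> m"
  shows "mi_deriv \<alpha> (\<lambda>x. f x - g x) x = mi_deriv \<alpha> f x - mi_deriv \<alpha> g x"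
  using mi_deriv_add[OF assms(1,2) Cm_on_diff[OF assms(1,3,4)] assms(4,5)] by simp


section \<open>Scale-invariant bounds on jets\<close>

text \<open>Equivalently, \<open>f\<close>, rescaled so that length \<open>s\<close> becomes 1, has
  derivatives bounded by \<open>A\<close>. In these terms the remainders are bounded by
  \<open>\<epsilon> * \<rho> ^ m\<close> and the multipliers by a constant, both at scale
  \<rho>.\<close>

definition jet_bound :: "nat \<Rightarrow> real \<Rightarrow> real \<Rightarrow> (real ^ 'n::finite \<Rightarrow> real) \<Rightarrow> real ^ 'n \<Rightarrow> bool" where
  "jet_bound m s A f x \<longleftrightarrow> (\<forall>\<alpha>. mi_deg \<alpha> \<le> m \<longrightarrow> \<bar>mi_deriv \<alpha> f x\<bar> \<le> A / s ^ mi_deg \<alpha>)"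

lemma jet_boundD: "jet_bound m s A f x \<Longrightarrow> mi_deg \<alpha> \<le> m \<Longrightarrow> \<bar>mi_deriv \<alpha> f x\<bar> \<le> A / s ^ mi_deg \<alpha>"
  by (simp add: jet_bound_def)

lemma jet_bound_nonneg: "jet_bound m s A f x \<Longrightarrow> A \<ge> 0"
  using jet_boundD[of m s A f x 0] by (simp add: mi_deg_def)

lemma jet_bound_mono:
  assumes "jet_bound m s A f x" "A \<le> B" "s > 0"
  shows "jet_bound m s B f x"
  unfolding jet_bound_def
  using assms by (meson divide_right_mono jet_boundD order.trans zero_le_power less_imp_le)

text \<open>Coarsening the scale by a factor \<open>K\<close> costs \<open>K ^ m\<close>; the case
  \<open>K = 1\<close> says that refining the scale costs nothing.\<close>

lemma jet_bound_rescale: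
  assumes "jet_bound m s A f x" "s > 0" "t > 0" "t \<le> K * s" "K \<ge> 1"
  shows "jet_bound m t (K ^ m * A) f x"
  unfolding jet_bound_def
proof safe
  fix \<alpha> :: "'a multiindex" assume a: "mi_deg \<alpha> \<le> m"
  have A: "A \<ge> 0" using assms(1) by (rule jet_bound_nonneg)
  have "A * t ^ mi_deg \<alpha> \<le> A * (K * s) ^ mi_deg \<alpha>"
    using assms A by (intro mult_left_mono power_mono) auto
  also have "\<dots> \<le> A * (K ^ m * s ^ mi_deg \<alpha>)"
    using assms A a by (auto simp: power_mult_distrib intro!: mult_left_mono mult_right_mono power_increasing)
  finally have "A / s ^ mi_deg \<alpha> \<le> K ^ m * A / t ^ mi_deg \<alpha>"
    using assms by (simp add: divide_simps mult_ac)
  with jet_boundD[OF assms(1) a] show "\<bar>mi_deriv \<alpha> f x\<bar> \<le> K ^ m * A / t ^ mi_deg \<alpha>" by simp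
qed

lemma jet_bound_cong:
  assumes "open U" "x \<in> U" "\<And>y. y \<in> U \<Longrightarrow> f y = g y"
  shows "jet_bound m s A f x \<longleftrightarrow> jet_bound m s A g x"
  unfolding jet_bound_def by (simp add: mi_deriv_cong[OF assms])

lemma jet_bound_zero:
  assumes "open U" "x \<in> U" "\<And>y. y \<in> U \<Longrightarrow> f y = 0" "A \<ge> 0" "s > 0"
  shows "jet_bound m s A f x"
  by (subst jet_bound_cong[OF assms(1-3)]) (use assms(4,5) in \<open>auto simp: jet_bound_def\<close>)

lemma jet_bound_add:
  assumes "open U" "x \<in> U" "Cm_on m U f" "Cm_on m U g"
    "jet_bound m s A f x" "jet_bound m s B g x"
  shows "jet_bound m s (A + B) (\<lambda>x. f x + g x) x"
  unfolding jet_bound_def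
proof safe
  fix \<alpha> :: "'a multiindex" assume a: "mi_deg \<alpha> \<le> m"
  show "\<bar>mi_deriv \<alpha> (\<lambda>x. f x + g x) x\<bar> \<le> (A + B) / s ^ mi_deg \<alpha>"
    using jet_boundD[OF assms(5) a] jet_boundD[OF assms(6) a]
    by (simp add: mi_deriv_add[OF assms(1-4) a] add_divide_distrib)
qed

text \<open>Leibniz rule: the letters of \<open>w\<close> are shared out between \<open>f\<close>
  and \<open>g\<close>, in order, in \<open>2 ^ length w\<close> ways, so each factor is
  differentiated along a subsequence of \<open>w\<close>.\<close>

lemma wderiv_mult_bound:
  fixes f g :: "real ^ 'n::finite \<Rightarrow> real"
  assumes "open U" "x \<in> U" "s > 0" "Cm_on (length w) U f" "Cm_on (length w) U g"
    "\<And>u. subseq u w \<Longrightarrow> \<bar>wderiv u f x\<bar> \<le> A / s ^ length u"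
    "\<And>u. subseq u w \<Longrightarrow> \<bar>wderiv u g x\<bar> \<le> B / s ^ length u"
  shows "\<bar>wderiv w (\<lambda>x. f x * g x) x\<bar> \<le> 2 ^ length w * A * B / s ^ length w"
  using assms(4-)
proof (induction w arbitrary: f g A B rule: rev_induct)
  case Nil
  from Nil.prems(3,4)[of "[]"] show ?case
    by (auto simp: abs_mult intro!: mult_mono)
next
  case (snoc i w)
  let ?f' = "partial_deriv i f" and ?g' = "partial_deriv i g"
  have C: "Cm_on (Suc (length w)) U f" "Cm_on (Suc (length w)) U g" using snoc.prems by auto
  note C' = C[THEN Cm_on_SucD]
  have C'': "Cm_on (length w) U ?f'" "Cm_on (length w) U ?g'" using C by auto
  \<comment> \<open>If \<open>u\<close> is a subsequence of \<open>w\<close>, then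
    \<open>u @ [i]\<close> is one of \<open>w @ [i]\<close>; this bounds the derivatives of
    \<open>?f'\<close> and \<open>?g'\<close> at the price of one factor
    \<open>1 / s\<close>.\<close>
  have bnd: "\<bar>wderiv u f x\<bar> \<le> A / s ^ length u" "\<bar>wderiv u g x\<bar> \<le> B / s ^ length u"
    "\<bar>wderiv u ?f' x\<bar> \<le> (A / s) / s ^ length u" "\<bar>wderiv u ?g' x\<bar> \<le> (B / s) / s ^ length u"
    if "subseq u w" for u
    using that snoc.prems(3,4)[of u] snoc.prems(3,4)[of "u @ [i]"]
      subseq_order.trans[of u w "w @ [i]"]
    by (auto simp: list_emb_append2)
  have "wderiv (w @ [i]) (\<lambda>x. f x * g x) x = wderiv w (\<lambda>x. ?f' x * g x + f x * ?g' x) x"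
    using C by (simp, intro wderiv_cong[OF assms(1,2)] partial_deriv_mult) auto
  also have "\<dots> = wderiv w (\<lambda>x. ?f' x * g x) x + wderiv w (\<lambda>x. f x * ?g' x) x"
    by (intro wderiv_add[OF assms(1,2)] Cm_on_mult[OF assms(1)] C' C'')
  finally have "\<bar>wderiv (w @ [i]) (\<lambda>x. f x * g x) x\<bar>
      \<le> \<bar>wderiv w (\<lambda>x. ?f' x * g x) x\<bar> + \<bar>wderiv w (\<lambda>x. f x * ?g' x) x\<bar>" by simp
  also have "\<dots> \<le> 2 ^ length w * (A / s) * B / s ^ length w + 2 ^ length w * A * (B / s) / s ^ length w"
    by (intro add_mono snoc.IH C' C'' bnd)
  finally show ?case by (simp add: field_simps)
qed

lemma jet_bound_mult:
  fixes f g :: "real ^ 'n::finite \<Rightarrow> real"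
  assumes "open U" "x \<in> U" "Cm_on m U f" "Cm_on m U g" "s > 0"
    "jet_bound m s A f x" "jet_bound m s B g x"
  shows "jet_bound m s (2 ^ m * A * B) (\<lambda>x. f x * g x) x"
  unfolding jet_bound_def
proof safe
  fix \<alpha> :: "'n multiindex" assume a: "mi_deg \<alpha> \<le> m"
  have AB: "A \<ge> 0" "B \<ge> 0" using assms jet_bound_nonneg by blast+
  have "\<bar>wderiv (mi_word \<alpha>) (\<lambda>x. f x * g x) x\<bar>
      \<le> 2 ^ length (mi_word \<alpha>) * A * B / s ^ length (mi_word \<alpha>)"
  proof (rule wderiv_mult_bound[OF assms(1,2,5)])
    show "Cm_on (length (mi_word \<alpha>)) U f" "Cm_on (length (mi_word \<alpha>)) U g"
      using assms(3,4) a Cm_on_le by auto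
  next
    fix u assume u: "subseq u (mi_word \<alpha>)"
    then obtain \<beta> where \<beta>: "u = mi_word \<beta>" by (rule subseq_mi_wordE)
    have le: "mi_deg \<beta> \<le> m" using a list_emb_length[OF u] by (simp add: \<beta>)
    show "\<bar>wderiv u f x\<bar> \<le> A / s ^ length u" "\<bar>wderiv u g x\<bar> \<le> B / s ^ length u"
      using jet_boundD[OF assms(6) le] jet_boundD[OF assms(7) le]
      by (simp_all add: \<beta> mi_deriv_eq_wderiv)
  qed
  also have "\<dots> \<le> 2 ^ m * A * B / s ^ mi_deg \<alpha>"
    using a assms(5) AB by (auto intro!: divide_right_mono mult_right_mono power_increasing)
  finally show "\<bar>mi_deriv \<alpha> (\<lambda>x. f x * g x) x\<bar> \<le> 2 ^ m * A * B / s ^ mi_deg \<alpha>"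
    by (simp add: mi_deriv_eq_wderiv)
qed

lemma jet_bound_const: "c \<ge> 0 \<Longrightarrow> s > 0 \<Longrightarrow> jet_bound m s c (\<lambda>x. c) x"
proof -
  assume "c \<ge> 0" "s > 0"
  have "\<bar>wderiv w (\<lambda>x. c) x\<bar> \<le> c / s ^ length w" for w
  proof (cases w rule: rev_cases)
    case Nil
    with \<open>c \<ge> 0\<close> show ?thesis by simp
  next
    case (snoc v i)
    with \<open>c \<ge> 0\<close> \<open>s > 0\<close> show ?thesis by simp
  qed
  from this[of "mi_word _"] show ?thesis by (simp add: jet_bound_def mi_deriv_eq_wderiv)
qed

lemma jet_bound_uminus:
  assumes "open U" "x \<in> U" "Cm_on m U f" "jet_bound m s A f x"
  shows "jet_bound m s A (\<lambda>x. - f x) x"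
proof -
  have "mi_deriv \<alpha> (\<lambda>x. - f x) x = - mi_deriv \<alpha> f x" if "mi_deg \<alpha> \<le> m" for \<alpha>
    using mi_deriv_diff[OF assms(1,2) Cm_on_const[of m U 0] assms(3) that] by simp
  then show ?thesis using assms(4) by (simp add: jet_bound_def)
qed

lemma jet_bound_diff:
  assumes "open U" "x \<in> U" "Cm_on m U f" "Cm_on m U g"
    "jet_bound m s A f x" "jet_bound m s B g x"
  shows "jet_bound m s (A + B) (\<lambda>x. f x - g x) x"
  using jet_bound_add[OF assms(1-3) _ assms(5) jet_bound_uminus[OF assms(1,2,4,6)]]
    Cm_on_diff[OF assms(1) Cm_on_const[of m U 0] assms(4)] by simp

lemma jet_bound_sum:
  assumes "open U" "x \<in> U" "s > 0" "\<And>z. z \<in> Z \<Longrightarrow> Cm_on m U (f z)"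
    "\<And>z. z \<in> Z \<Longrightarrow> jet_bound m s (A z) (f z) x"
  shows "jet_bound m s (\<Sum>z\<in>Z. A z) (\<lambda>x. \<Sum>z\<in>Z. f z x) x"
  using assms(4,5)
proof (induction Z rule: infinite_finite_induct)
  case (insert z Z)
  then show ?case
    using jet_bound_add[OF assms(1,2), of m "f z" "\<lambda>x. \<Sum>z\<in>Z. f z x"] Cm_on_sum[OF assms(1), of Z m f]
    by simp
qed (use jet_bound_const[of 0 s] assms(3) in auto)

text \<open>Only the terms alive at \<open>x\<close> are counted, so the bound depends on the
  overlap \<open>N\<close> and not on the number of grid points, which grows as the mesh
  shrinks.\<close>

lemma jet_bound_sum_local:
  assumes "open U" "x \<in> U" "s > 0" "\<And>z. z \<in> Z \<Longrightarrow> Cm_on m U (f z)"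
    "\<And>z. z \<in> Z \<Longrightarrow> P z \<Longrightarrow> jet_bound m s A (f z) x"
    "\<And>z. z \<in> Z \<Longrightarrow> \<not> P z \<Longrightarrow> jet_bound m s 0 (f z) x"
    "finite Z" "card {z \<in> Z. P z} \<le> N" "A \<ge> 0"
  shows "jet_bound m s (real N * A) (\<lambda>x. \<Sum>z\<in>Z. f z x) x"
proof -
  have "jet_bound m s (\<Sum>z\<in>Z. if P z then A else 0) (\<lambda>x. \<Sum>z\<in>Z. f z x) x"
    using assms by (intro jet_bound_sum) auto
  moreover have "(\<Sum>z\<in>Z. if P z then A else 0) = real (card {z \<in> Z. P z}) * A"
    using assms(7) by (simp add: sum.If_cases Int_def)
  moreover have "\<dots> \<le> real N * A"
    using assms by (intro mult_right_mono) auto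
  ultimately show ?thesis using jet_bound_mono assms(3) by metis
qed

lemma jet_bound_prod:
  fixes f :: "'a \<Rightarrow> real ^ 'n::finite \<Rightarrow> real"
  assumes "open U" "x \<in> U" "s > 0" "finite Z" "\<And>z. z \<in> Z \<Longrightarrow> Cm_on m U (f z)"
    "\<And>z. z \<in> Z \<Longrightarrow> jet_bound m s A (f z) x"
  shows "jet_bound m s ((2 ^ m * A) ^ card Z) (\<lambda>x. \<Prod>z\<in>Z. f z x) x"
  using assms(4-)
proof (induction Z rule: finite_induct)
  case (insert z Z)
  have "jet_bound m s (2 ^ m * A * (2 ^ m * A) ^ card Z) (\<lambda>x. f z x * (\<Prod>z\<in>Z. f z x)) x"
    using insert by (intro jet_bound_mult[OF assms(1,2) _ _ assms(3)] Cm_on_prod[OF assms(1)]) auto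
  with insert.hyps show ?case by simp
qed (use jet_bound_const[of 1 s] assms(3) in auto)

section \<open>Taylor polynomials\<close>

text \<open>\<open>partial_deriv\<close> is read off the total derivative, which a derivative along
  one line does not provide; given differentiability, one-variable calculus identifies its
  value.\<close>

lemma partial_derivI:
  fixes f :: "real ^ 'n::finite \<Rightarrow> real"
  assumes "f differentiable at x"
    and "((\<lambda>t. f (x + t *\<^sub>R axis i 1)) has_real_derivative D) (at 0)"
  shows "partial_deriv i f x = D"
proof -
  have "((\<lambda>t. x + t *\<^sub>R axis i 1) has_derivative (\<lambda>t. t *\<^sub>R axis i 1)) (at 0)"
    by (auto intro!: derivative_eq_intros)
  moreover have "(f has_derivative frechet_derivative f (at x)) (at (x + 0 *\<^sub>R axis i 1))"
    using assms(1) by (simp flip: frechet_derivative_works)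
  ultimately have "((\<lambda>t. f (x + t *\<^sub>R axis i 1)) has_derivative
      (\<lambda>t. frechet_derivative f (at x) (t *\<^sub>R axis i 1))) (at 0)"
    by (rule has_derivative_compose)
  from has_derivative_unique[OF this assms(2)[unfolded has_field_derivative_def]]
  have "frechet_derivative f (at x) (1 *\<^sub>R axis i 1) = D * 1" by (rule fun_cong)
  then show ?thesis by (simp add: partial_deriv_def)
qed

section \<open>Monomials as products of one-variable functions\<close>

lemma separable_deriv:
  fixes g :: "'n::finite \<Rightarrow> real \<Rightarrow> real"
  assumes "\<And>j. (g j has_real_derivative g' j) (at (x $ j))"
  shows separable_differentiable: "(\<lambda>x. \<Prod>j\<in>UNIV. g j (x $ j)) differentiable at x"
    and DERIV_separable: "((\<lambda>t. \<Prod>j\<in>UNIV. g j ((x + t *\<^sub>R axis i 1) $ j))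
      has_real_derivative g' i * (\<Prod>j\<in>UNIV - {i}. g j (x $ j))) (at 0)"
proof -
  have "((\<lambda>x. g j (x $ j)) has_derivative (\<lambda>h. g' j * h $ j)) (at x)" for j
    using has_derivative_compose[OF bounded_linear.has_derivative[OF bounded_linear_vec_nth has_derivative_ident]
      assms[of j, unfolded has_field_derivative_def]] by simp
  from has_derivative_prod[OF this, of "\<lambda>j. j" UNIV]
  show "(\<lambda>x. \<Prod>j\<in>UNIV. g j (x $ j)) differentiable at x"
    unfolding differentiable_def by blast
  have "(\<Prod>j\<in>UNIV. g j ((x + t *\<^sub>R axis i 1) $ j))
      = g i (x $ i + t) * (\<Prod>j\<in>UNIV - {i}. g j (x $ j))" for t
    by (subst prod.remove[of UNIV i]) (auto simp: axis_def intro!: prod.cong arg_cong2[of _ _ _ _ "(*)"])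
  moreover have "((\<lambda>t. g i (x $ i + t) * (\<Prod>j\<in>UNIV - {i}. g j (x $ j)))
      has_real_derivative g' i * (\<Prod>j\<in>UNIV - {i}. g j (x $ j))) (at 0)"
    using assms[of i] DERIV_shift[of "g i" "g' i" 0 "x $ i"]
    by (intro DERIV_cmult_right) (simp add: add.commute)
  ultimately show "((\<lambda>t. \<Prod>j\<in>UNIV. g j ((x + t *\<^sub>R axis i 1) $ j))
      has_real_derivative g' i * (\<Prod>j\<in>UNIV - {i}. g j (x $ j))) (at 0)" by simp
qed

text \<open>With the factorials divided out, differentiation lowers an exponent without a
  coefficient and the binomial theorem has coefficients 1, so calculus with Taylor polynomials
  becomes bookkeeping of indices.\<close>

definition mi_monom :: "'n::finite multiindex \<Rightarrow> real ^ 'n \<Rightarrow> real" where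
  "mi_monom \<gamma> u = (\<Prod>i\<in>UNIV. (u $ i) ^ Poly_Mapping.lookup \<gamma> i / fact (Poly_Mapping.lookup \<gamma> i))"

lemma mi_monom_eq: "mi_monom \<gamma> u = 1 / mi_fact \<gamma> * mi_power u \<gamma>"
  by (simp add: mi_monom_def mi_fact_def mi_power_def prod_dividef)

definition mi_unit :: "'n::finite \<Rightarrow> 'n multiindex" where
  "mi_unit i = Poly_Mapping.single i 1"

lemma mi_deg_0 [simp]: "mi_deg 0 = 0"
  by (simp add: mi_deg_def)

lemma lookup_mi_unit [simp]: "Poly_Mapping.lookup (mi_unit i) j = (if i = j then 1 else 0)"
  by (simp add: mi_unit_def lookup_single when_def)

lemma mi_deg_unit [simp]: "mi_deg (mi_unit i) = 1"
  by (simp add: mi_deg_def)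

lemma mi_deg_minus_unit: "Poly_Mapping.lookup \<gamma> i \<noteq> 0 \<Longrightarrow> \<gamma> - mi_unit i + mi_unit i = \<gamma>"
  by (rule poly_mapping_eqI) (auto simp: lookup_add lookup_minus)

lemma mi_monom_deriv:
  shows mi_monom_differentiable: "(\<lambda>x. mi_monom \<gamma> (x - y)) differentiable at x"
    and DERIV_mi_monom: "((\<lambda>t. mi_monom \<gamma> (x + t *\<^sub>R axis i 1 - y)) has_real_derivative
      (if Poly_Mapping.lookup \<gamma> i = 0 then 0 else mi_monom (\<gamma> - mi_unit i) (x - y))) (at 0)"
proof -
  define g where "g = (\<lambda>j t. (t - y $ j) ^ Poly_Mapping.lookup \<gamma> j / fact (Poly_Mapping.lookup \<gamma> j))"
  \<comment> \<open>At exponent 0 the truncated subtraction would give 1 in place of the derivative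
    0.\<close>
  define g' where "g' = (\<lambda>j. if Poly_Mapping.lookup \<gamma> j = 0 then 0
    else (x $ j - y $ j) ^ (Poly_Mapping.lookup \<gamma> j - 1) / fact (Poly_Mapping.lookup \<gamma> j - 1))"
  have g: "(g j has_real_derivative g' j) (at (x $ j))" for j
  proof (cases "Poly_Mapping.lookup \<gamma> j")
    case 0
    then show ?thesis by (simp add: g_def g'_def)
  next
    case (Suc k)
    have "((\<lambda>t. (t - y $ j) ^ Suc k / fact (Suc k)) has_real_derivative
        real (Suc k) * (1 * (x $ j - y $ j) ^ (Suc k - Suc 0)) / fact (Suc k)) (at (x $ j))"
      by (intro DERIV_cdivide DERIV_power) (auto intro!: derivative_eq_intros)
    moreover have "real (Suc k) * (1 * (x $ j - y $ j) ^ (Suc k - Suc 0)) / fact (Suc k) = (x $ j - y $ j) ^ k / fact k"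
      by (simp add: divide_simps del: of_nat_Suc)
    ultimately show ?thesis
      using Suc by (simp add: g_def g'_def)
  qed
  have eq: "mi_monom \<gamma> (x - y) = (\<Prod>j\<in>UNIV. g j (x $ j))" for x
    by (simp add: mi_monom_def g_def)
  show "(\<lambda>x. mi_monom \<gamma> (x - y)) differentiable at x"
    unfolding eq by (rule separable_differentiable[OF g])
  have "(if Poly_Mapping.lookup \<gamma> i = 0 then 0 else mi_monom (\<gamma> - mi_unit i) (x - y))
      = g' i * (\<Prod>j\<in>UNIV - {i}. g j (x $ j))"
    by (auto simp: mi_monom_def g_def g'_def prod.remove[of UNIV i] lookup_minus intro!: prod.cong)
  then show "((\<lambda>t. mi_monom \<gamma> (x + t *\<^sub>R axis i 1 - y)) has_real_derivative
      (if Poly_Mapping.lookup \<gamma> i = 0 then 0 else mi_monom (\<gamma> - mi_unit i) (x - y))) (at 0)"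
    unfolding eq by (simp only: DERIV_separable[OF g])
qed

lemma mi_monom_bound: "\<bar>mi_monom \<gamma> u\<bar> \<le> norm u ^ mi_deg \<gamma>"
proof -
  have "\<bar>mi_monom \<gamma> u\<bar> = (\<Prod>i\<in>UNIV. \<bar>u $ i\<bar> ^ Poly_Mapping.lookup \<gamma> i / fact (Poly_Mapping.lookup \<gamma> i))"
    by (simp add: mi_monom_def abs_prod power_abs)
  also have "\<dots> \<le> (\<Prod>i\<in>UNIV. norm u ^ Poly_Mapping.lookup \<gamma> i / 1)"
    by (intro prod_mono conjI frac_le power_mono component_le_norm_cart fact_ge_1) auto
  finally show ?thesis by (simp add: mi_deg_def power_sum)
qed

text \<open>The binomial theorem holds in each coordinate. Expanding the product of the sums picks
  one exponent per coordinate; such a choice is the multi-index \<alpha>, and \<beta> is the rest of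
  \<gamma>.\<close>

lemma mi_monom_add:
  fixes \<gamma> :: "'n::finite multiindex"
  shows "mi_monom \<gamma> (u + v) = (\<Sum>(\<alpha>, \<beta>) | \<alpha> + \<beta> = \<gamma>. mi_monom \<alpha> u * mi_monom \<beta> v)"
proof -
  let ?l = "Poly_Mapping.lookup"
  let ?h = "\<lambda>i k. (u $ i) ^ k / fact k * ((v $ i) ^ (?l \<gamma> i - k) / fact (?l \<gamma> i - k))"
  have "(u $ i + v $ i) ^ n / fact n = (\<Sum>k\<le>n. (u $ i) ^ k / fact k * ((v $ i) ^ (n - k) / fact (n - k)))"
    for i n
    by (simp add: binomial_ring binomial_fact sum_divide_distrib field_simps)
  then have "mi_monom \<gamma> (u + v) = (\<Prod>i\<in>UNIV. \<Sum>k\<le>?l \<gamma> i. ?h i k)"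
    by (simp add: mi_monom_def)
  also have "\<dots> = (\<Sum>b\<in>(\<Pi>\<^sub>E i\<in>UNIV. {..?l \<gamma> i}). \<Prod>i\<in>UNIV. ?h i (b i))"
    by (rule prod_sum_PiE) auto
  also have "\<dots> = (\<Sum>(\<alpha>, \<beta>) | \<alpha> + \<beta> = \<gamma>. mi_monom \<alpha> u * mi_monom \<beta> v)"
  proof (rule sum.reindex_bij_witness[of _ "\<lambda>(\<alpha>, \<beta>). ?l \<alpha>"
        "\<lambda>b. (Abs_poly_mapping b, \<gamma> - Abs_poly_mapping b)"])
    fix b assume b: "b \<in> (\<Pi>\<^sub>E i\<in>UNIV. {..?l \<gamma> i})"
    then show "(Abs_poly_mapping b, \<gamma> - Abs_poly_mapping b) \<in> {(\<alpha>, \<beta>). \<alpha> + \<beta> = \<gamma>}"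
      by (auto intro!: poly_mapping_eqI simp: lookup_add lookup_minus PiE_def Pi_def)
    show "(case (Abs_poly_mapping b, \<gamma> - Abs_poly_mapping b) of
        (\<alpha>, \<beta>) \<Rightarrow> mi_monom \<alpha> u * mi_monom \<beta> v) = (\<Prod>i\<in>UNIV. ?h i (b i))"
      by (simp add: mi_monom_def lookup_minus flip: prod.distrib)
  qed (auto simp: lookup_add lookup_minus PiE_def Pi_def lookup_inverse le_iff_add)
  finally show ?thesis .
qed

text \<open>
  \<open>a\<close> is the family of derivatives at \<open>y\<close>. It is always assumed to vanish above degree \<open>m\<close>, so that
  differentiation becomes a shift of \<open>a\<close> with the range of summation unchanged.
\<close>

definition taylor_poly :: "nat \<Rightarrow> ('n::finite multiindex \<Rightarrow> real) \<Rightarrow> real ^ 'n \<Rightarrow> real ^ 'n \<Rightarrow> real" where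
  "taylor_poly m a y x = (\<Sum>\<gamma> | mi_deg \<gamma> \<le> m. a \<gamma> * mi_monom \<gamma> (x - y))"

lemma taylor_poly_deriv:
  assumes "\<And>\<gamma>. mi_deg \<gamma> > m \<Longrightarrow> a \<gamma> = 0"
  shows taylor_poly_differentiable: "taylor_poly m a y differentiable at x"
    and partial_deriv_taylor_poly:
      "partial_deriv i (taylor_poly m a y) = taylor_poly m (\<lambda>\<gamma>. a (\<gamma> + mi_unit i)) y"
proof -
  have diff: "taylor_poly m a y differentiable at x" for x
    unfolding taylor_poly_def
    by (intro differentiable_sum ballI differentiable_mult differentiable_const
        mi_monom_differentiable finite_mi_deg_le)
  show "taylor_poly m a y differentiable at x" by (rule diff)
  show "partial_deriv i (taylor_poly m a y) = taylor_poly m (\<lambda>\<gamma>. a (\<gamma> + mi_unit i)) y"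
  proof
    fix x
    let ?D = "\<lambda>\<gamma>. if Poly_Mapping.lookup \<gamma> i = 0 then 0 else mi_monom (\<gamma> - mi_unit i) (x - y)"
    have "((\<lambda>t. taylor_poly m a y (x + t *\<^sub>R axis i 1)) has_real_derivative
        (\<Sum>\<gamma> | mi_deg \<gamma> \<le> m. a \<gamma> * ?D \<gamma>)) (at 0)"
      unfolding taylor_poly_def by (intro DERIV_sum DERIV_cmult DERIV_mi_monom)
    then have "partial_deriv i (taylor_poly m a y) x = (\<Sum>\<gamma> | mi_deg \<gamma> \<le> m. a \<gamma> * ?D \<gamma>)"
      by (rule partial_derivI[OF diff])
    also have "\<dots> = (\<Sum>\<gamma> | mi_deg \<gamma> \<le> m \<and> Poly_Mapping.lookup \<gamma> i \<noteq> 0.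
        a \<gamma> * mi_monom (\<gamma> - mi_unit i) (x - y))"
      using finite_mi_deg_le[of m] by (intro sum.mono_neutral_cong_right) auto
    also have "\<dots> = (\<Sum>\<gamma> | mi_deg \<gamma> + 1 \<le> m. a (\<gamma> + mi_unit i) * mi_monom \<gamma> (x - y))"
    proof (rule sum.reindex_bij_witness[of _ "\<lambda>\<gamma>. \<gamma> + mi_unit i" "\<lambda>\<gamma>. \<gamma> - mi_unit i"])
      fix \<gamma> assume "\<gamma> \<in> {\<gamma>. mi_deg \<gamma> \<le> m \<and> Poly_Mapping.lookup \<gamma> i \<noteq> 0}"
      then show "\<gamma> - mi_unit i + mi_unit i = \<gamma>" "\<gamma> - mi_unit i \<in> {\<gamma>. mi_deg \<gamma> + 1 \<le> m}"
        using mi_deg_add[of "\<gamma> - mi_unit i" "mi_unit i"] by (auto simp: mi_deg_minus_unit)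
    qed (auto simp: mi_deg_add mi_deg_minus_unit lookup_add poly_mapping_eqI lookup_minus)
    \<comment> \<open>The monomials of degree \<open>m\<close> are added back: their coefficients
      are entries of \<open>a\<close> of degree \<open>m + 1\<close>, which vanish.\<close>
    also have "\<dots> = taylor_poly m (\<lambda>\<gamma>. a (\<gamma> + mi_unit i)) y x"
      unfolding taylor_poly_def using finite_mi_deg_le[of m] assms
      by (intro sum.mono_neutral_left) (auto simp: mi_deg_add)
    finally show "partial_deriv i (taylor_poly m a y) x = taylor_poly m (\<lambda>\<gamma>. a (\<gamma> + mi_unit i)) y x" .
  qed
qed

lemma Cm_on_taylor_poly:
  assumes "\<And>\<gamma>. mi_deg \<gamma> > m \<Longrightarrow> a \<gamma> = 0"
  shows "Cm_on k U (taylor_poly m a y)"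
  using assms
proof (induction k arbitrary: a)
  case 0
  then show ?case
    using taylor_poly_differentiable[of m a y]
    by (auto intro!: continuous_at_imp_continuous_on differentiable_imp_continuous_within)
next
  case (Suc k)
  have "Cm_on k U (taylor_poly m (\<lambda>\<gamma>. a (\<gamma> + mi_unit i)) y)" for i
    by (rule Suc.IH) (simp add: Suc.prems mi_deg_add)
  with taylor_poly_differentiable[of m a] partial_deriv_taylor_poly[of m a] Suc.prems
  show ?case by simp
qed

lemma sum_list_mi_word:
  fixes \<alpha> :: "'n::finite multiindex"
  shows "sum_list (map mi_unit (mi_word \<alpha>)) = \<alpha>"
proof (rule poly_mapping_eqI)
  fix i :: 'n
  have r: "Poly_Mapping.lookup (sum_list (map mi_unit (replicate k j))) i = (if i = j then k else 0)" for k j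
    by (induction k) (auto simp: lookup_add)
  have "Poly_Mapping.lookup
      (sum_list (map mi_unit (concat (map (\<lambda>j. replicate (Poly_Mapping.lookup \<alpha> j) j) cs)))) i
      = (if i \<in> set cs then Poly_Mapping.lookup \<alpha> i else 0)" if "distinct cs" for cs
    using that by (induction cs) (auto simp: lookup_add r simp del: map_replicate)
  from this[OF distinct_coord_list] show
    "Poly_Mapping.lookup (sum_list (map mi_unit (mi_word \<alpha>))) i = Poly_Mapping.lookup \<alpha> i"
    by (simp add: mi_word_def set_coord_list)
qed

lemma mi_deriv_taylor_poly:
  assumes "\<And>\<gamma>. mi_deg \<gamma> > m \<Longrightarrow> a \<gamma> = 0"
  shows "mi_deriv \<alpha> (taylor_poly m a y) = taylor_poly m (\<lambda>\<gamma>. a (\<gamma> + \<alpha>)) y"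
proof -
  have "wderiv w (taylor_poly m a y) = taylor_poly m (\<lambda>\<gamma>. a (\<gamma> + sum_list (map mi_unit w))) y" for w
  proof (induction w)
    case (Cons i w)
    then show ?case
      using partial_deriv_taylor_poly[of m "\<lambda>\<gamma>. a (\<gamma> + sum_list (map mi_unit w))" i y] assms
      by (simp add: mi_deg_add add_ac)
  qed simp
  then show ?thesis by (simp add: mi_deriv_eq_wderiv sum_list_mi_word)
qed

text \<open>A polynomial equals its Taylor expansion about any other point: expand
  \<open>x - y = (z - y) + (x - z)\<close> and collect the powers of \<open>x - z\<close>.\<close>

lemma taylor_poly_recenter:
  assumes "\<And>\<gamma>. mi_deg \<gamma> > m \<Longrightarrow> a \<gamma> = 0"
  shows "taylor_poly m a y x = taylor_poly m (\<lambda>\<gamma>. taylor_poly m (\<lambda>\<beta>. a (\<beta> + \<gamma>)) y z) z x"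
proof -
  let ?D = "{\<gamma> :: 'a multiindex. mi_deg \<gamma> \<le> m}"
  let ?S = "{p \<in> ?D \<times> ?D. mi_deg (fst p + snd p) \<le> m}"
  let ?h = "\<lambda>(\<alpha>, \<beta>). a (\<alpha> + \<beta>) * (mi_monom \<alpha> (z - y) * mi_monom \<beta> (x - z))"
  have fin: "finite ?D" by (rule finite_mi_deg_le)
  have "taylor_poly m a y x = (\<Sum>\<gamma>\<in>?D. a \<gamma> * mi_monom \<gamma> ((z - y) + (x - z)))"
    by (simp add: taylor_poly_def)
  also have "\<dots> = (\<Sum>\<gamma>\<in>?D. \<Sum>p\<in>{p \<in> ?S. fst p + snd p = \<gamma>}. ?h p)"
  proof (rule sum.cong)
    fix \<gamma> assume "\<gamma> \<in> ?D"
    then have "{p \<in> ?S. fst p + snd p = \<gamma>} = {(\<alpha>, \<beta>). \<alpha> + \<beta> = \<gamma>}"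
      by (auto simp: mi_deg_add)
    then show "a \<gamma> * mi_monom \<gamma> ((z - y) + (x - z)) = (\<Sum>p\<in>{p \<in> ?S. fst p + snd p = \<gamma>}. ?h p)"
      unfolding mi_monom_add sum_distrib_left by (intro sum.cong) auto
  qed simp
  also have "\<dots> = (\<Sum>p\<in>?S. ?h p)"
    using fin by (intro sum.group) auto
  \<comment> \<open>The pairs of total degree above \<open>m\<close> carry the coefficient 0. Adding
    them turns a triangle of indices into a square, where the order of summation can be
    exchanged.\<close>
  also have "\<dots> = (\<Sum>p\<in>?D \<times> ?D. ?h p)"
    using fin by (intro sum.mono_neutral_left) (auto, meson assms not_le)
  also have "\<dots> = (\<Sum>\<alpha>\<in>?D. \<Sum>\<beta>\<in>?D. ?h (\<alpha>, \<beta>))"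
    by (simp add: sum.cartesian_product)
  also have "\<dots> = (\<Sum>\<beta>\<in>?D. \<Sum>\<alpha>\<in>?D. ?h (\<alpha>, \<beta>))"
    by (rule sum.swap)
  also have "\<dots> = taylor_poly m (\<lambda>\<gamma>. taylor_poly m (\<lambda>\<beta>. a (\<beta> + \<gamma>)) y z) z x"
    unfolding taylor_poly_def sum_distrib_right by (simp add: mult_ac)
  finally show ?thesis .
qed

definition mi_count :: "nat \<Rightarrow> 'n::finite itself \<Rightarrow> nat" where
  "mi_count m _ = card {\<gamma> :: 'n multiindex. mi_deg \<gamma> \<le> m}"

lemma taylor_poly_bound:
  fixes a :: "'n::finite multiindex \<Rightarrow> real" and B :: real
  assumes "\<And>\<gamma>. mi_deg \<gamma> \<le> m \<Longrightarrow> \<bar>a \<gamma>\<bar> * norm (x - y) ^ mi_deg \<gamma> \<le> B"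
  shows "\<bar>taylor_poly m a y x\<bar> \<le> mi_count m TYPE('n) * B"
proof -
  have "\<bar>taylor_poly m a y x\<bar> \<le> (\<Sum>\<gamma> | mi_deg \<gamma> \<le> m. \<bar>a \<gamma> * mi_monom \<gamma> (x - y)\<bar>)"
    unfolding taylor_poly_def by (rule sum_abs)
  also have "\<dots> \<le> (\<Sum>\<gamma> :: 'n multiindex | mi_deg \<gamma> \<le> m. B)"
  proof (rule sum_mono)
    fix \<gamma> :: "'n multiindex" assume "\<gamma> \<in> {\<gamma>. mi_deg \<gamma> \<le> m}"
    then have "\<bar>a \<gamma>\<bar> * norm (x - y) ^ mi_deg \<gamma> \<le> B" using assms by simp
    moreover have "\<bar>a \<gamma> * mi_monom \<gamma> (x - y)\<bar> \<le> \<bar>a \<gamma>\<bar> * norm (x - y) ^ mi_deg \<gamma>"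
      unfolding abs_mult by (intro mult_left_mono mi_monom_bound) simp
    ultimately show "\<bar>a \<gamma> * mi_monom \<gamma> (x - y)\<bar> \<le> B" by linarith
  qed
  finally show ?thesis by (simp add: mi_count_def)
qed

lemma jet_boundI:
  assumes "s > 0" "\<And>\<alpha>. mi_deg \<alpha> \<le> m \<Longrightarrow> \<bar>mi_deriv \<alpha> f x\<bar> \<le> B * s ^ (m - mi_deg \<alpha>)"
  shows "jet_bound m s (B * s ^ m) f x"
  unfolding jet_bound_def using assms(2) assms(1) by (simp add: power_diff)

lemma jet_bound_taylor_poly:
  fixes a :: "'n::finite multiindex \<Rightarrow> real" and B :: real
  assumes "\<And>\<gamma>. mi_deg \<gamma> > m \<Longrightarrow> a \<gamma> = 0" "0 < s" "norm (x - y) \<le> s" "B \<ge> 0"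
    and "\<And>\<gamma>. mi_deg \<gamma> \<le> m \<Longrightarrow> \<bar>a \<gamma>\<bar> \<le> B * s ^ (m - mi_deg \<gamma>)"
  shows "jet_bound m s (mi_count m TYPE('n) * B * s ^ m) (taylor_poly m a y) x"
proof (rule jet_boundI[OF assms(2)])
  fix \<alpha> :: "'n multiindex" assume "mi_deg \<alpha> \<le> m"
  have "\<bar>a (\<gamma> + \<alpha>)\<bar> * norm (x - y) ^ mi_deg \<gamma> \<le> B * s ^ (m - mi_deg \<alpha>)" for \<gamma>
  proof (cases "mi_deg \<gamma> + mi_deg \<alpha> \<le> m")
    case True
    have "\<bar>a (\<gamma> + \<alpha>)\<bar> * norm (x - y) ^ mi_deg \<gamma> \<le> (B * s ^ (m - mi_deg (\<gamma> + \<alpha>))) * s ^ mi_deg \<gamma>"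
      using True assms(2-4) by (intro mult_mono power_mono assms(5)) (auto simp: mi_deg_add)
    also have "\<dots> = B * s ^ (m - mi_deg \<alpha>)"
      using True by (simp add: mi_deg_add mult.assoc flip: power_add)
    finally show ?thesis .
  qed (use assms in \<open>simp add: mi_deg_add\<close>)
  from taylor_poly_bound[OF this]
  show "\<bar>mi_deriv \<alpha> (taylor_poly m a y) x\<bar> \<le> mi_count m TYPE('n) * B * s ^ (m - mi_deg \<alpha>)"
    by (simp add: mi_deriv_taylor_poly assms(1) mult_ac)
qed

text \<open>Recentering \<open>taylor_poly m a y\<close> at \<open>z\<close> reduces the comparison to the jets at \<open>z\<close>.\<close>

lemma jet_bound_taylor_poly_diff:
  fixes a b :: "'n::finite multiindex \<Rightarrow> real" and B :: real
  assumes a: "\<And>\<gamma>. mi_deg \<gamma> > m \<Longrightarrow> a \<gamma> = 0" and b: "\<And>\<gamma>. mi_deg \<gamma> > m \<Longrightarrow> b \<gamma> = 0"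
    and s: "0 < s" "norm (x - z) \<le> s" "B \<ge> 0"
    and ab: "\<And>\<alpha>. mi_deg \<alpha> \<le> m \<Longrightarrow>
      \<bar>b \<alpha> - taylor_poly m (\<lambda>\<gamma>. a (\<gamma> + \<alpha>)) y z\<bar> \<le> B * s ^ (m - mi_deg \<alpha>)"
  shows "jet_bound m s (mi_count m TYPE('n) * B * s ^ m)
    (\<lambda>x. taylor_poly m b z x - taylor_poly m a y x) x"
proof -
  let ?c = "\<lambda>\<gamma>. b \<gamma> - taylor_poly m (\<lambda>\<beta>. a (\<beta> + \<gamma>)) y z"
  have "taylor_poly m ?c z x = taylor_poly m b z x
      - taylor_poly m (\<lambda>\<gamma>. taylor_poly m (\<lambda>\<beta>. a (\<beta> + \<gamma>)) y z) z x" for x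
    by (simp add: taylor_poly_def left_diff_distrib sum_subtractf)
  then have "taylor_poly m b z x - taylor_poly m a y x = taylor_poly m ?c z x" for x
    using taylor_poly_recenter[of m a y x z, OF a] by simp
  moreover have "?c \<gamma> = 0" if "mi_deg \<gamma> > m" for \<gamma>
    using that by (simp add: a b taylor_poly_def mi_deg_add)
  ultimately show ?thesis
    using jet_bound_taylor_poly[of m ?c s x z B] s ab by simp
qed

section \<open>Partitions of unity on a grid\<close>

text \<open>One constant bounds \<open>g\<close> and its derivatives on the whole line. The
  derivative is an existential witness so that translates and averages can name theirs.\<close>

primrec bounded_Cm :: "nat \<Rightarrow> real \<Rightarrow> (real \<Rightarrow> real) \<Rightarrow> bool" where
  "bounded_Cm 0 C g \<longleftrightarrow> (\<forall>t. \<bar>g t\<bar> \<le> C) \<and> continuous_on UNIV g"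
| "bounded_Cm (Suc k) C g \<longleftrightarrow> (\<forall>t. \<bar>g t\<bar> \<le> C) \<and>
     (\<exists>g'. (\<forall>t. (g has_real_derivative g' t) (at t)) \<and> bounded_Cm k C g')"

lemma bounded_Cm_bound: "bounded_Cm k C g \<Longrightarrow> \<bar>g t\<bar> \<le> C"
  by (cases k) auto

lemma bounded_Cm_continuous: "bounded_Cm k C g \<Longrightarrow> continuous_on UNIV g"
  by (cases k) (auto intro: DERIV_continuous_on has_field_derivative_at_within)

lemma bounded_Cm_shift: "bounded_Cm k C g \<Longrightarrow> bounded_Cm k C (\<lambda>t. g (t + c))"
proof (induction k arbitrary: g)
  case 0
  then show ?case
    by (auto intro!: continuous_on_compose2[of UNIV g UNIV "\<lambda>t. t + c"] continuous_intros)
next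
  case (Suc k)
  then obtain g' where g': "\<And>t. (g has_real_derivative g' t) (at t)" "bounded_Cm k C g'" by auto
  have "((\<lambda>t. g (t + c)) has_real_derivative g' (t + c)) (at t)" for t
    using g'(1)[of "t + c"] by (simp add: DERIV_shift)
  moreover have "\<bar>g (t + c)\<bar> \<le> C" for t using Suc.prems by simp
  ultimately show ?case
    using Suc.IH[OF g'(2)] by (auto intro!: exI[of _ "\<lambda>t. g' (t + c)"])
qed

lemma bounded_Cm_diff:
  "bounded_Cm k C f \<Longrightarrow> bounded_Cm k D g \<Longrightarrow> bounded_Cm k (C + D) (\<lambda>t. f t - g t)"
proof (induction k arbitrary: f g)
  case 0
  have "\<bar>f t - g t\<bar> \<le> C + D" for t
    using bounded_Cm_bound[OF 0(1), of t] bounded_Cm_bound[OF 0(2), of t] by linarith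
  with 0 show ?case by (auto intro: continuous_intros)
next
  case (Suc k)
  obtain f' g' where D: "\<And>t. (f has_real_derivative f' t) (at t)" "bounded_Cm k C f'"
      "\<And>t. (g has_real_derivative g' t) (at t)" "bounded_Cm k D g'"
    using Suc.prems by auto
  have "\<bar>f t - g t\<bar> \<le> C + D" for t
    using bounded_Cm_bound[OF Suc.prems(1), of t] bounded_Cm_bound[OF Suc.prems(2), of t] by linarith
  with D Suc.IH[OF D(2,4)] show ?case
    by (auto intro!: exI[of _ "\<lambda>t. f' t - g' t"] DERIV_diff)
qed

text \<open>Averaging over unit intervals gains one derivative, as for B-splines.\<close>

lemma smooth_step_exists:
  "\<exists>C h. C \<ge> 1 \<and> bounded_Cm m C h \<and> (\<forall>t. 0 \<le> h t \<and> h t \<le> 1)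
    \<and> (\<forall>t\<le>0. h t = 0) \<and> (\<forall>t\<ge>real m + 1. h t = 1)"
proof (induction m)
  case 0
  show ?case
    by (intro exI[of _ 1] exI[of _ "\<lambda>t. max 0 (min 1 t)"]) (auto intro!: continuous_intros)
next
  case (Suc m)
  then obtain C h where h: "C \<ge> 1" "bounded_Cm m C h" "\<And>t. 0 \<le> h t \<and> h t \<le> 1"
      "\<And>t. t \<le> 0 \<Longrightarrow> h t = 0" "\<And>t. t \<ge> real m + 1 \<Longrightarrow> h t = 1" by auto
  have "isCont h t" for t
    using bounded_Cm_continuous[OF h(2)] by (simp add: continuous_on_eq_continuous_at)
  then obtain P where "\<And>t. (P has_vector_derivative h t) (at t)"
    using einterval_antiderivative[of "-\<infinity>" "\<infinity>" h] by auto
  then have P: "(P has_real_derivative h t) (at t)" for t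
    by (simp add: has_real_derivative_iff_has_vector_derivative)
  define H where "H = (\<lambda>t. P t - P (t - 1))"
  \<comment> \<open>\<open>H t\<close> is the mean of \<open>h\<close> over the interval from
    \<open>t - 1\<close> to \<open>t\<close>, hence a value of \<open>h\<close> there. This
    preserves the range and lengthens the transition interval by 1.\<close>
  have mean: "\<exists>u. t - 1 < u \<and> u < t \<and> H t = h u" for t
    using MVT2[of "t - 1" t P h] P by (auto simp: H_def)
  have "(H has_real_derivative h t - h (t + (- 1))) (at t)" for t
    using P[of t] P[of "t + (- 1)"] unfolding H_def DERIV_shift by (auto intro: DERIV_diff)
  moreover have "bounded_Cm m (C + C) (\<lambda>t. h t - h (t + (- 1)))"
    by (intro bounded_Cm_diff bounded_Cm_shift h(2))
  moreover have "0 \<le> H t \<and> H t \<le> 1" for t using mean[of t] h(3) by auto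
  moreover from this have "\<bar>H t\<bar> \<le> C + C" for t using h(1) by (smt (verit))
  ultimately have "bounded_Cm (Suc m) (C + C) H"
    by (auto intro!: exI[of _ "\<lambda>t. h t - h (t - 1)"])
  moreover have "H t = 0" if "t \<le> 0" for t using mean[of t] h(4) that by auto
  moreover have "H t = 1" if "t \<ge> real (Suc m) + 1" for t
  proof -
    obtain u where "t - 1 < u" "H t = h u" using mean by blast
    with that h(5)[of u] show ?thesis by auto
  qed
  ultimately show ?case
    using h(1) \<open>\<And>t. 0 \<le> H t \<and> H t \<le> 1\<close> by (intro exI[of _ "C + C"] exI[of _ H]) auto
qed

text \<open>The factor \<open>a\<close> makes the family closed under differentiation, which
  replaces it by \<open>a / h\<close> or 0, so that inductions on the order go through.\<close>

lemma coordinate_function_deriv: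
  fixes g :: "real \<Rightarrow> real"
  assumes "\<And>t. (g has_real_derivative g' t) (at t)"
  shows "(\<lambda>x :: real ^ 'n::finite. a * g ((x $ i - c) / h)) differentiable at x"
    and "partial_deriv j (\<lambda>x :: real ^ 'n. a * g ((x $ i - c) / h))
      = (\<lambda>x. (if j = i then a / h else 0) * g' ((x $ i - c) / h))"
proof -
  have D: "((\<lambda>x :: real ^ 'n. a * g ((x $ i - c) / h)) has_derivative
      (\<lambda>v. a * (g' ((x $ i - c) / h) * (v $ i / h)))) (at x)" for x
  proof -
    have "((\<lambda>x :: real ^ 'n. (x $ i - c) / h) has_derivative (\<lambda>v. v $ i / h)) (at x)"
      using bounded_linear.has_derivative[OF bounded_linear_vec_nth[of i] has_derivative_ident]
      by (auto intro!: derivative_eq_intros simp: divide_inverse)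
    moreover have "(g has_derivative (*) (g' ((x $ i - c) / h))) (at ((x $ i - c) / h))"
      using assms by (simp add: has_field_derivative_def)
    ultimately have "((\<lambda>x :: real ^ 'n. g ((x $ i - c) / h)) has_derivative
        (\<lambda>v. g' ((x $ i - c) / h) * (v $ i / h))) (at x)"
      by (rule has_derivative_compose)
    then show ?thesis by (rule has_derivative_mult_right)
  qed
  then show "(\<lambda>x :: real ^ 'n. a * g ((x $ i - c) / h)) differentiable at x"
    unfolding differentiable_def by blast
  show "partial_deriv j (\<lambda>x :: real ^ 'n. a * g ((x $ i - c) / h))
      = (\<lambda>x. (if j = i then a / h else 0) * g' ((x $ i - c) / h))"
    by (auto simp: partial_deriv_def fun_eq_iff axis_def simp flip: frechet_derivative_at[OF D])
qed

lemma Cm_on_coordinate_function: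
  assumes "bounded_Cm k C g"
  shows "Cm_on k UNIV (\<lambda>x :: real ^ 'n::finite. a * g ((x $ i - c) / h))"
  using assms
proof (induction k arbitrary: g a)
  case 0
  then show ?case
    by (cases "h = 0")
      (auto intro!: continuous_intros continuous_on_compose2[of UNIV g UNIV "\<lambda>x. (x $ i - c) / h"])
next
  case (Suc k)
  then obtain g' where g': "\<And>t. (g has_real_derivative g' t) (at t)" "bounded_Cm k C g'" by auto
  show ?case
    unfolding Cm_on.simps coordinate_function_deriv(2)[OF g'(1)]
    by (intro conjI ballI allI coordinate_function_deriv(1)[OF g'(1)] Suc.IH[OF g'(2)])
qed

lemma wderiv_coordinate_function:
  fixes x :: "real ^ 'n::finite"
  assumes "bounded_Cm k C g" "length w \<le> k" "h > 0"
  shows "\<bar>wderiv w (\<lambda>x. a * g ((x $ i - c) / h)) x\<bar> \<le> \<bar>a\<bar> * C / h ^ length w"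
  using assms(1,2)
proof (induction w arbitrary: g a k rule: rev_induct)
  case Nil
  then show ?case
    using bounded_Cm_bound[of k C g] by (simp add: abs_mult mult_left_mono)
next
  case (snoc j w)
  have C: "C \<ge> 0" using bounded_Cm_bound[OF snoc.prems(1), of 0] by simp
  obtain k' g' where g': "k = Suc k'" "\<And>t. (g has_real_derivative g' t) (at t)" "bounded_Cm k' C g'"
    using snoc.prems by (cases k) auto
  have "\<bar>wderiv (w @ [j]) (\<lambda>x. a * g ((x $ i - c) / h)) x\<bar>
      \<le> \<bar>if j = i then a / h else 0\<bar> * C / h ^ length w"
    using snoc.IH[OF g'(3), of "if j = i then a / h else 0"] snoc.prems g'(1)
    by (simp add: coordinate_function_deriv(2)[OF g'(2)])
  also have "\<dots> \<le> \<bar>a\<bar> * C / h ^ length (w @ [j])"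
    using assms(3) C by (auto simp: field_simps)
  finally show ?case .
qed

section \<open>Tensor-product bumps on a grid\<close>

definition unit_partition ::
  "nat \<Rightarrow> real \<Rightarrow> nat \<Rightarrow> real \<Rightarrow> real \<Rightarrow> (real ^ 'n::finite) set \<Rightarrow> (real ^ 'n \<Rightarrow> real ^ 'n \<Rightarrow> real) \<Rightarrow> bool"
  where "unit_partition m C N s R Z \<phi> \<longleftrightarrow>
    finite Z \<and> (\<forall>z\<in>Z. Cm_on m UNIV (\<phi> z)) \<and> (\<forall>z\<in>Z. \<forall>x. jet_bound m s C (\<phi> z) x) \<and>
    (\<forall>z\<in>Z. \<forall>x. s \<le> dist x z \<longrightarrow> \<phi> z x = 0) \<and>
    (\<forall>x. norm x \<le> R \<longrightarrow> (\<Sum>z\<in>Z. \<phi> z x) = 1) \<and> (\<forall>x. card {z \<in> Z. dist x z \<le> s} \<le> N)"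

lemma sum_telescope_symmetric:
  fixes H :: "real \<Rightarrow> real" and t :: real
  shows "(\<Sum>k\<in>{- int M..int M}. H (t - k + 1) - H (t - k)) = H (t + M + 1) - H (t - M)"
proof (induction M)
  case (Suc M)
  have "{- int (Suc M)..int (Suc M)} = insert (- int (Suc M)) (insert (int (Suc M)) {- int M..int M})"
    by auto
  with Suc show ?case by (simp add: algebra_simps)
qed simp

text \<open>\<open>C\<close> and \<open>N\<close> are found before \<open>s\<close> and
  \<open>R\<close>, which makes every later constant uniform in the scale. The bumps are products
  over the coordinates of one profile \<open>\<psi>\<close>, translated along a cubic grid; asking
  for sum 1 only up to radius \<open>R\<close> allows a finite grid.\<close>

lemma unit_partition_exists:
  "\<exists>C\<ge>0. \<exists>N. \<forall>s>0. \<forall>R. \<exists>(Z :: (real ^ 'n::finite) set) \<phi>. unit_partition m C N s R Z \<phi>"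
proof -
  obtain C0 H where H: "C0 \<ge> 1" "bounded_Cm m C0 H" "\<And>t. t \<le> 0 \<Longrightarrow> H t = 0"
      "\<And>t. t \<ge> real m + 1 \<Longrightarrow> H t = 1"
    using smooth_step_exists[of m] by blast
  \<comment> \<open>Sums of integer translates of this difference telescope to differences of
    \<open>H\<close>, hence to 1 over a long enough range.\<close>
  define \<psi> where "\<psi> = (\<lambda>t. H (t + 1) - H t)"
  have \<psi>: "bounded_Cm m (C0 + C0) \<psi>"
    unfolding \<psi>_def by (intro bounded_Cm_diff bounded_Cm_shift H)
  have \<psi>_supp: "\<psi> t = 0" if "\<bar>t\<bar> \<ge> real m + 1" for t
    using that H(3,4) by (cases "t \<ge> 0") (auto simp: \<psi>_def)
  \<comment> \<open>With mesh \<open>s / q\<close>, a point at distance at least \<open>s\<close>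
    from \<open>z\<close> has, by comparison with the 1-norm, a coordinate at least
    \<open>m + 1\<close> meshes away, where \<open>\<psi>\<close> vanishes.\<close>
  define q where "q = CARD('n) * (m + 1)"
  have q: "q > 0" by (simp add: q_def)
  \<comment> \<open>Each of the \<open>CARD('n)\<close> factors is bounded by \<open>C0 + C0\<close>
    at the scale of the mesh \<open>h\<close>, each multiplication costs \<open>2 ^ m\<close>, and
    the passage from \<open>h\<close> to \<open>s = q * h\<close> costs
    \<open>q ^ m\<close>.\<close>
  define C where "C = real q ^ m * (2 ^ m * (C0 + C0)) ^ CARD('n)"
  define N where "N = (2 * q + 2) ^ CARD('n)"
  show ?thesis
  proof (intro exI[of _ C] exI[of _ N] conjI allI impI)
    show "C \<ge> 0" using H(1) by (simp add: C_def)
    fix s R :: real assume s: "s > 0"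
    define h where "h = s / q"
    have h: "h > 0" "s = q * h" using s q by (auto simp: h_def)
    \<comment> \<open>The telescoped sum is \<open>H (t + M + 1) - H (t - M)\<close> with
      \<open>\<bar>t\<bar>\<close> at most \<open>R / h\<close>. The extra \<open>m\<close> makes
      the first argument at least \<open>m + 1\<close>, where \<open>H\<close> is 1; the second is
      at most 0.\<close>
    define M where "M = nat \<lceil>R / h\<rceil> + m"
    define grid where "grid = (\<lambda>\<nu> :: 'n \<Rightarrow> int. \<chi> i. h * \<nu> i)"
    define V where "V = (\<Pi>\<^sub>E i\<in>(UNIV :: 'n set). {- int M..int M})"
    define \<phi> where "\<phi> = (\<lambda>z x :: real ^ 'n. \<Prod>i\<in>UNIV. \<psi> ((x $ i - z $ i) / h))"
    have finV: "finite V" unfolding V_def by (intro finite_PiE) auto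
    have inj: "inj grid" using h by (auto simp: inj_def grid_def vec_eq_iff fun_eq_iff)
    have Cm: "Cm_on m UNIV (\<lambda>x :: real ^ 'n. \<psi> ((x $ i - c) / h))" for i c
      using Cm_on_coordinate_function[OF \<psi>, of 1] by simp
    have jb: "jet_bound m h (C0 + C0) (\<lambda>x. \<psi> ((x $ i - c) / h)) x" for i c and x :: "real ^ 'n"
      using wderiv_coordinate_function[OF \<psi> _ h(1), of "mi_word \<alpha>" 1 i c x for \<alpha>]
      by (simp add: jet_bound_def mi_deriv_eq_wderiv)
    have "unit_partition m C N s R (grid ` V) \<phi>"
      unfolding unit_partition_def
    proof (intro conjI ballI allI impI)
      show "finite (grid ` V)" using finV by simp
    next
      fix z show "Cm_on m UNIV (\<phi> z)"
        unfolding \<phi>_def by (intro Cm_on_prod Cm) auto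
    next
      fix z x
      have "jet_bound m h ((2 ^ m * (C0 + C0)) ^ CARD('n)) (\<phi> z) x"
        unfolding \<phi>_def by (intro jet_bound_prod[OF open_UNIV UNIV_I h(1) finite] Cm jb)
      then show "jet_bound m s C (\<phi> z) x"
        unfolding C_def by (rule jet_bound_rescale) (use s h q in auto)
    next
      fix z x :: "real ^ 'n" assume d: "s \<le> dist x z"
      have "\<exists>i. (m + 1) * h \<le> \<bar>x $ i - z $ i\<bar>"
      proof (rule ccontr)
        assume "\<not> ?thesis"
        then have "(\<Sum>i\<in>UNIV. \<bar>(x - z) $ i\<bar>) < (\<Sum>i\<in>(UNIV :: 'n set). (m + 1) * h)"
          by (intro sum_strict_mono) (auto simp: not_le)
        with norm_le_l1_cart[of "x - z"] d show False
          by (simp add: h(2) q_def dist_norm algebra_simps)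
      qed
      then obtain i where "(m + 1) * h \<le> \<bar>x $ i - z $ i\<bar>" ..
      then have "\<psi> ((x $ i - z $ i) / h) = 0"
        using h by (intro \<psi>_supp) (simp add: pos_le_divide_eq add.commute)
      then show "\<phi> z x = 0" unfolding \<phi>_def by (intro prod_zero) auto
    next
      fix x :: "real ^ 'n" assume x: "norm x \<le> R"
      have one: "(\<Sum>k\<in>{- int M..int M}. \<psi> (x $ i / h - k)) = 1" for i
      proof -
        have "\<bar>x $ i / h\<bar> \<le> R / h"
          using component_le_norm_cart[of x i] x h by (simp add: divide_right_mono)
        then have "\<bar>x $ i / h\<bar> + m \<le> M" unfolding M_def by linarith
        then show ?thesis
          using sum_telescope_symmetric[of H "x $ i / h" M]
            H(3)[of "x $ i / h - M"] H(4)[of "x $ i / h + M + 1"]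
          unfolding \<psi>_def by linarith
      qed
      have "(\<Sum>z\<in>grid ` V. \<phi> z x) = (\<Sum>\<nu>\<in>V. \<Prod>i\<in>UNIV. \<psi> (x $ i / h - \<nu> i))"
        using h inj by (subst sum.reindex) (auto simp: \<phi>_def grid_def diff_divide_distrib intro: inj_on_subset)
      also have "\<dots> = (\<Prod>i\<in>UNIV. \<Sum>k\<in>{- int M..int M}. \<psi> (x $ i / h - k))"
        unfolding V_def by (subst prod_sum_PiE) auto
      finally show "(\<Sum>z\<in>grid ` V. \<phi> z x) = 1" by (simp add: one)
    next
      fix x :: "real ^ 'n"
      let ?B = "\<Pi>\<^sub>E i\<in>(UNIV :: 'n set). {\<lfloor>x $ i / h\<rfloor> - int q..\<lfloor>x $ i / h\<rfloor> + int q + 1}"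
      have "{z \<in> grid ` V. dist x z \<le> s} \<subseteq> grid ` ?B"
      proof safe
        fix \<nu> assume "dist x (grid \<nu>) \<le> s"
        then have "\<bar>x $ i - h * \<nu> i\<bar> \<le> q * h" for i
          using component_le_norm_cart[of "x - grid \<nu>" i] by (simp add: h(2) dist_norm grid_def)
        moreover have "\<bar>x $ i / h - \<nu> i\<bar> = \<bar>x $ i - h * \<nu> i\<bar> / h" for i
        proof -
          have "x $ i / h - \<nu> i = (x $ i - h * \<nu> i) / h" using h(1) by (simp add: diff_divide_distrib)
          then show ?thesis using h(1) by simp
        qed
        ultimately have near: "\<bar>x $ i / h - \<nu> i\<bar> \<le> q" for i using h(1) by (simp add: pos_divide_le_eq)
        have "\<nu> i \<in> {\<lfloor>x $ i / h\<rfloor> - int q..\<lfloor>x $ i / h\<rfloor> + int q + 1}" for i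
        proof -
          have "real_of_int (\<lfloor>x $ i / h\<rfloor> - int q) \<le> \<nu> i" "\<nu> i \<le> real_of_int (\<lfloor>x $ i / h\<rfloor> + int q + 1)"
            using near[of i] floor_correct[of "x $ i / h"] by simp_all linarith+
          then show ?thesis by (simp only: of_int_le_iff atLeastAtMost_iff)
        qed
        then show "grid \<nu> \<in> grid ` ?B" by blast
      qed
      then have "card {z \<in> grid ` V. dist x z \<le> s} \<le> card (grid ` ?B)"
        by (intro card_mono finite_imageI finite_PiE) auto
      also have "\<dots> \<le> card ?B" by (intro card_image_le finite_PiE) auto
      also have "\<dots> = N" by (simp add: card_PiE N_def nat_add_distrib nat_mult_distrib)
      finally show "card {z \<in> grid ` V. dist x z \<le> s} \<le> N" .
    qed
    then show "\<exists>(Z :: (real ^ 'n) set) \<phi>. unit_partition m C N s R Z \<phi>" by blast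
  qed
qed

section \<open>Whitney extension from a neighbourhood of a set\<close>

definition nbhd :: "'a::metric_space set \<Rightarrow> real \<Rightarrow> 'a set" where
  "nbhd E t = {x. \<exists>y\<in>E. dist x y < t}"

lemma open_nbhd [simp]: "open (nbhd E t)"
proof -
  have "nbhd E t = (\<Union>y\<in>E. ball y t)" by (auto simp: nbhd_def dist_commute)
  then show ?thesis by auto
qed

lemma nbhd_mono: "s \<le> t \<Longrightarrow> nbhd E s \<subseteq> nbhd E t"
  unfolding nbhd_def by (blast intro: less_le_trans)

lemma nbhd_norm_bound:
  fixes E :: "'a::real_normed_vector set"
  assumes "bounded E"
  obtains R where "\<And>x. x \<in> nbhd E t \<Longrightarrow> norm x \<le> R"
proof -
  obtain R where R: "\<And>y. y \<in> E \<Longrightarrow> norm y \<le> R" using assms by (auto simp: bounded_iff)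
  have "norm x \<le> R + t" if x: "x \<in> nbhd E t" for x
  proof -
    obtain y where "y \<in> E" "dist x y < t" using x by (auto simp: nbhd_def)
    then show ?thesis using R[of y] norm_triangle_ineq2[of x y] by (simp add: dist_norm)
  qed
  then show thesis by (rule that)
qed

text \<open>A bound of the special form \<open>B * s ^ m\<close> passes to a coarser scale with the
  same \<open>B\<close>, because the exponents \<open>m - mi_deg \<alpha>\<close> are
  nonnegative.\<close>

lemma jet_bound_enlarge:
  assumes "jet_bound m s (B * s ^ m) f x" "0 < s" "s \<le> t" "B \<ge> 0"
  shows "jet_bound m t (B * t ^ m) f x"
proof (rule jet_boundI)
  fix \<alpha> :: "'a multiindex" assume \<alpha>: "mi_deg \<alpha> \<le> m"
  have "\<bar>mi_deriv \<alpha> f x\<bar> \<le> B * s ^ (m - mi_deg \<alpha>)"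
    using jet_boundD[OF assms(1) \<alpha>] assms(2) \<alpha> by (simp add: power_diff)
  also have "\<dots> \<le> B * t ^ (m - mi_deg \<alpha>)"
    using assms by (intro mult_left_mono power_mono) auto
  finally show "\<bar>mi_deriv \<alpha> f x\<bar> \<le> B * t ^ (m - mi_deg \<alpha>)" .
qed (use assms in auto)

lemma unit_partitionD:
  assumes "unit_partition m C N s R Z \<phi>"
  shows "finite Z" "\<And>z. z \<in> Z \<Longrightarrow> Cm_on m UNIV (\<phi> z)"
    "\<And>z x. z \<in> Z \<Longrightarrow> jet_bound m s C (\<phi> z) x"
    "\<And>z x. z \<in> Z \<Longrightarrow> s \<le> dist x z \<Longrightarrow> \<phi> z x = 0"
    "\<And>x. norm x \<le> R \<Longrightarrow> (\<Sum>z\<in>Z. \<phi> z x) = 1"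
    "\<And>x. card {z \<in> Z. dist x z \<le> s} \<le> N"
  using assms unfolding unit_partition_def by blast+

text \<open>Each \<open>g z\<close> need only be controlled at distance at most \<open>s\<close>
  from \<open>z\<close>; farther away its bump vanishes near \<open>x\<close>.\<close>

lemma unit_partition_sum_bound:
  fixes g :: "real ^ 'n::finite \<Rightarrow> real ^ 'n \<Rightarrow> real"
  assumes P: "unit_partition m C N s R Z \<phi>" and "s > 0" "C \<ge> 0" "B \<ge> 0" "Y \<subseteq> Z"
    and U: "open U" "x \<in> U" "\<And>z. z \<in> Y \<Longrightarrow> Cm_on m U (g z)"
    and g: "\<And>z. z \<in> Y \<Longrightarrow> dist x z \<le> s \<Longrightarrow> jet_bound m s B (g z) x"
  shows "jet_bound m s (N * (2 ^ m * C * B)) (\<lambda>x. \<Sum>z\<in>Y. \<phi> z x * g z x) x"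
proof (rule jet_bound_sum_local[OF U(1,2) \<open>s > 0\<close>])
  note P = unit_partitionD[OF P]
  fix z assume z: "z \<in> Y"
  then have zZ: "z \<in> Z" using \<open>Y \<subseteq> Z\<close> by auto
  have \<phi>: "Cm_on m U (\<phi> z)" using Cm_on_subset[OF P(2)[OF zZ]] by simp
  then show "Cm_on m U (\<lambda>x. \<phi> z x * g z x)" using U z by (intro Cm_on_mult) auto
  show "jet_bound m s (2 ^ m * C * B) (\<lambda>x. \<phi> z x * g z x) x" if "dist x z \<le> s"
    using that z by (intro jet_bound_mult[OF U(1,2) \<phi> U(3)] P(3) zZ g) (use assms in auto)
  show "jet_bound m s 0 (\<lambda>x. \<phi> z x * g z x) x" if "\<not> dist x z \<le> s"
  proof (rule jet_bound_zero)
    show "open {x. s < dist x z}" by (intro open_Collect_less continuous_intros)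
  qed (use that P(4)[OF zZ] \<open>s > 0\<close> in auto)
next
  note P = unit_partitionD[OF P]
  show "finite Y" using P(1) \<open>Y \<subseteq> Z\<close> finite_subset by blast
  have "card {z \<in> Y. dist x z \<le> s} \<le> card {z \<in> Z. dist x z \<le> s}"
    using P(1) \<open>Y \<subseteq> Z\<close> by (intro card_mono) auto
  also have "\<dots> \<le> N" by (rule P(6))
  finally show "card {z \<in> Y. dist x z \<le> s} \<le> N" .
qed (use \<open>B \<ge> 0\<close> \<open>C \<ge> 0\<close> in simp)

lemma cutoff_exists:
  fixes E Z :: "(real ^ 'n::finite) set"
  assumes P: "unit_partition m C N s R Z \<phi>" and s: "s > 0" and C: "C \<ge> 0"
    and R: "\<And>x. x \<in> nbhd E (2 * s) \<Longrightarrow> norm x \<le> R"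
  obtains \<eta> K where "Cm_on m UNIV \<eta>" "closed K" "K \<subseteq> nbhd E (4 * s)" "\<And>x. x \<notin> K \<Longrightarrow> \<eta> x = 0"
    "\<And>x. x \<in> nbhd E (2 * s) \<Longrightarrow> \<eta> x = 1" "\<And>x. jet_bound m s (N * (2 ^ m * C)) \<eta> x"
proof
  note PD = unit_partitionD[OF P]
  \<comment> \<open>A bump alive at distance less than \<open>2 * s\<close> from \<open>E\<close>
    has its centre within \<open>3 * s\<close>, and a bump with such a centre reaches no farther
    than \<open>4 * s\<close>.\<close>
  define Y where "Y = {z \<in> Z. z \<in> nbhd E (3 * s)}"
  have Y: "Y \<subseteq> Z" by (auto simp: Y_def)
  show "Cm_on m UNIV (\<lambda>x. \<Sum>z\<in>Y. \<phi> z x)"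
    using Y PD(2) by (intro Cm_on_sum) auto
  show "closed (\<Union>z\<in>Y. cball z s)"
    using Y PD(1) finite_subset by (intro closed_UN) auto
  show "(\<Union>z\<in>Y. cball z s) \<subseteq> nbhd E (4 * s)"
  proof safe
    fix z x assume "z \<in> Y" "x \<in> cball z s"
    then obtain y where "y \<in> E" "dist z y < 3 * s" "dist x z \<le> s"
      by (auto simp: Y_def nbhd_def dist_commute)
    then show "x \<in> nbhd E (4 * s)"
      using dist_triangle[of x y z] by (auto simp: nbhd_def intro!: bexI[of _ y])
  qed
  show "(\<Sum>z\<in>Y. \<phi> z x) = 0" if "x \<notin> (\<Union>z\<in>Y. cball z s)" for x
  proof (intro sum.neutral ballI)
    fix z assume "z \<in> Y"
    with that have "\<not> dist z x \<le> s" by auto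
    with \<open>z \<in> Y\<close> Y show "\<phi> z x = 0" by (intro PD(4)) (auto simp: dist_commute)
  qed
  show "(\<Sum>z\<in>Y. \<phi> z x) = 1" if x: "x \<in> nbhd E (2 * s)" for x
  proof -
    obtain y where y: "y \<in> E" "dist x y < 2 * s" using x by (auto simp: nbhd_def)
    have "z \<in> Y" if "z \<in> Z" "\<phi> z x \<noteq> 0" for z
    proof -
      have "dist x z < s" using PD(4)[of z x] that by force
      then have "dist z y < 3 * s" using y dist_triangle[of z y x] by (simp add: dist_commute)
      with that y show ?thesis by (auto simp: Y_def nbhd_def)
    qed
    then have "(\<Sum>z\<in>Y. \<phi> z x) = (\<Sum>z\<in>Z. \<phi> z x)"
      using Y PD(1) by (intro sum.mono_neutral_left) auto
    with PD(5)[OF R[OF x]] show ?thesis by simp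
  qed
  show "jet_bound m s (N * (2 ^ m * C)) (\<lambda>x. \<Sum>z\<in>Y. \<phi> z x) x" for x
    using unit_partition_sum_bound[OF P s C _ Y open_UNIV UNIV_I, of 1 "\<lambda>z x. 1"]
      jet_bound_const[of 1 s m x] s by simp
qed

section \<open>Whitney fields and layers of averaged Taylor polynomials\<close>

locale whitney_jets =
  fixes m :: nat and C :: real and N :: nat and E :: "(real ^ 'n::finite) set"
    and J :: "real ^ 'n \<Rightarrow> 'n multiindex \<Rightarrow> real" and \<epsilon> \<sigma> :: real
  assumes C: "C \<ge> 0" and partition: "\<And>s R. s > 0 \<Longrightarrow> \<exists>Z \<phi>. unit_partition m C N s R (Z :: (real ^ 'n) set) \<phi>"
    and E: "bounded E" and \<epsilon>: "\<epsilon> \<ge> 0" and \<sigma>: "\<sigma> > 0"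
    and J0: "\<And>y \<gamma>. m < mi_deg \<gamma> \<Longrightarrow> J y \<gamma> = 0"
    and J1: "\<And>y \<alpha>. y \<in> E \<Longrightarrow> mi_deg \<alpha> \<le> m \<Longrightarrow> \<bar>J y \<alpha>\<bar> \<le> \<epsilon> * \<sigma> ^ (m - mi_deg \<alpha>)"
    and J2: "\<And>y z \<alpha>. y \<in> E \<Longrightarrow> z \<in> E \<Longrightarrow> mi_deg \<alpha> \<le> m \<Longrightarrow>
      \<bar>J z \<alpha> - taylor_poly m (\<lambda>\<gamma>. J y (\<gamma> + \<alpha>)) y z\<bar> \<le> \<epsilon> * dist z y ^ (m - mi_deg \<alpha>)"
begin

abbreviation T :: "real ^ 'n \<Rightarrow> real ^ 'n \<Rightarrow> real" where
  "T y \<equiv> taylor_poly m (J y) y"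

text \<open>Like the constants below, this involves only \<open>m\<close>, \<open>C\<close>,
  \<open>N\<close> and the dimension. In units of \<open>s\<close>, 18 bounds the distance between
  base points compared in one layer: 9 from base point to grid point, 1 on to \<open>x\<close>, 8 on
  to \<open>y\<close>.\<close>

definition c_layer :: real where
  "c_layer = N * (2 ^ m * C * (mi_count m TYPE('n) * 18 ^ m))"

definition c_cutoff :: real where
  "c_cutoff = N * (2 ^ m * C)"

text \<open>The summands bound the two products in
  \<open>\<eta> * (G - T y) + (1 - \<eta>) * (A - T y)\<close>, where \<open>1 + c_cutoff\<close>
  bounds \<open>1 - \<eta>\<close>.\<close>

definition c_glue :: real where
  "c_glue = 2 ^ m * c_cutoff * (c_layer + 4 ^ m) + 2 ^ m * (1 + c_cutoff) * c_layer"

text \<open>\<open>c_glue\<close> measures the distance to a Taylor polynomial, and the middle term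
  that polynomial itself within \<open>8 * \<sigma>\<close>. The 1 lets the initial function meet
  the bound at the finest scale.\<close>

definition c_all :: real where
  "c_all = c_glue + mi_count m TYPE('n) * 8 ^ m + 1"

lemma c_nonneg: "c_layer \<ge> 0" "c_cutoff \<ge> 0" "c_glue \<ge> 0" "c_all \<ge> 1"
  using C by (auto simp: c_layer_def c_cutoff_def c_glue_def c_all_def)

lemma Cm_on_T: "Cm_on k U (T y)"
  by (rule Cm_on_taylor_poly) (rule J0)

lemma T_bound:
  assumes "y \<in> E" "dist x y \<le> 8 * \<sigma>"
  shows "jet_bound m \<sigma> (mi_count m TYPE('n) * 8 ^ m * \<epsilon> * \<sigma> ^ m) (T y) x"
proof -
  have "\<bar>J y \<gamma>\<bar> \<le> \<epsilon> * (8 * \<sigma>) ^ (m - mi_deg \<gamma>)" if "mi_deg \<gamma> \<le> m" for \<gamma>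
  proof -
    have "\<epsilon> * \<sigma> ^ (m - mi_deg \<gamma>) \<le> \<epsilon> * (8 * \<sigma>) ^ (m - mi_deg \<gamma>)"
      using \<epsilon> \<sigma> by (intro mult_left_mono power_mono) auto
    with J1[OF assms(1) that] show ?thesis by linarith
  qed
  then have "jet_bound m (8 * \<sigma>) (mi_count m TYPE('n) * \<epsilon> * (8 * \<sigma>) ^ m) (T y) x"
    using assms \<epsilon> \<sigma> J0 by (intro jet_bound_taylor_poly) (auto simp: dist_norm)
  from jet_bound_rescale[OF this, of \<sigma> 1] \<sigma> show ?thesis
    by (simp add: power_mult_distrib mult_ac)
qed

text \<open>The compatibility condition enters here: at scale \<open>s\<close>, nearby Taylor
  polynomials differ by a multiple of \<open>\<epsilon> * s ^ m\<close>, which a cutoff at scale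
  \<open>s\<close> multiplies only by a constant.\<close>

lemma T_diff_bound:
  assumes "y \<in> E" "z \<in> E" "s > 0" "dist z y \<le> 18 * s" "dist x z \<le> 18 * s"
  shows "jet_bound m s (mi_count m TYPE('n) * 18 ^ m * (\<epsilon> * s ^ m)) (\<lambda>x. T z x - T y x) x"
proof -
  have "\<bar>J z \<alpha> - taylor_poly m (\<lambda>\<gamma>. J y (\<gamma> + \<alpha>)) y z\<bar> \<le> \<epsilon> * (18 * s) ^ (m - mi_deg \<alpha>)"
    if "mi_deg \<alpha> \<le> m" for \<alpha>
  proof -
    have "\<epsilon> * dist z y ^ (m - mi_deg \<alpha>) \<le> \<epsilon> * (18 * s) ^ (m - mi_deg \<alpha>)"
      using \<epsilon> assms by (intro mult_left_mono power_mono) auto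
    with J2[OF assms(1,2) that] show ?thesis by linarith
  qed
  then have "jet_bound m (18 * s) (mi_count m TYPE('n) * \<epsilon> * (18 * s) ^ m) (\<lambda>x. T z x - T y x) x"
    using assms \<epsilon> J0 by (intro jet_bound_taylor_poly_diff) (auto simp: dist_norm)
  from jet_bound_rescale[OF this, of s 1] assms show ?thesis
    by (simp add: power_mult_distrib mult_ac)
qed

text \<open>Whitney's construction at a single scale. Near \<open>E\<close> the weights sum to 1, so
  \<open>A - T y\<close> is a weighted sum of differences \<open>T (b z) - T y\<close>, for every
  \<open>y\<close> in reach at once.\<close>

lemma layer_exists:
  assumes s: "s > 0"
  obtains A where "Cm_on m UNIV A"
    "\<And>x y. y \<in> E \<Longrightarrow> dist x y < 8 * s \<Longrightarrow> jet_bound m s (c_layer * \<epsilon> * s ^ m) (\<lambda>x. A x - T y x) x"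
proof -
  obtain R where R: "\<And>x. x \<in> nbhd E (8 * s) \<Longrightarrow> norm x \<le> R"
    using nbhd_norm_bound[OF E] by blast
  obtain Z :: "(real ^ 'n) set" and \<phi> where P: "unit_partition m C N s R Z \<phi>" using partition s by blast
  note PD = unit_partitionD[OF P]
  \<comment> \<open>A bump alive within \<open>8 * s\<close> of \<open>E\<close> has its centre
    within \<open>9 * s\<close>, hence a base point in \<open>E\<close> that near.\<close>
  define Y where "Y = {z \<in> Z. z \<in> nbhd E (9 * s)}"
  have Y: "Y \<subseteq> Z" "finite Y" using PD(1) by (auto simp: Y_def)
  have "\<forall>z\<in>Y. \<exists>y. y \<in> E \<and> dist z y < 9 * s" by (auto simp: Y_def nbhd_def)
  then obtain b where b: "\<And>z. z \<in> Y \<Longrightarrow> b z \<in> E \<and> dist z (b z) < 9 * s"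
    by (metis bchoice)
  define A where "A = (\<lambda>x. \<Sum>z\<in>Y. \<phi> z x * T (b z) x)"
  have one: "(\<Sum>z\<in>Y. \<phi> z x) = 1" if x: "x \<in> nbhd E (8 * s)" for x
  proof -
    obtain y where y: "y \<in> E" "dist x y < 8 * s" using x by (auto simp: nbhd_def)
    have "z \<in> Y" if "z \<in> Z" "\<phi> z x \<noteq> 0" for z
    proof -
      have "dist x z < s" using PD(4)[of z x] that by force
      then have "dist z y < 9 * s" using y dist_triangle[of z y x] by (simp add: dist_commute)
      with that y show ?thesis by (auto simp: Y_def nbhd_def)
    qed
    then have "(\<Sum>z\<in>Y. \<phi> z x) = (\<Sum>z\<in>Z. \<phi> z x)"
      using Y PD(1) by (intro sum.mono_neutral_left) auto
    with PD(5)[OF R[OF x]] show ?thesis by simp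
  qed
  show thesis
  proof
    show "Cm_on m UNIV A"
      unfolding A_def using Y PD(2) by (intro Cm_on_sum Cm_on_mult Cm_on_T) auto
    fix x y assume y: "y \<in> E" "dist x y < 8 * s"
    then have x: "x \<in> nbhd E (8 * s)" by (auto simp: nbhd_def)
    let ?B = "mi_count m TYPE('n) * 18 ^ m * (\<epsilon> * s ^ m)"
    have "jet_bound m s (N * (2 ^ m * C * ?B)) (\<lambda>x. \<Sum>z\<in>Y. \<phi> z x * (T (b z) x - T y x)) x"
    proof (rule unit_partition_sum_bound[OF P s C _ Y(1) open_UNIV UNIV_I])
      show "0 \<le> ?B" using \<epsilon> s by simp
      fix z assume z: "z \<in> Y"
      show "Cm_on m UNIV (\<lambda>x. T (b z) x - T y x)" by (intro Cm_on_diff Cm_on_T) auto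
      assume "dist x z \<le> s"
      then have "dist (b z) y \<le> 18 * s" "dist x (b z) \<le> 18 * s"
        using b[OF z] y dist_triangle[of x "b z" z] dist_triangle[of "b z" y x] s
        by (auto simp: dist_commute)
      then show "jet_bound m s ?B (\<lambda>x. T (b z) x - T y x) x"
        using b[OF z] y s by (intro T_diff_bound) auto
    qed
    moreover have "(\<Sum>z\<in>Y. \<phi> z x * (T (b z) x - T y x)) = A x - T y x"
      if "x \<in> nbhd E (8 * s)" for x
      using one[OF that]
      by (simp add: A_def right_diff_distrib sum_subtractf flip: sum_distrib_right)
    ultimately have "jet_bound m s (N * (2 ^ m * C * ?B)) (\<lambda>x. A x - T y x) x"
      using jet_bound_cong[OF open_nbhd x, of "\<lambda>x. \<Sum>z\<in>Y. \<phi> z x * (T (b z) x - T y x)" "\<lambda>x. A x - T y x"]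
      by simp
    then show "jet_bound m s (c_layer * \<epsilon> * s ^ m) (\<lambda>x. A x - T y x) x"
      by (simp add: c_layer_def mult.assoc)
  qed
qed

text \<open>Closeness to Taylor polynomials is required only on the shell where the next cutoff
  passes from 1 to 0; nearer to \<open>E\<close> the size bound suffices. The constant admits both
  sources of \<open>G\<close>: \<open>4 ^ m\<close> for the initial function, \<open>c_layer\<close>
  for a layer glued on at the previous step.\<close>

definition extends_to_scale :: "real \<Rightarrow> (real ^ 'n \<Rightarrow> real) \<Rightarrow> bool" where
  "extends_to_scale s G \<longleftrightarrow> Cm_on m (nbhd E (4 * s)) G \<and>
    (\<forall>x\<in>nbhd E (4 * s). jet_bound m \<sigma> (c_all * \<epsilon> * \<sigma> ^ m) G x) \<and>
    (\<forall>x\<in>nbhd E (4 * s) - nbhd E (2 * s). \<forall>y\<in>E. dist x y < 4 * s \<longrightarrow>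
      jet_bound m s ((c_layer + 4 ^ m) * \<epsilon> * s ^ m) (\<lambda>x. G x - T y x) x)"

text \<open>
  Passing to scale \<open>2 * s\<close> changes \<open>G\<close> only outside \<open>nbhd E (2 * s)\<close>, and outside
  \<open>nbhd E (4 * s)\<close> the new function is a Whitney approximation again: the constants do not grow.
\<close>

lemma extends_to_scale_double:
  assumes s: "s > 0" "s \<le> \<sigma>" and G: "extends_to_scale s G"
  obtains G' where "extends_to_scale (2 * s) G'" "\<And>x. x \<in> nbhd E (2 * s) \<Longrightarrow> G' x = G x"
proof -
  obtain R where R: "\<And>x. x \<in> nbhd E (2 * s) \<Longrightarrow> norm x \<le> R"
    using nbhd_norm_bound[OF E] by blast
  obtain Z :: "(real ^ 'n) set" and \<phi> where "unit_partition m C N s R Z \<phi>" using partition s by blast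
  then obtain \<eta> K where \<eta>: "Cm_on m UNIV \<eta>" "closed K" "K \<subseteq> nbhd E (4 * s)"
      "\<And>x. x \<notin> K \<Longrightarrow> \<eta> x = 0" "\<And>x. x \<in> nbhd E (2 * s) \<Longrightarrow> \<eta> x = 1"
      "\<And>x. jet_bound m s c_cutoff \<eta> x"
    using cutoff_exists[OF _ s(1) C R] unfolding c_cutoff_def by blast
  obtain A where A: "Cm_on m UNIV A"
    "\<And>x y. y \<in> E \<Longrightarrow> dist x y < 8 * s \<Longrightarrow> jet_bound m s (c_layer * \<epsilon> * s ^ m) (\<lambda>x. A x - T y x) x"
    using layer_exists[OF s(1)] by blast
  let ?U = "nbhd E (4 * s)"
  have GCm: "Cm_on m ?U G" and Ga: "\<And>x. x \<in> ?U \<Longrightarrow> jet_bound m \<sigma> (c_all * \<epsilon> * \<sigma> ^ m) G x"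
    and Gb: "\<And>x y. x \<in> ?U \<Longrightarrow> x \<notin> nbhd E (2 * s) \<Longrightarrow> y \<in> E \<Longrightarrow> dist x y < 4 * s \<Longrightarrow>
      jet_bound m s ((c_layer + 4 ^ m) * \<epsilon> * s ^ m) (\<lambda>x. G x - T y x) x"
    using G unfolding extends_to_scale_def by auto
  define G' where "G' = (\<lambda>x. (if x \<in> ?U then \<eta> x * G x else 0) + (1 - \<eta> x) * A x)"
  have sub: "nbhd E (2 * s) \<subseteq> ?U" using s by (intro nbhd_mono) auto
  have \<eta>1: "Cm_on m UNIV (\<lambda>x. 1 - \<eta> x)" by (intro Cm_on_diff Cm_on_const \<eta>(1)) simp
  have "Cm_on m UNIV (\<lambda>x. if x \<in> ?U then \<eta> x * G x else 0)"
    using \<eta>(2-4) by (intro Cm_on_extend_zero[of _ K] Cm_on_mult Cm_on_subset[OF \<eta>(1)] GCm) auto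
  then have CmG': "Cm_on m UNIV G'"
    unfolding G'_def by (intro Cm_on_add Cm_on_mult \<eta>1 A(1)) simp_all
  have inner: "G' x = G x" if "x \<in> nbhd E (2 * s)" for x
    using that sub \<eta>(5) by (auto simp: G'_def)
  have outer: "G' x = A x" if "x \<in> - K" for x
    using that \<eta>(4) by (simp add: G'_def)
  have outer_bound: "jet_bound m s (c_layer * \<epsilon> * s ^ m) (\<lambda>x. G' x - T y x) x"
    if "x \<notin> ?U" "y \<in> E" "dist x y < 8 * s" for x y
  proof -
    have "x \<in> - K" using that(1) \<eta>(3) by auto
    from jet_bound_cong[OF open_Compl[OF \<eta>(2)] this, of "\<lambda>x. G' x - T y x" "\<lambda>x. A x - T y x"]
    show ?thesis using A(2)[OF that(2,3)] outer by simp
  qed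
  have glue_bound: "jet_bound m s (c_glue * \<epsilon> * s ^ m) (\<lambda>x. G' x - T y x) x"
    if x: "x \<in> ?U" "x \<notin> nbhd E (2 * s)" and y: "y \<in> E" "dist x y < 4 * s" for x y
  proof -
    \<comment> \<open>The weights \<open>\<eta>\<close> and \<open>1 - \<eta>\<close> sum to 1, so
      \<open>T y\<close> may be subtracted from both branches; derivatives of \<open>\<eta>\<close>
      then meet only differences of order \<open>\<epsilon> * s ^ m\<close>.\<close>
    let ?h = "\<lambda>x. \<eta> x * (G x - T y x) + (1 - \<eta> x) * (A x - T y x)"
    have "jet_bound m s (2 ^ m * c_cutoff * ((c_layer + 4 ^ m) * \<epsilon> * s ^ m)
        + 2 ^ m * (1 + c_cutoff) * (c_layer * \<epsilon> * s ^ m)) ?h x"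
      using s x y
      by (intro jet_bound_add[OF open_nbhd x(1)] jet_bound_mult[OF open_nbhd x(1)] Cm_on_mult Cm_on_diff
          open_nbhd Cm_on_T GCm Cm_on_subset[OF A(1)] Cm_on_subset[OF \<eta>(1)] Cm_on_const
          jet_bound_diff[OF open_nbhd x(1)] jet_bound_const Gb A(2) \<eta>(6)) auto
    moreover have "?h x = G' x - T y x" if "x \<in> ?U" for x
      using that by (simp add: G'_def algebra_simps)
    ultimately show ?thesis
      using jet_bound_cong[OF open_nbhd x(1), of ?h "\<lambda>x. G' x - T y x"]
      by (simp add: c_glue_def algebra_simps)
  qed
  have "extends_to_scale (2 * s) G'"
    unfolding extends_to_scale_def
  proof (intro conjI ballI impI)
    show "Cm_on m (nbhd E (4 * (2 * s))) G'" by (rule Cm_on_subset[OF CmG']) simp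
  next
    fix x assume x8: "x \<in> nbhd E (4 * (2 * s))"
    show "jet_bound m \<sigma> (c_all * \<epsilon> * \<sigma> ^ m) G' x"
    proof (cases "x \<in> nbhd E (2 * s)")
      case True
      then show ?thesis
        using Ga[of x] sub jet_bound_cong[OF open_nbhd True, of G' G] inner by auto
    next
      case False
      obtain y where y: "y \<in> E" "dist x y < 8 * s"
        and G'y: "jet_bound m s (c_glue * \<epsilon> * s ^ m) (\<lambda>x. G' x - T y x) x"
      proof (cases "x \<in> ?U")
        case True
        then obtain y where y: "y \<in> E" "dist x y < 4 * s" by (auto simp: nbhd_def)
        with that[of y] glue_bound[OF True False y] s show thesis by auto
      next
        case outside: False
        obtain y where y: "y \<in> E" "dist x y < 8 * s" using x8 by (auto simp: nbhd_def)
        have "0 \<le> 2 ^ m * c_cutoff * (c_layer + 4 ^ m)" using c_nonneg by simp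
        moreover have "1 * c_layer \<le> 2 ^ m * (1 + c_cutoff) * c_layer"
          using c_nonneg mult_mono[of 1 "2 ^ m" 1 "1 + c_cutoff"] by (intro mult_right_mono) auto
        ultimately have "c_layer \<le> c_glue" unfolding c_glue_def by linarith
        then have "c_layer * \<epsilon> * s ^ m \<le> c_glue * \<epsilon> * s ^ m"
          using \<epsilon> s by (intro mult_right_mono) auto
        then show thesis by (rule that[OF y jet_bound_mono[OF outer_bound[OF outside y] _ s(1)]])
      qed
      from G'y have "jet_bound m \<sigma> (c_glue * \<epsilon> * \<sigma> ^ m) (\<lambda>x. G' x - T y x) x"
        by (rule jet_bound_enlarge) (use s \<epsilon> c_nonneg in auto)
      then have "jet_bound m \<sigma> (c_glue * \<epsilon> * \<sigma> ^ m + mi_count m TYPE('n) * 8 ^ m * \<epsilon> * \<sigma> ^ m)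
          (\<lambda>x. (G' x - T y x) + T y x) x"
        using y s by (intro jet_bound_add[OF open_UNIV UNIV_I] Cm_on_diff CmG' Cm_on_T T_bound) auto
      then have "jet_bound m \<sigma> (c_glue * \<epsilon> * \<sigma> ^ m + mi_count m TYPE('n) * 8 ^ m * \<epsilon> * \<sigma> ^ m) G' x"
        by simp
      then show ?thesis
        by (rule jet_bound_mono) (use \<epsilon> \<sigma> in \<open>auto simp: c_all_def algebra_simps\<close>)
    qed
  next
    fix x y assume "x \<in> nbhd E (4 * (2 * s)) - nbhd E (2 * (2 * s))" "y \<in> E" "dist x y < 4 * (2 * s)"
    \<comment> \<open>Beyond \<open>4 * s\<close> the new function is the layer \<open>A\<close>
      alone, so \<open>G\<close> leaves no trace in the bound on the next shell.\<close>
    then have "jet_bound m s (c_layer * \<epsilon> * s ^ m) (\<lambda>x. G' x - T y x) x"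
      by (intro outer_bound) auto
    then have "jet_bound m (2 * s) (c_layer * \<epsilon> * (2 * s) ^ m) (\<lambda>x. G' x - T y x) x"
      by (rule jet_bound_enlarge) (use s \<epsilon> c_nonneg in auto)
    then show "jet_bound m (2 * s) ((c_layer + 4 ^ m) * \<epsilon> * (2 * s) ^ m) (\<lambda>x. G' x - T y x) x"
      by (rule jet_bound_mono) (use s \<epsilon> in \<open>auto intro!: mult_right_mono\<close>)
  qed
  with inner show thesis by (intro that)
qed

lemma extends_to_all_scales:
  assumes "s > 0" "2 ^ k * s \<le> \<sigma>" "extends_to_scale s G"
  shows "\<exists>G'. extends_to_scale (2 ^ k * s) G' \<and> (\<forall>x\<in>nbhd E (2 * s). G' x = G x)"
  using assms(2)
proof (induction k)
  case 0
  with assms show ?case by auto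
next
  case (Suc k)
  have le: "s \<le> 2 ^ k * s" using assms(1) by simp
  have "2 ^ k * s \<le> 2 ^ Suc k * s" using assms(1) by simp
  then have "2 ^ k * s \<le> \<sigma>" using Suc.prems by linarith
  with Suc.IH obtain G' where G': "extends_to_scale (2 ^ k * s) G'" "\<forall>x\<in>nbhd E (2 * s). G' x = G x"
    by blast
  obtain G'' where "extends_to_scale (2 * (2 ^ k * s)) G''"
      "\<And>x. x \<in> nbhd E (2 * (2 ^ k * s)) \<Longrightarrow> G'' x = G' x"
    using extends_to_scale_double[OF _ \<open>2 ^ k * s \<le> \<sigma>\<close> G'(1)] assms(1) by auto
  moreover have "nbhd E (2 * s) \<subseteq> nbhd E (2 * (2 ^ k * s))"
    using le by (intro nbhd_mono) simp
  ultimately show ?case using G'(2) by (intro exI[of _ G'']) (auto simp: mult.assoc subset_iff)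
qed

text \<open>One last cutoff, now against 0, makes the function global. It is affordable at scale
  \<sigma>, where \<open>G\<close> itself has size of order
  \<open>\<epsilon> * \<sigma> ^ m\<close>.\<close>

lemma extension_exists:
  assumes "s > 0" "\<sigma> = 2 ^ k * s" "extends_to_scale s f"
  shows "\<exists>G. Cm_on m UNIV G \<and> (\<forall>x. jet_bound m \<sigma> (2 ^ m * c_cutoff * c_all * \<epsilon> * \<sigma> ^ m) G x)
    \<and> (\<forall>x\<in>nbhd E (2 * s). G x = f x)"
proof -
  obtain G where G: "extends_to_scale \<sigma> G" "\<forall>x\<in>nbhd E (2 * s). G x = f x"
    using extends_to_all_scales[OF assms(1) _ assms(3), of k] assms(2) by auto
  obtain R where R: "\<And>x. x \<in> nbhd E (2 * \<sigma>) \<Longrightarrow> norm x \<le> R"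
    using nbhd_norm_bound[OF E] by blast
  obtain Z :: "(real ^ 'n) set" and \<phi> where "unit_partition m C N \<sigma> R Z \<phi>" using partition \<sigma> by blast
  then obtain \<eta> K where \<eta>: "Cm_on m UNIV \<eta>" "closed K" "K \<subseteq> nbhd E (4 * \<sigma>)"
      "\<And>x. x \<notin> K \<Longrightarrow> \<eta> x = 0" "\<And>x. x \<in> nbhd E (2 * \<sigma>) \<Longrightarrow> \<eta> x = 1"
      "\<And>x. jet_bound m \<sigma> c_cutoff \<eta> x"
    using cutoff_exists[OF _ \<sigma> C R] unfolding c_cutoff_def by blast
  let ?U = "nbhd E (4 * \<sigma>)"
  let ?G = "\<lambda>x. if x \<in> ?U then \<eta> x * G x else 0"
  have GCm: "Cm_on m ?U G" and Ga: "\<And>x. x \<in> ?U \<Longrightarrow> jet_bound m \<sigma> (c_all * \<epsilon> * \<sigma> ^ m) G x"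
    using G unfolding extends_to_scale_def by auto
  have "jet_bound m \<sigma> (2 ^ m * c_cutoff * (c_all * \<epsilon> * \<sigma> ^ m)) ?G x" for x
  proof (cases "x \<in> ?U")
    case True
    have "jet_bound m \<sigma> (2 ^ m * c_cutoff * (c_all * \<epsilon> * \<sigma> ^ m)) (\<lambda>x. \<eta> x * G x) x"
      using True by (intro jet_bound_mult[OF open_nbhd True] Cm_on_subset[OF \<eta>(1)] GCm Ga \<eta>(6) \<sigma>) auto
    then show ?thesis using jet_bound_cong[OF open_nbhd True, of ?G "\<lambda>x. \<eta> x * G x"] by simp
  next
    case False
    then show ?thesis
      using \<eta> \<epsilon> \<sigma> c_nonneg by (intro jet_bound_zero[of "- K"]) auto
  qed
  moreover have "Cm_on m UNIV ?G"
    using \<eta>(2-4) by (intro Cm_on_extend_zero[of _ K] Cm_on_mult Cm_on_subset[OF \<eta>(1)] GCm) auto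
  moreover have "?G x = f x" if "x \<in> nbhd E (2 * s)" for x
  proof -
    have "s \<le> \<sigma>" using assms(1,2) by simp
    then have "x \<in> nbhd E (2 * \<sigma>)" "x \<in> ?U"
      using that nbhd_mono[of "2 * s" "2 * \<sigma>" E] nbhd_mono[of "2 * s" "4 * \<sigma>" E] \<sigma> by auto
    with that G(2) \<eta>(5) show ?thesis by simp
  qed
  ultimately show ?thesis by (intro exI[of _ ?G]) (simp add: mult.assoc)
qed

end

text \<open>\<open>K\<close> precedes \<open>E\<close>, \<open>f\<close>, \<epsilon>,
  \<open>s\<close> and \<open>k\<close>. The number \<open>k\<close> of doublings will depend on
  \<epsilon> through the width of the cone, and it leaves the bound untouched.\<close>

lemma whitney_extension_at_scale:
  "\<exists>K\<ge>0. \<forall>(E :: (real ^ 'n::finite) set) f \<epsilon> s k. bounded E \<longrightarrow> \<epsilon> \<ge> 0 \<longrightarrow> s > 0 \<longrightarrow>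
    Cm_on m (nbhd E (4 * s)) f \<longrightarrow>
    (\<forall>x\<in>nbhd E (4 * s). \<forall>\<alpha>. mi_deg \<alpha> \<le> m \<longrightarrow> \<bar>mi_deriv \<alpha> f x\<bar> \<le> \<epsilon> * (2 ^ k * s) ^ (m - mi_deg \<alpha>)) \<longrightarrow>
    (\<forall>x\<in>nbhd E (4 * s). \<forall>y\<in>E. \<forall>\<alpha>. x \<noteq> y \<longrightarrow> mi_deg \<alpha> \<le> m \<longrightarrow>
      \<bar>mi_deriv \<alpha> f x - (\<Sum>\<gamma> | mi_deg \<gamma> \<le> m - mi_deg \<alpha>.
        1 / mi_fact \<gamma> * mi_deriv (\<alpha> + \<gamma>) f y * mi_power (x - y) \<gamma>)\<bar>
      \<le> \<epsilon> * norm (x - y) ^ (m - mi_deg \<alpha>)) \<longrightarrow>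
    (\<exists>G. Cm_on m UNIV G \<and> (\<forall>x. jet_bound m (2 ^ k * s) (K * \<epsilon> * (2 ^ k * s) ^ m) G x)
      \<and> (\<forall>x\<in>nbhd E (2 * s). G x = f x))"
proof -
  obtain C N where C: "C \<ge> 0"
    and P: "\<And>s R. s > 0 \<Longrightarrow> \<exists>(Z :: (real ^ 'n) set) \<phi>. unit_partition m C N s R Z \<phi>"
    using unit_partition_exists[of m, where 'n='n] by blast
  \<comment> \<open>A trivial instance names the constants before \<open>E\<close> and
    \<open>f\<close> are given; at the end the constants of both instances unfold to the same
    expressions.\<close>
  interpret c: whitney_jets m C N "{} :: (real ^ 'n) set" "\<lambda>_ _. 0" 1 1
    by unfold_locales (simp_all add: C P)
  show ?thesis
  proof (intro exI[of _ "2 ^ m * c.c_cutoff * c.c_all"] conjI allI impI)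
    show "0 \<le> 2 ^ m * c.c_cutoff * c.c_all" using c.c_nonneg by simp
    fix E :: "(real ^ 'n) set" and f \<epsilon> s k
    assume E: "bounded E" and \<epsilon>: "(0 :: real) \<le> \<epsilon>" and s: "(0 :: real) < s"
      and f: "Cm_on m (nbhd E (4 * s)) f"
      and f1: "\<forall>x\<in>nbhd E (4 * s). \<forall>\<alpha>. mi_deg \<alpha> \<le> m \<longrightarrow>
        \<bar>mi_deriv \<alpha> f x\<bar> \<le> \<epsilon> * (2 ^ k * s) ^ (m - mi_deg \<alpha>)"
      and f2: "\<forall>x\<in>nbhd E (4 * s). \<forall>y\<in>E. \<forall>\<alpha>. x \<noteq> y \<longrightarrow> mi_deg \<alpha> \<le> m \<longrightarrow>
        \<bar>mi_deriv \<alpha> f x - (\<Sum>\<gamma> | mi_deg \<gamma> \<le> m - mi_deg \<alpha>.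
          1 / mi_fact \<gamma> * mi_deriv (\<alpha> + \<gamma>) f y * mi_power (x - y) \<gamma>)\<bar>
        \<le> \<epsilon> * norm (x - y) ^ (m - mi_deg \<alpha>)"
    \<comment> \<open>Setting the jets to 0 above degree \<open>m\<close> turns the Taylor sum up to
      \<open>m - mi_deg \<alpha>\<close> into one over all degrees up to \<open>m\<close>, as
      \<open>taylor_poly\<close> demands.\<close>
    define J where "J = (\<lambda>y \<gamma>. if mi_deg \<gamma> \<le> m then mi_deriv \<gamma> f y else 0)"
    have sum_eq: "(\<Sum>\<gamma> | mi_deg \<gamma> \<le> m - mi_deg \<alpha>. 1 / mi_fact \<gamma> * mi_deriv (\<alpha> + \<gamma>) f y * mi_power (x - y) \<gamma>)
        = taylor_poly m (\<lambda>\<gamma>. J y (\<gamma> + \<alpha>)) y x" if "mi_deg \<alpha> \<le> m" for \<alpha> x y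
      unfolding taylor_poly_def using that finite_mi_deg_le[of m]
      by (intro sum.mono_neutral_cong_left) (auto simp: J_def mi_deg_add mi_monom_eq add.commute)
    have EU: "y \<in> nbhd E (4 * s)" if "y \<in> E" for y
      using that s by (auto simp: nbhd_def intro!: bexI[of _ y])
    have T: "\<bar>mi_deriv \<alpha> f x - taylor_poly m (\<lambda>\<gamma>. J y (\<gamma> + \<alpha>)) y x\<bar> \<le> \<epsilon> * dist x y ^ (m - mi_deg \<alpha>)"
      if "x \<in> nbhd E (4 * s)" "y \<in> E" "mi_deg \<alpha> \<le> m" for x y \<alpha>
    proof (cases "x = y")
      case False
      with f2 that show ?thesis by (simp add: dist_norm flip: sum_eq)
    next
      \<comment> \<open>The Whitney condition on \<open>J\<close> includes equal points, which the
        estimate for \<open>f\<close> leaves out; there the Taylor polynomial reduces to its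
        constant term.\<close>
      case True
      have "mi_monom \<gamma> (0 :: real ^ 'n) = 0" if nz: "\<gamma> \<noteq> 0" for \<gamma>
      proof -
        obtain i where "Poly_Mapping.lookup \<gamma> i \<noteq> 0"
          using nz poly_mapping_eqI[of \<gamma> 0] by auto
        then show ?thesis unfolding mi_monom_def by (intro prod_zero) (auto simp: power_0_left)
      qed
      moreover have "mi_monom 0 (0 :: real ^ 'n) = 1" by (simp add: mi_monom_def)
      ultimately have monom: "mi_monom \<gamma> (0 :: real ^ 'n) = (if \<gamma> = 0 then 1 else 0)" for \<gamma> by simp
      have "taylor_poly m (\<lambda>\<gamma>. J y (\<gamma> + \<alpha>)) y y = (\<Sum>\<gamma> :: 'n multiindex | mi_deg \<gamma> \<le> m. if \<gamma> = 0 then J y \<alpha> else 0)"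
        unfolding taylor_poly_def by (intro sum.cong) (auto simp: monom)
      also have "\<dots> = mi_deriv \<alpha> f y"
        using that(3) by (simp add: J_def finite_mi_deg_le)
      finally have "taylor_poly m (\<lambda>\<gamma>. J y (\<gamma> + \<alpha>)) y y = mi_deriv \<alpha> f y" .
      with True \<epsilon> show ?thesis by simp
    qed
    interpret w: whitney_jets m C N E J \<epsilon> "2 ^ k * s"
    proof unfold_locales
      fix y z and \<alpha> :: "'n multiindex" assume "y \<in> E" "z \<in> E" "mi_deg \<alpha> \<le> m"
      then show "\<bar>J z \<alpha> - taylor_poly m (\<lambda>\<gamma>. J y (\<gamma> + \<alpha>)) y z\<bar> \<le> \<epsilon> * dist z y ^ (m - mi_deg \<alpha>)"
        using T[OF EU, of z y \<alpha>] by (simp add: J_def)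
    qed (simp_all add: C P E \<epsilon> s f1 EU J_def)
    have "w.extends_to_scale s f"
      unfolding w.extends_to_scale_def
    proof (intro conjI ballI impI f)
      fix x assume x: "x \<in> nbhd E (4 * s)"
      have "jet_bound m (2 ^ k * s) (\<epsilon> * (2 ^ k * s) ^ m) f x"
        using x f1 s by (intro jet_boundI) auto
      moreover have "1 * (\<epsilon> * (2 ^ k * s) ^ m) \<le> w.c_all * (\<epsilon> * (2 ^ k * s) ^ m)"
        using w.c_nonneg(4) \<epsilon> s by (intro mult_right_mono) auto
      ultimately show "jet_bound m (2 ^ k * s) (w.c_all * \<epsilon> * (2 ^ k * s) ^ m) f x"
        using s by (auto intro: jet_bound_mono simp: mult.assoc)
    next
      fix x y assume x: "x \<in> nbhd E (4 * s) - nbhd E (2 * s)" and y: "y \<in> E" "dist x y < 4 * s"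
      have "\<bar>mi_deriv \<alpha> (\<lambda>x. f x - w.T y x) x\<bar> \<le> (4 ^ m * \<epsilon>) * s ^ (m - mi_deg \<alpha>)"
        if \<alpha>: "mi_deg \<alpha> \<le> m" for \<alpha>
      proof -
        have "mi_deriv \<alpha> (\<lambda>x. f x - w.T y x) x = mi_deriv \<alpha> f x - taylor_poly m (\<lambda>\<gamma>. J y (\<gamma> + \<alpha>)) y x"
          using x by (subst mi_deriv_diff[OF open_nbhd _ f w.Cm_on_T \<alpha>])
            (auto simp: mi_deriv_taylor_poly w.J0)
        also have "\<bar>\<dots>\<bar> \<le> \<epsilon> * dist x y ^ (m - mi_deg \<alpha>)"
          using x y \<alpha> by (intro T) auto
        also have "\<dots> \<le> \<epsilon> * (4 * s) ^ (m - mi_deg \<alpha>)"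
          using y \<epsilon> by (intro mult_left_mono power_mono) auto
        also have "\<dots> \<le> \<epsilon> * (4 ^ m * s ^ (m - mi_deg \<alpha>))"
          unfolding power_mult_distrib using \<epsilon> s by (intro mult_left_mono mult_right_mono power_increasing) auto
        finally show ?thesis by (simp add: mult_ac)
      qed
      then have "jet_bound m s (4 ^ m * \<epsilon> * s ^ m) (\<lambda>x. f x - w.T y x) x"
        by (rule jet_boundI[OF s])
      then show "jet_bound m s ((w.c_layer + 4 ^ m) * \<epsilon> * s ^ m) (\<lambda>x. f x - w.T y x) x"
        by (rule jet_bound_mono) (use s \<epsilon> w.c_nonneg in \<open>auto intro!: mult_right_mono\<close>)
    qed
    from w.extension_exists[OF s refl this]
    show "\<exists>G. Cm_on m UNIV G
        \<and> (\<forall>x. jet_bound m (2 ^ k * s) (2 ^ m * c.c_cutoff * c.c_all * \<epsilon> * (2 ^ k * s) ^ m) G x)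
        \<and> (\<forall>x\<in>nbhd E (2 * s). G x = f x)"
      unfolding w.c_cutoff_def c.c_cutoff_def w.c_all_def c.c_all_def w.c_glue_def c.c_glue_def
        w.c_layer_def c.c_layer_def .
  qed
qed

section \<open>Cones and directions\<close>

lemma set_edist_less_iff: "set_edist x Y < ereal \<delta> \<longleftrightarrow> (\<exists>y\<in>Y. dist x y < \<delta>)"
  by (simp add: set_edist_def INF_less_iff)

text \<open>The difference splits into a change of length along \<open>x\<close> and the vector
  \<open>x - y\<close> divided by \<open>norm y\<close>; each part is at most
  \<open>dist x y / norm y\<close>.\<close>

lemma dist_directions:
  fixes x y :: "'a::real_normed_vector"
  assumes "x \<noteq> 0" "y \<noteq> 0"
  shows "dist (x /\<^sub>R norm x) (y /\<^sub>R norm y) \<le> 2 * dist x y / norm y"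
proof -
  have "(norm y - norm x) / norm y * inverse (norm x) = inverse (norm x) - inverse (norm y)"
    using assms by (simp add: field_simps)
  then have "x /\<^sub>R norm x - y /\<^sub>R norm y = ((norm y - norm x) / norm y) *\<^sub>R (x /\<^sub>R norm x) + (x - y) /\<^sub>R norm y"
    by (simp add: scaleR_diff_left scaleR_diff_right)
  then have "dist (x /\<^sub>R norm x) (y /\<^sub>R norm y)
      \<le> norm (((norm y - norm x) / norm y) *\<^sub>R (x /\<^sub>R norm x)) + norm ((x - y) /\<^sub>R norm y)"
    by (simp only: dist_norm norm_triangle_ineq)
  also have "\<dots> = \<bar>norm y - norm x\<bar> / norm y + norm (x - y) / norm y"
    unfolding norm_scaleR[of "(norm y - norm x) / norm y"] using assms
    by simp (simp add: divide_inverse mult.commute)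
  also have "\<dots> \<le> 2 * dist x y / norm y"
    using norm_triangle_ineq3[of y x] assms
    by (simp add: dist_norm norm_minus_commute divide_right_mono flip: add_divide_distrib)
  finally show ?thesis .
qed

lemma dist_ray_point:
  fixes x \<omega> :: "'a::real_normed_vector"
  assumes "x \<noteq> 0"
  shows "dist x (norm x *\<^sub>R \<omega>) = norm x * dist (x /\<^sub>R norm x) \<omega>"
proof -
  have "x - norm x *\<^sub>R \<omega> = norm x *\<^sub>R (x /\<^sub>R norm x - \<omega>)"
    using assms by (simp add: scaleR_diff_right)
  then show ?thesis by (simp add: dist_norm)
qed

text \<open>The 4 is the 2 of \<open>dist_directions\<close> doubled by
  \<open>norm y > \<rho> / 2\<close>; the bound 1/4 on \<open>c\<close> keeps \<open>x\<close> away
  from the origin.\<close>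

lemma near_direction:
  fixes x y :: "'a::real_normed_vector"
  assumes d: "dist x y < c * \<rho>" "c \<le> 1 / 4" and y: "\<rho> / 2 < norm y" "norm y < 2 * \<rho>"
  shows "\<rho> / 4 < norm x" "norm x < 3 * \<rho>" "dist (x /\<^sub>R norm x) (y /\<^sub>R norm y) < 4 * c"
proof -
  have \<rho>: "\<rho> > 0" using y by linarith
  have "c * \<rho> \<le> 1 / 4 * \<rho>" using d \<rho> by (intro mult_right_mono) auto
  with d(1) have "dist x y < \<rho> / 4" by simp
  moreover have "norm x \<ge> norm y - dist x y" "norm x \<le> norm y + dist x y"
    using norm_triangle_ineq2[of y x] norm_triangle_ineq2[of x y] by (simp_all add: dist_norm norm_minus_commute)
  ultimately show x: "\<rho> / 4 < norm x" "norm x < 3 * \<rho>" using y by linarith+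
  have "2 * dist x y < 4 * c * norm y"
  proof -
    have "2 * dist x y < 2 * c * \<rho>" using d by simp
    also have "c > 0" using d(1) \<rho> zero_le_dist[of x y] by (smt (verit) mult_nonpos_nonneg)
    then have "2 * c * \<rho> \<le> 4 * c * norm y" using y by simp
    finally show ?thesis .
  qed
  moreover have "norm y > 0" using y \<rho> by linarith
  ultimately have "2 * dist x y / norm y < 4 * c" by (simp only: pos_divide_less_eq)
  moreover have "x \<noteq> 0" "y \<noteq> 0" using x(1) y(1) \<rho> by force+
  ultimately show "dist (x /\<^sub>R norm x) (y /\<^sub>R norm y) < 4 * c"
    using dist_directions[of x y] by linarith
qed

text \<open>Being forbidden is an open condition: the same polynomials and constants serve all
  directions within \<open>\<delta> / 2\<close>, on cones of half the aperture.\<close>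

lemma compact_Allow: "compact (Allow m I)"
proof -
  have "open {\<omega>. forbidden_dir m I \<omega>}"
    unfolding open_dist
  proof safe
    fix \<omega> assume "forbidden_dir m I \<omega>"
    then obtain L P c \<delta> r where P: "\<forall>l\<in>{1..L::nat}. P l \<in> I" "c > 0" "\<delta> > 0" "r > 0"
      and *: "\<forall>x\<in>cone {\<omega>} \<delta> r. (\<Sum>l=1..L. \<bar>poly_eval (P l) x\<bar>) > c * norm x ^ m"
      unfolding forbidden_dir_def by blast
    have "forbidden_dir m I \<omega>'" if "dist \<omega>' \<omega> < \<delta> / 2" for \<omega>'
    proof -
      have "cone {\<omega>'} (\<delta> / 2) r \<subseteq> cone {\<omega>} \<delta> r"
      proof
        fix x assume "x \<in> cone {\<omega>'} (\<delta> / 2) r"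
        then show "x \<in> cone {\<omega>} \<delta> r"
          using that dist_triangle[of "x /\<^sub>R norm x" \<omega> \<omega>'] by (auto simp: cone_def set_edist_less_iff)
      qed
      with P * show ?thesis
        unfolding forbidden_dir_def
        by (intro exI[of _ L] exI[of _ P] exI[of _ c] exI[of _ "\<delta> / 2"] exI[of _ r]) auto
    qed
    with P show "\<exists>e>0. \<forall>\<omega>'. dist \<omega>' \<omega> < e \<longrightarrow> \<omega>' \<in> {\<omega>. forbidden_dir m I \<omega>}"
      by (intro exI[of _ "\<delta> / 2"]) auto
  qed
  then have "compact (sphere 0 1 \<inter> - {\<omega>. forbidden_dir m I \<omega>})"
    by (intro compact_Int_closed) auto
  moreover have "Allow m I = sphere 0 1 \<inter> - {\<omega>. forbidden_dir m I \<omega>}" by (auto simp: Allow_def)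
  ultimately show ?thesis by simp
qed


section \<open>From strong directional implication to implication\<close>

text \<open>Including \<open>b\<close> in the minimum gives it a value when \<open>A\<close> is
  empty, as for the cover when no direction is allowed.\<close>

lemma finite_lower_bound:
  fixes f :: "'a \<Rightarrow> real"
  assumes "finite A" "\<And>a. a \<in> A \<Longrightarrow> 0 < f a" "0 < b"
  obtains c where "0 < c" "c \<le> b" "\<And>a. a \<in> A \<Longrightarrow> c \<le> f a"
  using assms by (intro that[of "Min (insert b (f ` A))"]) auto

text \<open>\<open>F\<close> lives on a cone and is small only near \<Omega>. The replacement
  \<open>G\<close> is small everywhere at scale \<rho>, so it can be multiplied by bumps whose mesh
  does not depend on \<epsilon>.\<close>

lemma negligible_extension:
  fixes \<Omega> :: "(real ^ 'n::finite) set"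
  assumes F: "negligible_for m U \<Omega> F" and \<Omega>: "\<Omega> \<subseteq> sphere 0 1" and \<epsilon>: "\<epsilon> > 0"
  shows "\<exists>\<delta>>0. \<exists>r>0. \<forall>\<rho>. 0 < \<rho> \<and> \<rho> \<le> r \<longrightarrow>
    (\<exists>G. Cm_on m UNIV G \<and> (\<forall>x. jet_bound m \<rho> (\<epsilon> * \<rho> ^ m) G x) \<and>
      (\<forall>x \<omega>. \<rho> / 2 < norm x \<longrightarrow> norm x < 2 * \<rho> \<longrightarrow> \<omega> \<in> \<Omega> \<longrightarrow> dist (x /\<^sub>R norm x) \<omega> < \<delta> \<longrightarrow> G x = F x))"
proof -
  obtain K :: real where K: "K \<ge> 0" and ext:
    "\<And>(E :: (real ^ 'n) set) f \<epsilon> s k. bounded E \<Longrightarrow> \<epsilon> \<ge> 0 \<Longrightarrow> s > 0 \<Longrightarrow> Cm_on m (nbhd E (4 * s)) f \<Longrightarrow>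
      (\<forall>x\<in>nbhd E (4 * s). \<forall>\<alpha>. mi_deg \<alpha> \<le> m \<longrightarrow> \<bar>mi_deriv \<alpha> f x\<bar> \<le> \<epsilon> * (2 ^ k * s) ^ (m - mi_deg \<alpha>)) \<Longrightarrow>
      (\<forall>x\<in>nbhd E (4 * s). \<forall>y\<in>E. \<forall>\<alpha>. x \<noteq> y \<longrightarrow> mi_deg \<alpha> \<le> m \<longrightarrow>
        \<bar>mi_deriv \<alpha> f x - (\<Sum>\<gamma> | mi_deg \<gamma> \<le> m - mi_deg \<alpha>.
          1 / mi_fact \<gamma> * mi_deriv (\<alpha> + \<gamma>) f y * mi_power (x - y) \<gamma>)\<bar>
        \<le> \<epsilon> * norm (x - y) ^ (m - mi_deg \<alpha>)) \<Longrightarrow>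
      \<exists>G. Cm_on m UNIV G \<and> (\<forall>x. jet_bound m (2 ^ k * s) (K * \<epsilon> * (2 ^ k * s) ^ m) G x)
        \<and> (\<forall>x\<in>nbhd E (2 * s). G x = f x)"
    using whitney_extension_at_scale[of m, where 'n='n] by blast
  \<comment> \<open>\<open>3 ^ m\<close> accounts for bounds in terms of \<open>norm x\<close>,
    which may come close to \<open>3 * \<rho>\<close>; the 1 in the denominator covers
    \<open>K = 0\<close>.\<close>
  define \<epsilon>' where "\<epsilon>' = \<epsilon> / (K * 3 ^ m + 1)"
  have \<epsilon>': "\<epsilon>' > 0" "K * (\<epsilon>' * 3 ^ m) \<le> \<epsilon>"
  proof -
    have pos: "K * 3 ^ m + 1 > 0" using K by (simp add: add_nonneg_pos)
    then show "\<epsilon>' > 0" using \<epsilon> by (simp add: \<epsilon>'_def)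
    have "K * 3 ^ m / (K * 3 ^ m + 1) \<le> 1" using pos by simp
    then have "\<epsilon> * (K * 3 ^ m / (K * 3 ^ m + 1)) \<le> \<epsilon> * 1" using \<epsilon> by (intro mult_left_mono) auto
    then show "K * (\<epsilon>' * 3 ^ m) \<le> \<epsilon>" by (simp add: \<epsilon>'_def mult_ac)
  qed
  have CmF: "Cm_on m U F" using F by (simp add: negligible_for_def)
  from F[unfolded negligible_for_def, THEN conjunct2, rule_format, OF \<epsilon>'(1)]
  obtain \<delta>' r' where \<delta>': "\<delta>' > 0" "r' > 0" "cone \<Omega> \<delta>' r' \<subseteq> U"
    and F1: "\<forall>x\<in>cone \<Omega> \<delta>' r'. \<forall>\<alpha>. mi_deg \<alpha> \<le> m \<longrightarrow> \<bar>mi_deriv \<alpha> F x\<bar> \<le> \<epsilon>' * norm x ^ (m - mi_deg \<alpha>)"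
    and F2: "\<forall>x\<in>cone \<Omega> \<delta>' r'. \<forall>y\<in>cone \<Omega> \<delta>' r'. \<forall>\<alpha>. x \<noteq> y \<and> mi_deg \<alpha> \<le> m \<longrightarrow>
        \<bar>mi_deriv \<alpha> F x - (\<Sum>\<gamma> | mi_deg \<gamma> \<le> m - mi_deg \<alpha>.
          1 / mi_fact \<gamma> * mi_deriv (\<alpha> + \<gamma>) F y * mi_power (x - y) \<gamma>)\<bar>
        \<le> \<epsilon>' * norm (x - y) ^ (m - mi_deg \<alpha>)"
    by (elim exE conjE) (rule that)
  \<comment> \<open>With \<open>s = \<rho> / 2 ^ k\<close>, points within \<open>4 * s\<close> of
    \<open>E\<close> have directions less than \<open>4 * c \<le> \<delta>'\<close> from \<Omega>,
    so they stay in the cone where \<open>F\<close> is controlled.\<close>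
  obtain k where k: "16 / min \<delta>' 1 < 2 ^ k" using real_arch_pow[of 2 "16 / min \<delta>' 1"] by auto
  define c where "c = 1 / 2 ^ k * (4 :: real)"
  have c: "c \<le> 1 / 4" "4 * c \<le> \<delta>'" "c > 0"
  proof -
    have "16 < 2 ^ k * min \<delta>' 1" using k \<delta>'(1) by (simp add: pos_divide_less_eq)
    moreover have "2 ^ k * min \<delta>' 1 \<le> 2 ^ k * 1" "2 ^ k * min \<delta>' 1 \<le> 2 ^ k * \<delta>'"
      by (intro mult_left_mono; simp)+
    ultimately have "16 \<le> (2 :: real) ^ k" "16 \<le> 2 ^ k * \<delta>'" by linarith+
    then show "c \<le> 1 / 4" "4 * c \<le> \<delta>'" by (simp_all add: c_def field_simps)
  qed (simp add: c_def)
  show ?thesis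
  \<comment> \<open>A point of the annulus with direction within \<open>1 / 2 ^ k\<close> of
    \<Omega> lies within \<open>2 * s\<close> of \<open>E\<close>, where the extension agrees with
    \<open>F\<close>; \<open>r' / 3\<close> leaves room for norms below
    \<open>3 * \<rho>\<close>.\<close>
  proof (rule exI[of _ "1 / 2 ^ k"], rule conjI, simp, rule exI[of _ "r' / 3"], intro conjI allI impI)
    fix \<rho> :: real assume "0 < \<rho> \<and> \<rho> \<le> r' / 3"
    then have \<rho>: "\<rho> > 0" "3 * \<rho> \<le> r'" by auto
    define s where "s = \<rho> / 2 ^ k"
    have s: "s > 0" "2 ^ k * s = \<rho>" "4 * s = c * \<rho>" using \<rho> by (auto simp: s_def c_def)
    define E where "E = {y. \<rho> / 2 < norm y \<and> norm y < 2 * \<rho> \<and> y /\<^sub>R norm y \<in> \<Omega>}"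
    have "norm y \<le> 2 * \<rho>" if "y \<in> E" for y using that by (simp add: E_def)
    then have E: "bounded E" by (auto simp: bounded_iff)
    have near: "norm x < 3 * \<rho>" "x \<in> cone \<Omega> \<delta>' r'" if x: "x \<in> nbhd E (4 * s)" for x
    proof -
      obtain y where y: "y \<in> E" "dist x y < c * \<rho>" using x unfolding nbhd_def s(3) by auto
      then have ny: "\<rho> / 2 < norm y" "norm y < 2 * \<rho>" by (simp_all add: E_def)
      note * = near_direction[OF y(2) c(1) ny]
      show "norm x < 3 * \<rho>" by (rule *(2))
      have "0 < norm x" using *(1) \<rho>(1) by linarith
      moreover have "dist (x /\<^sub>R norm x) (y /\<^sub>R norm y) < \<delta>'" using *(3) c(2) by linarith
      moreover have "norm x < r'" using \<open>norm x < 3 * \<rho>\<close> \<rho> by linarith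
      ultimately show "x \<in> cone \<Omega> \<delta>' r'" using y by (auto simp: cone_def set_edist_less_iff E_def)
    qed
    have En: "y \<in> nbhd E (4 * s)" if "y \<in> E" for y
      using that s(1) by (auto simp: nbhd_def intro!: bexI[of _ y])
    have "\<exists>G. Cm_on m UNIV G \<and> (\<forall>x. jet_bound m (2 ^ k * s) (K * (\<epsilon>' * 3 ^ m) * (2 ^ k * s) ^ m) G x)
        \<and> (\<forall>x\<in>nbhd E (2 * s). G x = F x)"
    proof (rule ext[OF E _ s(1)])
      show "0 \<le> \<epsilon>' * 3 ^ m" using \<epsilon>' by simp
      show "Cm_on m (nbhd E (4 * s)) F"
        using near(2) \<delta>'(3) by (intro Cm_on_subset[OF CmF]) auto
      show "\<forall>x\<in>nbhd E (4 * s). \<forall>\<alpha>. mi_deg \<alpha> \<le> m \<longrightarrow>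
          \<bar>mi_deriv \<alpha> F x\<bar> \<le> \<epsilon>' * 3 ^ m * (2 ^ k * s) ^ (m - mi_deg \<alpha>)"
      proof (intro ballI allI impI)
        fix x and \<alpha> :: "'n multiindex" assume x: "x \<in> nbhd E (4 * s)" and \<alpha>: "mi_deg \<alpha> \<le> m"
        have "\<bar>mi_deriv \<alpha> F x\<bar> \<le> \<epsilon>' * norm x ^ (m - mi_deg \<alpha>)" using F1 near(2)[OF x] \<alpha> by blast
        also have "\<dots> \<le> \<epsilon>' * (3 * \<rho>) ^ (m - mi_deg \<alpha>)"
          using near(1)[OF x] \<epsilon>' by (intro mult_left_mono power_mono) auto
        also have "\<dots> \<le> \<epsilon>' * (3 ^ m * \<rho> ^ (m - mi_deg \<alpha>))"
          unfolding power_mult_distrib using \<rho> \<epsilon>'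
          by (intro mult_left_mono mult_right_mono power_increasing) auto
        finally show "\<bar>mi_deriv \<alpha> F x\<bar> \<le> \<epsilon>' * 3 ^ m * (2 ^ k * s) ^ (m - mi_deg \<alpha>)"
          by (simp add: s(2) mult.assoc)
      qed
      show "\<forall>x\<in>nbhd E (4 * s). \<forall>y\<in>E. \<forall>\<alpha>. x \<noteq> y \<longrightarrow> mi_deg \<alpha> \<le> m \<longrightarrow>
        \<bar>mi_deriv \<alpha> F x - (\<Sum>\<gamma> | mi_deg \<gamma> \<le> m - mi_deg \<alpha>.
          1 / mi_fact \<gamma> * mi_deriv (\<alpha> + \<gamma>) F y * mi_power (x - y) \<gamma>)\<bar>
        \<le> \<epsilon>' * 3 ^ m * norm (x - y) ^ (m - mi_deg \<alpha>)"
      proof (intro ballI allI impI)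
        fix x y and \<alpha> :: "'n multiindex"
        assume x: "x \<in> nbhd E (4 * s)" and y: "y \<in> E" and ne: "x \<noteq> y" and \<alpha>: "mi_deg \<alpha> \<le> m"
        have "\<epsilon>' * 1 * norm (x - y) ^ (m - mi_deg \<alpha>) \<le> \<epsilon>' * 3 ^ m * norm (x - y) ^ (m - mi_deg \<alpha>)"
          using \<epsilon>' by (intro mult_left_mono mult_right_mono) auto
        moreover note F2[rule_format, OF near(2)[OF x] near(2)[OF En[OF y]] conjI[OF ne \<alpha>]]
        ultimately show "\<bar>mi_deriv \<alpha> F x - (\<Sum>\<gamma> | mi_deg \<gamma> \<le> m - mi_deg \<alpha>.
            1 / mi_fact \<gamma> * mi_deriv (\<alpha> + \<gamma>) F y * mi_power (x - y) \<gamma>)\<bar>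
          \<le> \<epsilon>' * 3 ^ m * norm (x - y) ^ (m - mi_deg \<alpha>)" by linarith
      qed
    qed
    then obtain G where G: "Cm_on m UNIV G" "\<And>x. jet_bound m \<rho> (K * (\<epsilon>' * 3 ^ m) * \<rho> ^ m) G x"
        "\<And>x. x \<in> nbhd E (2 * s) \<Longrightarrow> G x = F x" unfolding s(2) by blast
    have "jet_bound m \<rho> (\<epsilon> * \<rho> ^ m) G x" for x
      using G(2) by (rule jet_bound_mono) (use \<epsilon>' \<rho> in \<open>auto intro: mult_right_mono\<close>)
    moreover have "G x = F x" if x: "\<rho> / 2 < norm x" "norm x < 2 * \<rho>" "\<omega> \<in> \<Omega>"
      and d: "dist (x /\<^sub>R norm x) \<omega> < 1 / 2 ^ k" for x \<omega>
    proof (rule G(3))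
      have x0: "x \<noteq> 0" using x \<rho> by auto
      have "norm \<omega> = 1" using \<Omega> x by auto
      then have "norm x *\<^sub>R \<omega> \<in> E" using x x0 by (simp add: E_def)
      moreover have "dist x (norm x *\<^sub>R \<omega>) < 2 * s"
      proof -
        have "norm x * dist (x /\<^sub>R norm x) \<omega> < 2 * \<rho> * (1 / 2 ^ k)"
          using x d by (intro mult_strict_mono) auto
        then show ?thesis by (simp add: dist_ray_point[OF x0] s_def)
      qed
      ultimately show "x \<in> nbhd E (2 * s)" by (auto simp: nbhd_def)
    qed
    ultimately show "\<exists>G. Cm_on m UNIV G \<and> (\<forall>x. jet_bound m \<rho> (\<epsilon> * \<rho> ^ m) G x) \<and>
      (\<forall>x \<omega>. \<rho> / 2 < norm x \<longrightarrow> norm x < 2 * \<rho> \<longrightarrow> \<omega> \<in> \<Omega> \<longrightarrow> dist (x /\<^sub>R norm x) \<omega> < 1 / 2 ^ k \<longrightarrow> G x = F x)"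
      using G(1) by blast
  qed (use \<delta>' in auto)
qed

text \<open>Gluing yields functions on the whole space, indexed by pairs of a direction and a
  number; restriction to the annulus and a renumbering give the required form.\<close>

lemma implies_jetI:
  fixes I :: "'n::finite rpoly set"
  assumes J: "finite J" and A: "A > 0" and Q: "\<And>j. j \<in> J \<Longrightarrow> Q j \<in> I"
    and scale: "\<And>\<epsilon>. \<epsilon> > 0 \<Longrightarrow> \<exists>\<delta>>0. \<exists>r>0. \<forall>\<rho>. 0 < \<rho> \<and> \<rho> \<le> r \<longrightarrow> (\<exists>F S.
      Cm_on m UNIV F \<and> (\<forall>x. jet_bound m \<rho> (\<epsilon> * \<rho> ^ m) F x) \<and>
      (\<forall>j\<in>J. Cm_on m UNIV (S j) \<and> (\<forall>x. jet_bound m \<rho> A (S j) x)) \<and>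
      (\<forall>x \<omega>. \<rho> / 2 < norm x \<longrightarrow> norm x < 2 * \<rho> \<longrightarrow> \<omega> \<in> Allow m I \<longrightarrow> dist (x /\<^sub>R norm x) \<omega> < \<delta> \<longrightarrow>
        poly_eval p x = F x + (\<Sum>j\<in>J. S j x * poly_eval (Q j) x)))"
  shows "implies_jet m I p"
proof -
  obtain h where h: "bij_betw h {1..card J} J" using ex_bij_betw_nat_finite_1[OF J] by blast
  then have hJ: "h l \<in> J" if "l \<in> {1..card J}" for l using that by (auto simp: bij_betw_def)
  show ?thesis
    unfolding implies_jet_def
  proof (rule exI[of _ A], rule exI[of _ "card J"], rule exI[of _ "Q \<circ> h"], intro conjI allI impI)
    fix \<epsilon> :: real assume "\<epsilon> > 0"
    from scale[OF this] obtain \<delta> r where \<delta>: "\<delta> > 0" "r > 0" and *: "\<forall>\<rho>. 0 < \<rho> \<and> \<rho> \<le> r \<longrightarrow> (\<exists>F S.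
      Cm_on m UNIV F \<and> (\<forall>x. jet_bound m \<rho> (\<epsilon> * \<rho> ^ m) F x) \<and>
      (\<forall>j\<in>J. Cm_on m UNIV (S j) \<and> (\<forall>x. jet_bound m \<rho> A (S j) x)) \<and>
      (\<forall>x \<omega>. \<rho> / 2 < norm x \<longrightarrow> norm x < 2 * \<rho> \<longrightarrow> \<omega> \<in> Allow m I \<longrightarrow> dist (x /\<^sub>R norm x) \<omega> < \<delta> \<longrightarrow>
        poly_eval p x = F x + (\<Sum>j\<in>J. S j x * poly_eval (Q j) x)))"
      by (elim exE conjE) (rule that)
    show "\<exists>\<delta> r. \<delta> > 0 \<and> r > 0 \<and> (\<forall>\<rho>. 0 < \<rho> \<and> \<rho> \<le> r \<longrightarrow>
         (\<exists>F S. Cm_on m (annulus 4 \<rho>) F \<and> (\<forall>l\<in>{1..card J}. Cm_on m (annulus 4 \<rho>) (S l)) \<and>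
           (\<forall>x\<in>annulus 4 \<rho>. \<forall>\<alpha>. mi_deg \<alpha> \<le> m \<longrightarrow>
              \<bar>mi_deriv \<alpha> F x\<bar> \<le> \<epsilon> * \<rho> ^ (m - mi_deg \<alpha>)) \<and>
           (\<forall>x\<in>annulus 4 \<rho>. \<forall>\<alpha>. \<forall>l\<in>{1..card J}. mi_deg \<alpha> \<le> m \<longrightarrow>
              \<bar>mi_deriv \<alpha> (S l) x\<bar> \<le> A / \<rho> ^ mi_deg \<alpha>) \<and>
           (\<forall>x\<in>annulus 2 \<rho>. set_edist (x /\<^sub>R norm x) (Allow m I) < ereal \<delta> \<longrightarrow>
              poly_eval p x = F x + (\<Sum>l=1..card J. S l x * poly_eval ((Q \<circ> h) l) x))))"
    proof (rule exI[of _ \<delta>], rule exI[of _ r], intro conjI allI impI)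
      fix \<rho> assume "0 < \<rho> \<and> \<rho> \<le> r"
      then have \<rho>: "0 < \<rho>" "\<rho> \<le> r" by auto
      from *[rule_format, OF conjI[OF \<rho>]] obtain F S
        where F: "Cm_on m UNIV F" "\<forall>x. jet_bound m \<rho> (\<epsilon> * \<rho> ^ m) F x"
        and S: "\<forall>j\<in>J. Cm_on m UNIV (S j) \<and> (\<forall>x. jet_bound m \<rho> A (S j) x)"
        and eq: "\<forall>x \<omega>. \<rho> / 2 < norm x \<longrightarrow> norm x < 2 * \<rho> \<longrightarrow> \<omega> \<in> Allow m I \<longrightarrow>
          dist (x /\<^sub>R norm x) \<omega> < \<delta> \<longrightarrow> poly_eval p x = F x + (\<Sum>j\<in>J. S j x * poly_eval (Q j) x)"
        by (elim exE conjE) (rule that)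
      have F': "\<bar>mi_deriv \<alpha> F x\<bar> \<le> \<epsilon> * \<rho> ^ (m - mi_deg \<alpha>)" if "mi_deg \<alpha> \<le> m" for \<alpha> x
        using jet_boundD[OF F(2)[rule_format] that] that \<rho> by (simp add: power_diff)
      have S': "Cm_on m UNIV (S (h l))" "\<And>x. jet_bound m \<rho> A (S (h l)) x" if "l \<in> {1..card J}" for l
        using S hJ[OF that] by auto
      have reindex: "(\<Sum>l=1..card J. S (h l) x * poly_eval (Q (h l)) x) = (\<Sum>j\<in>J. S j x * poly_eval (Q j) x)" for x
        using sum.reindex_bij_betw[OF h, of "\<lambda>j. S j x * poly_eval (Q j) x"] by simp
      show "\<exists>F S. Cm_on m (annulus 4 \<rho>) F \<and> (\<forall>l\<in>{1..card J}. Cm_on m (annulus 4 \<rho>) (S l)) \<and>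
           (\<forall>x\<in>annulus 4 \<rho>. \<forall>\<alpha>. mi_deg \<alpha> \<le> m \<longrightarrow>
              \<bar>mi_deriv \<alpha> F x\<bar> \<le> \<epsilon> * \<rho> ^ (m - mi_deg \<alpha>)) \<and>
           (\<forall>x\<in>annulus 4 \<rho>. \<forall>\<alpha>. \<forall>l\<in>{1..card J}. mi_deg \<alpha> \<le> m \<longrightarrow>
              \<bar>mi_deriv \<alpha> (S l) x\<bar> \<le> A / \<rho> ^ mi_deg \<alpha>) \<and>
           (\<forall>x\<in>annulus 2 \<rho>. set_edist (x /\<^sub>R norm x) (Allow m I) < ereal \<delta> \<longrightarrow>
              poly_eval p x = F x + (\<Sum>l=1..card J. S l x * poly_eval ((Q \<circ> h) l) x))"
      proof (rule exI[of _ F], rule exI[of _ "S \<circ> h"], intro conjI ballI allI impI)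
        show "Cm_on m (annulus 4 \<rho>) F" using Cm_on_subset[OF F(1)] by simp
        show "Cm_on m (annulus 4 \<rho>) ((S \<circ> h) l)" if "l \<in> {1..card J}" for l
          using Cm_on_subset[OF S'(1)[OF that]] by simp
        show "\<bar>mi_deriv \<alpha> F x\<bar> \<le> \<epsilon> * \<rho> ^ (m - mi_deg \<alpha>)" if "mi_deg \<alpha> \<le> m" for \<alpha> x
          by (rule F'[OF that])
        show "\<bar>mi_deriv \<alpha> ((S \<circ> h) l) x\<bar> \<le> A / \<rho> ^ mi_deg \<alpha>"
          if "l \<in> {1..card J}" "mi_deg \<alpha> \<le> m" for l \<alpha> x
          using jet_boundD[OF S'(2)[OF that(1)] that(2)] by simp
        fix x :: "real ^ 'n" assume "x \<in> annulus 2 \<rho>" "set_edist (x /\<^sub>R norm x) (Allow m I) < ereal \<delta>"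
        then show "poly_eval p x = F x + (\<Sum>l=1..card J. (S \<circ> h) l x * poly_eval ((Q \<circ> h) l) x)"
          using eq by (auto simp: annulus_def set_edist_less_iff reindex simp del: One_nat_def)
      qed
    qed (use \<delta> in auto)
  qed (use A Q hJ in auto)
qed

text \<open>With all the data as arguments, they can be chosen as functions of the direction. One
  constant \<open>B\<close> replaces the separate \<open>C l\<close>.\<close>

definition strong_data :: "nat \<Rightarrow> 'n::finite rpoly set \<Rightarrow> 'n rpoly \<Rightarrow> real ^ 'n \<Rightarrow> real \<Rightarrow> real \<Rightarrow> nat \<Rightarrow>
    (nat \<Rightarrow> 'n rpoly) \<Rightarrow> (real ^ 'n \<Rightarrow> real) \<Rightarrow> (nat \<Rightarrow> real ^ 'n \<Rightarrow> real) \<Rightarrow> real \<Rightarrow> bool" where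
  "strong_data m I p \<omega> \<delta> r L Q F S B \<longleftrightarrow> \<delta> > 0 \<and> r > 0 \<and> B > 0 \<and> (\<forall>l\<in>{1..L}. Q l \<in> I) \<and>
     negligible_for m (cone {\<omega>} \<delta> r) (Allow m I \<inter> dir_nbhd {\<omega>} \<delta>) F \<and>
     (\<forall>l\<in>{1..L}. Cm_on m (cone {\<omega>} \<delta> r) (S l) \<and> (\<forall>x\<in>cone {\<omega>} \<delta> r. jet_bound m (norm x) B (S l) x)) \<and>
     (\<forall>x\<in>cone {\<omega>} \<delta> r. poly_eval p x = (\<Sum>l=1..L. S l x * poly_eval (Q l) x) + F x)"

lemma strong_dataD:
  assumes "strong_data m I p \<omega> \<delta> r L Q F S B"
  shows "\<delta> > 0" "r > 0" "B > 0" "\<And>l. l \<in> {1..L} \<Longrightarrow> Q l \<in> I"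
    "negligible_for m (cone {\<omega>} \<delta> r) (Allow m I \<inter> dir_nbhd {\<omega>} \<delta>) F"
    "\<And>l. l \<in> {1..L} \<Longrightarrow> Cm_on m (cone {\<omega>} \<delta> r) (S l)"
    "\<And>l x. l \<in> {1..L} \<Longrightarrow> x \<in> cone {\<omega>} \<delta> r \<Longrightarrow> jet_bound m (norm x) B (S l) x"
    "\<And>x. x \<in> cone {\<omega>} \<delta> r \<Longrightarrow> poly_eval p x = (\<Sum>l=1..L. S l x * poly_eval (Q l) x) + F x"
  using assms unfolding strong_data_def by blast+

lemma strongly_implies_data:
  assumes "strongly_implies m I p \<omega>"
  shows "\<exists>\<delta> r L Q F S B. strong_data m I p \<omega> \<delta> r L Q F S B"
proof -
  from assms[unfolded strongly_implies_def] obtain \<delta> r L Q F S C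
    where "\<delta> > 0" "r > 0" and Q: "\<forall>l\<in>{1..L::nat}. Q l \<in> I \<and> C l > 0"
      and "Cm_on m (cone {\<omega>} \<delta> r) F" and S: "\<forall>l\<in>{1..L}. Cm_on m (cone {\<omega>} \<delta> r) (S l)"
      and F: "negligible_for m (cone {\<omega>} \<delta> r) (Allow m I \<inter> dir_nbhd {\<omega>} \<delta>) F"
      and SC: "\<forall>\<alpha>. \<forall>l\<in>{1..L}. \<forall>x\<in>cone {\<omega>} \<delta> r. mi_deg \<alpha> \<le> m \<longrightarrow>
           \<bar>mi_deriv \<alpha> (S l) x\<bar> \<le> C l / norm x ^ mi_deg \<alpha>"
      and p: "\<forall>x\<in>cone {\<omega>} \<delta> r. poly_eval p x = (\<Sum>l=1..L. S l x * poly_eval (Q l) x) + F x"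
    by (elim exE conjE) (rule that)
  define B where "B = 1 + (\<Sum>l=1..L. C l)"
  have "B > 0" unfolding B_def using Q by (intro add_pos_nonneg sum_nonneg) (auto intro: less_imp_le)
  moreover have "jet_bound m (norm x) B (S l) x" if l: "l \<in> {1..L}" and x: "x \<in> cone {\<omega>} \<delta> r" for l x
  proof (rule jet_bound_mono)
    show "jet_bound m (norm x) (C l) (S l) x" using SC l x by (auto simp: jet_bound_def)
    have "C l \<le> (\<Sum>l=1..L. C l)" using Q l by (intro member_le_sum) (auto intro: less_imp_le)
    then show "C l \<le> B" by (simp add: B_def)
    show "norm x > 0" using x by (simp add: cone_def)
  qed
  ultimately have "strong_data m I p \<omega> \<delta> r L Q F S B"
    unfolding strong_data_def using \<open>\<delta> > 0\<close> \<open>r > 0\<close> Q S F p by blast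
  then show ?thesis by blast
qed

section \<open>Gluing over a finite cover of the allowed directions\<close>

locale strong_cover =
  fixes m :: nat and I :: "'n::finite rpoly set" and p :: "'n rpoly" and T :: "(real ^ 'n) set"
    and d R :: "real ^ 'n \<Rightarrow> real" and L :: "real ^ 'n \<Rightarrow> nat" and Q :: "real ^ 'n \<Rightarrow> nat \<Rightarrow> 'n rpoly"
    and F :: "real ^ 'n \<Rightarrow> real ^ 'n \<Rightarrow> real" and S :: "real ^ 'n \<Rightarrow> nat \<Rightarrow> real ^ 'n \<Rightarrow> real"
    and B :: "real ^ 'n \<Rightarrow> real" and C :: real and N :: nat and \<eta> R0 B0 :: real
  assumes T: "finite T" "T \<subseteq> Allow m I" "Allow m I \<subseteq> (\<Union>\<omega>\<in>T. ball \<omega> (d \<omega> / 4))"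
    and data: "\<And>\<omega>. \<omega> \<in> T \<Longrightarrow> strong_data m I p \<omega> (d \<omega>) (R \<omega>) (L \<omega>) (Q \<omega>) (F \<omega>) (S \<omega>) (B \<omega>)"
    and \<eta>: "0 < \<eta>" "\<eta> \<le> 1" "\<And>\<omega>. \<omega> \<in> T \<Longrightarrow> \<eta> \<le> d \<omega>"
    and R0: "0 < R0" "\<And>\<omega>. \<omega> \<in> T \<Longrightarrow> R0 \<le> R \<omega>"
    and B0: "0 < B0" "\<And>\<omega>. \<omega> \<in> T \<Longrightarrow> B \<omega> \<le> B0"
    and C: "C \<ge> 0"
    and partition: "\<And>s R. s > 0 \<Longrightarrow> \<exists>(Z :: (real ^ 'n) set) \<phi>. unit_partition m C N s R Z \<phi>"
begin

text \<open>The cost of passing from the mesh \<open>\<eta> * \<rho> / 100\<close> of the patches to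
  the scale \<rho>.\<close>

definition K :: real where
  "K = (100 / \<eta>) ^ m"

definition J :: "((real ^ 'n) \<times> nat) set" where
  "J = Sigma T (\<lambda>\<omega>. {1..L \<omega>})"

text \<open>From the inside: \<open>4 ^ m\<close> passes from scale \<open>norm x\<close> to the
  mesh, then come the product with a bump, the overlap of the patches and the passage to scale
  \<rho>. Neither \<epsilon> nor \<rho> occurs, as \<open>A\<close> must be chosen first.\<close>

definition A :: real where
  "A = K * (N * (2 ^ m * C * (4 ^ m * B0)))"

lemma scale_exists:
  assumes \<rho>: "0 < \<rho>" "3 * \<rho> \<le> R0" and \<delta>: "\<delta> \<le> \<eta> / 200" and \<epsilon>: "\<epsilon> \<ge> 0"
    and G: "\<And>\<omega>. \<omega> \<in> T \<Longrightarrow> Cm_on m UNIV (G \<omega>)"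
      "\<And>\<omega> x. \<omega> \<in> T \<Longrightarrow> jet_bound m \<rho> (\<epsilon> * \<rho> ^ m) (G \<omega>) x"
      "\<And>\<omega> x \<omega>'. \<omega> \<in> T \<Longrightarrow> \<rho> / 2 < norm x \<Longrightarrow> norm x < 2 * \<rho> \<Longrightarrow>
        \<omega>' \<in> Allow m I \<inter> dir_nbhd {\<omega>} (d \<omega>) \<Longrightarrow> dist (x /\<^sub>R norm x) \<omega>' < \<delta> \<Longrightarrow> G \<omega> x = F \<omega> x"
  shows "\<exists>F' S'. Cm_on m UNIV F' \<and> (\<forall>x. jet_bound m \<rho> (K * (N * (2 ^ m * C * (\<epsilon> * \<rho> ^ m)))) F' x) \<and>
      (\<forall>j\<in>J. Cm_on m UNIV (S' j) \<and> (\<forall>x. jet_bound m \<rho> A (S' j) x)) \<and>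
      (\<forall>x \<omega>. \<rho> / 2 < norm x \<longrightarrow> norm x < 2 * \<rho> \<longrightarrow> \<omega> \<in> Allow m I \<longrightarrow> dist (x /\<^sub>R norm x) \<omega> < \<delta> \<longrightarrow>
        poly_eval p x = F' x + (\<Sum>j\<in>J. S' j x * poly_eval (case_prod Q j) x))"
proof -
  \<comment> \<open>A point within \<open>4 * s\<close> of a point of the annulus has a direction
    less than \<open>4 * \<eta> / 25\<close> away, which is below \<open>d \<omega> / 4\<close>. A
    patch near the quarter neighbourhood of \<omega> thus stays within \<open>d \<omega> / 2\<close>
    of it.\<close>
  define s where "s = \<eta> * \<rho> / 100"
  have s: "s > 0" "\<rho> = 100 / \<eta> * s" "s \<le> \<rho>" using \<rho> \<eta> mult_right_mono[of \<eta> 100 \<rho>] by (auto simp: s_def)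
  have rescale: "jet_bound m \<rho> (K * D) f x" if "jet_bound m s D f x" for D f and x :: "real ^ 'n"
    unfolding K_def using that s \<rho> \<eta> by (intro jet_bound_rescale[where s = s]) auto
  obtain Z :: "(real ^ 'n) set" and \<phi> where P: "unit_partition m C N s (4 * \<rho>) Z \<phi>" using partition s by blast
  note PD = unit_partitionD[OF P]
  define close where "close = (\<lambda>z \<omega>. \<omega> \<in> T \<and> (\<exists>y. \<rho> / 2 < norm y \<and> norm y < 2 * \<rho> \<and> dist z y < 2 * s
    \<and> dist (y /\<^sub>R norm y) \<omega> < d \<omega> / 4))"
  define Y where "Y = {z \<in> Z. \<exists>\<omega>. close z \<omega>}"
  have Y: "Y \<subseteq> Z" "finite Y" using PD(1) by (auto simp: Y_def)
  \<comment> \<open>Several directions may be close to one patch; one is picked, so that each patch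
    carries a single local representation of \<open>p\<close>.\<close>
  define w where "w = (\<lambda>z. SOME \<omega>. close z \<omega>)"
  have w: "close z (w z)" if "z \<in> Y" for z
    using that unfolding w_def Y_def by (auto intro: someI_ex)
  have wT: "w z \<in> T" if "z \<in> Y" for z using w[OF that] by (simp add: close_def)
  have in_cone: "x \<in> cone {w z} (d (w z)) (R (w z))" "\<rho> / 4 < norm x" "dist (x /\<^sub>R norm x) (w z) < d (w z) / 2"
    if z: "z \<in> Y" and x: "x \<in> ball z (2 * s)" for z x
  proof -
    obtain y where y: "\<rho> / 2 < norm y" "norm y < 2 * \<rho>" "dist z y < 2 * s" "dist (y /\<^sub>R norm y) (w z) < d (w z) / 4"
      using w[OF z] by (auto simp: close_def)
    have "dist x y < \<eta> / 25 * \<rho>"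
      using x y(3) dist_triangle[of x y z] by (simp add: s_def dist_commute)
    note n = near_direction[OF this _ y(1,2)]
    show "\<rho> / 4 < norm x" using n(1) \<eta> by simp
    have "\<eta> \<le> d (w z)" using \<eta>(3) wT z by auto
    then show dd: "dist (x /\<^sub>R norm x) (w z) < d (w z) / 2"
      using n(3) y(4) \<eta> dist_triangle[of "x /\<^sub>R norm x" "w z" "y /\<^sub>R norm y"] by simp
    have "norm x < R (w z)" using n(2) \<eta> \<rho> R0(2)[OF wT[OF z]] by simp
    moreover have "0 < norm x" using \<open>\<rho> / 4 < norm x\<close> \<rho> by linarith
    moreover have "dist (x /\<^sub>R norm x) (w z) < d (w z)" using dd zero_le_dist[of "x /\<^sub>R norm x" "w z"] by linarith
    ultimately show "x \<in> cone {w z} (d (w z)) (R (w z))" by (simp add: cone_def set_edist_less_iff)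
  qed
  \<comment> \<open>\<open>S (w z) l\<close> is controlled only on its cone. The bump is supported
    in \<open>cball z s\<close>, and the ball of twice the radius still lies in the cone, which
    gives room for the extension by zero.\<close>
  define h where "h = (\<lambda>z l x. if x \<in> ball z (2 * s) then \<phi> z x * S (w z) l x else 0)"
  have supp: "\<phi> z x = 0" if "z \<in> Y" "x \<notin> cball z s" for z x
    using that Y PD(4)[of z x] by (auto simp: dist_commute)
  have Cm_S: "Cm_on m (ball z (2 * s)) (S (w z) l)" if "z \<in> Y" "l \<in> {1..L (w z)}" for z l
    using in_cone(1)[OF that(1)] by (intro Cm_on_subset[OF strong_dataD(6)[OF data[OF wT[OF that(1)]] that(2)]]) auto
  have Cm_\<phi>: "Cm_on m U (\<phi> z)" if "z \<in> Y" for z U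
    using Cm_on_subset[OF PD(2)] that Y by auto
  have Cm_h: "Cm_on m UNIV (h z l)" if "z \<in> Y" "l \<in> {1..L (w z)}" for z l
    unfolding h_def using s supp[OF that(1)]
    by (intro Cm_on_extend_zero[of _ "cball z s"] Cm_on_mult Cm_\<phi> Cm_S that) auto
  have h_near: "jet_bound m s (2 ^ m * C * (4 ^ m * B0)) (h z l) x"
    if z: "z \<in> Y" "l \<in> {1..L (w z)}" and x: "dist x z \<le> s" for z l x
  proof -
    have xb: "x \<in> ball z (2 * s)" using x s by (simp add: dist_commute)
    note D = strong_dataD[OF data[OF wT[OF z(1)]]]
    have "jet_bound m s (4 ^ m * B (w z)) (S (w z) l) x"
    proof (rule jet_bound_rescale)
      show "jet_bound m (norm x) (B (w z)) (S (w z) l) x" by (rule D(7)[OF z(2) in_cone(1)[OF z(1) xb]])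
      show "s \<le> 4 * norm x" "0 < norm x" using in_cone(2)[OF z(1) xb] s \<rho> by auto
    qed (use s in auto)
    then have "jet_bound m s (4 ^ m * B0) (S (w z) l) x"
      by (rule jet_bound_mono) (use B0(2)[OF wT[OF z(1)]] s in auto)
    then have "jet_bound m s (2 ^ m * C * (4 ^ m * B0)) (\<lambda>x. \<phi> z x * S (w z) l x) x"
      using z Y s PD(3) by (intro jet_bound_mult[OF open_ball xb] Cm_\<phi> Cm_S) auto
    then show ?thesis
      using jet_bound_cong[OF open_ball xb, of "h z l" "\<lambda>x. \<phi> z x * S (w z) l x"] by (simp add: h_def)
  qed
  have h_far: "jet_bound m s 0 (h z l) x" if "z \<in> Y" "\<not> dist x z \<le> s" for z l x
    by (rule jet_bound_zero[of "- cball z s"]) (use that supp[OF that(1)] s in \<open>auto simp: h_def dist_commute\<close>)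
  \<comment> \<open>The grid changes with \<rho>; collecting the patches by their direction makes
    the index set \<open>J\<close> independent of it.\<close>
  define S' where "S' = (\<lambda>(\<omega>, l) x. \<Sum>z | z \<in> Y \<and> w z = \<omega>. h z l x)"
  define F' where "F' = (\<lambda>x. \<Sum>z\<in>Y. \<phi> z x * G (w z) x)"
  have "Cm_on m UNIV F'"
    unfolding F'_def by (intro Cm_on_sum Cm_on_mult Cm_\<phi> G(1) wT) auto
  moreover have "jet_bound m \<rho> (K * (N * (2 ^ m * C * (\<epsilon> * \<rho> ^ m)))) F' x" for x
  proof (rule rescale)
    have "jet_bound m s (\<epsilon> * \<rho> ^ m) (G (w z)) x" if "z \<in> Y" for z
      using jet_bound_rescale[OF G(2)[OF wT[OF that]], of s 1 x] s \<rho> by simp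
    then show "jet_bound m s (N * (2 ^ m * C * (\<epsilon> * \<rho> ^ m))) F' x"
      unfolding F'_def using \<epsilon> \<rho> wT
      by (intro unit_partition_sum_bound[OF P s(1) C _ Y(1) open_UNIV UNIV_I] G(1)) auto
  qed
  moreover have "Cm_on m UNIV (S' j) \<and> (\<forall>x. jet_bound m \<rho> A (S' j) x)" if jJ: "j \<in> J" for j
  proof -
    obtain \<omega> l where j: "j = (\<omega>, l)" "\<omega> \<in> T" "l \<in> {1..L \<omega>}" using jJ unfolding J_def by blast
    have S'j: "S' j = (\<lambda>x. \<Sum>z\<in>{z. z \<in> Y \<and> w z = \<omega>}. h z l x)" by (simp add: S'_def j)
    have "jet_bound m s (N * (2 ^ m * C * (4 ^ m * B0))) (S' j) x" for x
      unfolding S'j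
    proof (rule jet_bound_sum_local[OF open_UNIV UNIV_I s(1)])
      have "card {z \<in> {z \<in> Y. w z = \<omega>}. dist x z \<le> s} \<le> card {z \<in> Z. dist x z \<le> s}"
        using PD(1) Y by (intro card_mono) auto
      also have "\<dots> \<le> N" by (rule PD(6))
      finally show "card {z \<in> {z \<in> Y. w z = \<omega>}. dist x z \<le> s} \<le> N" .
    qed (use j Cm_h h_near h_far Y C B0 in auto)
    moreover have "Cm_on m UNIV (S' j)"
      unfolding S'j using j Cm_h by (intro Cm_on_sum) auto
    ultimately show ?thesis unfolding A_def using rescale by blast
  qed
  moreover have "poly_eval p x = F' x + (\<Sum>j\<in>J. S' j x * poly_eval (case_prod Q j) x)"
    if x: "\<rho> / 2 < norm x" "norm x < 2 * \<rho>" and \<omega>: "\<omega> \<in> Allow m I" "dist (x /\<^sub>R norm x) \<omega> < \<delta>" for x \<omega>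
  proof -
    have x0: "x \<noteq> 0" using x \<rho> by auto
    \<comment> \<open>Turning \<open>x\<close> into the allowed direction at the same radius moves
      it by less than \<open>2 * \<rho> * \<eta> / 200 = s\<close>. Then \<open>y\<close> shows that
      every patch alive at \<open>x\<close> is close to some member of the cover, so the discarded
      patches vanish at \<open>x\<close>.\<close>
    define y where "y = norm x *\<^sub>R \<omega>"
    have "norm \<omega> = 1" using \<omega> by (simp add: Allow_def)
    then have y: "norm y = norm x" "y /\<^sub>R norm y = \<omega>" using x0 by (simp_all add: y_def)
    have "norm x * dist (x /\<^sub>R norm x) \<omega> < 2 * \<rho> * (\<eta> / 200)"
      using x \<omega>(2) \<delta> by (intro mult_strict_mono) auto
    then have xy: "dist x y < s" by (simp add: y_def dist_ray_point[OF x0] s_def)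
    obtain \<omega>0 where \<omega>0: "\<omega>0 \<in> T" "dist \<omega> \<omega>0 < d \<omega>0 / 4" using T(3) \<omega>(1) by (auto simp: dist_commute)
    have inY: "z \<in> Y" if "z \<in> Z" "\<phi> z x \<noteq> 0" for z
    proof -
      have "dist x z < s" using PD(4)[of z x] that by force
      then have "dist z y < 2 * s" using xy dist_triangle[of z y x] by (simp add: dist_commute)
      then have "close z \<omega>0" using \<omega>0 x y by (auto simp: close_def intro!: exI[of _ y])
      with that show ?thesis by (auto simp: Y_def)
    qed
    have "(\<Sum>z\<in>Y. \<phi> z x) = (\<Sum>z\<in>Z. \<phi> z x)"
      using inY Y PD(1) by (intro sum.mono_neutral_left) auto
    also have "\<dots> = 1" using x \<rho> by (intro PD(5)) auto
    finally have "poly_eval p x = (\<Sum>z\<in>Y. \<phi> z x * poly_eval p x)" by (simp flip: sum_distrib_right)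
    also have "\<dots> = (\<Sum>z\<in>Y. \<phi> z x * G (w z) x + (\<Sum>l=1..L (w z). h z l x * poly_eval (Q (w z) l) x))"
    proof (rule sum.cong)
      fix z assume z: "z \<in> Y"
      show "\<phi> z x * poly_eval p x = \<phi> z x * G (w z) x + (\<Sum>l=1..L (w z). h z l x * poly_eval (Q (w z) l) x)"
      proof (cases "\<phi> z x = 0")
        case True
        then have "h z l x = 0" for l by (simp add: h_def)
        with True show ?thesis by simp
      next
        case False
        then have "dist x z < s" using PD(4)[of z x] z Y by force
        then have xb: "x \<in> ball z (2 * s)" using s by (simp add: dist_commute)
        note c = in_cone[OF z xb]
        have "\<eta> \<le> d (w z)" using \<eta>(3) wT z by auto
        \<comment> \<open>The direction of \<open>x\<close> is within \<open>d (w z) / 2\<close> of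
          \<open>w z\<close>, and \<omega> is within \<open>\<eta> / 200\<close> of that direction,
          so \<omega> is among the directions for which \<open>G\<close> is known to agree with
          \<open>F\<close>.\<close>
        then have "dist \<omega> (w z) < d (w z)"
          using c(3) \<omega>(2) \<delta> \<eta>(1) dist_triangle[of \<omega> "w z" "x /\<^sub>R norm x"] by (simp add: dist_commute)
        then have "\<omega> \<in> Allow m I \<inter> dir_nbhd {w z} (d (w z))"
          using \<omega> \<open>norm \<omega> = 1\<close> by (simp add: dir_nbhd_def set_edist_less_iff)
        from G(3)[OF wT[OF z] x this \<omega>(2)] strong_dataD(8)[OF data[OF wT[OF z]] c(1)] xb
        show ?thesis by (simp add: h_def distrib_left sum_distrib_left mult_ac)
      qed
    qed simp
    also have "\<dots> = F' x + (\<Sum>z\<in>Y. \<Sum>l=1..L (w z). h z l x * poly_eval (Q (w z) l) x)"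
      by (simp add: F'_def sum.distrib)
    also have "(\<Sum>z\<in>Y. \<Sum>l=1..L (w z). h z l x * poly_eval (Q (w z) l) x)
        = (\<Sum>\<omega>\<in>T. \<Sum>z\<in>{z \<in> Y. w z = \<omega>}. \<Sum>l=1..L (w z). h z l x * poly_eval (Q (w z) l) x)"
      using Y T wT by (intro sum.group[symmetric]) auto
    also have "\<dots> = (\<Sum>\<omega>\<in>T. \<Sum>l=1..L \<omega>. S' (\<omega>, l) x * poly_eval (Q \<omega> l) x)"
    proof (rule sum.cong)
      fix \<omega>
      have "(\<Sum>z\<in>{z \<in> Y. w z = \<omega>}. \<Sum>l=1..L (w z). h z l x * poly_eval (Q (w z) l) x)
          = (\<Sum>z\<in>{z \<in> Y. w z = \<omega>}. \<Sum>l=1..L \<omega>. h z l x * poly_eval (Q \<omega> l) x)"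
        by (rule sum.cong) auto
      also have "\<dots> = (\<Sum>l=1..L \<omega>. \<Sum>z\<in>{z \<in> Y. w z = \<omega>}. h z l x * poly_eval (Q \<omega> l) x)" by (rule sum.swap)
      finally show "(\<Sum>z\<in>{z \<in> Y. w z = \<omega>}. \<Sum>l=1..L (w z). h z l x * poly_eval (Q (w z) l) x)
          = (\<Sum>l=1..L \<omega>. S' (\<omega>, l) x * poly_eval (Q \<omega> l) x)"
        by (simp add: S'_def sum_distrib_right)
    qed simp
    also have "\<dots> = (\<Sum>j\<in>J. S' j x * poly_eval (case_prod Q j) x)"
      unfolding J_def using T(1) by (subst sum.Sigma) (auto simp: case_prod_unfold)
    finally show ?thesis .
  qed
  ultimately show ?thesis by blast
qed

lemma implies: "implies_jet m I p"
proof (rule implies_jetI[of J "A + 1" "case_prod Q"])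
  have K: "K \<ge> 0" using \<eta> by (simp add: K_def)
  show "finite J" unfolding J_def using T(1) by auto
  show "0 < A + 1" using K C B0 by (simp add: A_def add_nonneg_pos)
  show "case_prod Q j \<in> I" if "j \<in> J" for j
    using that strong_dataD(4)[OF data] by (auto simp: J_def)
  fix \<epsilon> :: real assume \<epsilon>: "\<epsilon> > 0"
  \<comment> \<open>The factor by which gluing enlarges the bound on the remainders; it is fixed by
    the cover, so \<epsilon> can be divided by it in advance.\<close>
  define D where "D = K * (N * (2 ^ m * C))"
  have D: "D \<ge> 0" using K C by (simp add: D_def)
  define \<epsilon>' where "\<epsilon>' = \<epsilon> / (D + 1)"
  have \<epsilon>': "\<epsilon>' > 0" "D * \<epsilon>' \<le> \<epsilon>" using \<epsilon> D by (auto simp: \<epsilon>'_def field_simps)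
  have "\<forall>\<omega>\<in>T. \<exists>\<delta> r. \<delta> > 0 \<and> r > 0 \<and> (\<forall>\<rho>. 0 < \<rho> \<and> \<rho> \<le> r \<longrightarrow>
    (\<exists>G. Cm_on m UNIV G \<and> (\<forall>x. jet_bound m \<rho> (\<epsilon>' * \<rho> ^ m) G x) \<and>
      (\<forall>x \<omega>'. \<rho> / 2 < norm x \<longrightarrow> norm x < 2 * \<rho> \<longrightarrow> \<omega>' \<in> Allow m I \<inter> dir_nbhd {\<omega>} (d \<omega>) \<longrightarrow>
        dist (x /\<^sub>R norm x) \<omega>' < \<delta> \<longrightarrow> G x = F \<omega> x)))"
  proof
    fix \<omega> assume \<omega>: "\<omega> \<in> T"
    have "Allow m I \<inter> dir_nbhd {\<omega>} (d \<omega>) \<subseteq> sphere 0 1" by (auto simp: Allow_def)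
    from negligible_extension[OF strong_dataD(5)[OF data[OF \<omega>]] this \<epsilon>'(1)]
    show "\<exists>\<delta> r. \<delta> > 0 \<and> r > 0 \<and> (\<forall>\<rho>. 0 < \<rho> \<and> \<rho> \<le> r \<longrightarrow>
      (\<exists>G. Cm_on m UNIV G \<and> (\<forall>x. jet_bound m \<rho> (\<epsilon>' * \<rho> ^ m) G x) \<and>
        (\<forall>x \<omega>'. \<rho> / 2 < norm x \<longrightarrow> norm x < 2 * \<rho> \<longrightarrow> \<omega>' \<in> Allow m I \<inter> dir_nbhd {\<omega>} (d \<omega>) \<longrightarrow>
          dist (x /\<^sub>R norm x) \<omega>' < \<delta> \<longrightarrow> G x = F \<omega> x)))"
      by (elim exE conjE) (intro exI conjI)
  qed
  from bchoice[OF this] obtain dA where "\<forall>\<omega>\<in>T. \<exists>r. dA \<omega> > 0 \<and> r > 0 \<and> (\<forall>\<rho>. 0 < \<rho> \<and> \<rho> \<le> r \<longrightarrow>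
    (\<exists>G. Cm_on m UNIV G \<and> (\<forall>x. jet_bound m \<rho> (\<epsilon>' * \<rho> ^ m) G x) \<and>
      (\<forall>x \<omega>'. \<rho> / 2 < norm x \<longrightarrow> norm x < 2 * \<rho> \<longrightarrow> \<omega>' \<in> Allow m I \<inter> dir_nbhd {\<omega>} (d \<omega>) \<longrightarrow>
        dist (x /\<^sub>R norm x) \<omega>' < dA \<omega> \<longrightarrow> G x = F \<omega> x)))" ..
  from bchoice[OF this] obtain rA where *: "\<forall>\<omega>\<in>T. dA \<omega> > 0 \<and> rA \<omega> > 0 \<and> (\<forall>\<rho>. 0 < \<rho> \<and> \<rho> \<le> rA \<omega> \<longrightarrow>
    (\<exists>G. Cm_on m UNIV G \<and> (\<forall>x. jet_bound m \<rho> (\<epsilon>' * \<rho> ^ m) G x) \<and>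
      (\<forall>x \<omega>'. \<rho> / 2 < norm x \<longrightarrow> norm x < 2 * \<rho> \<longrightarrow> \<omega>' \<in> Allow m I \<inter> dir_nbhd {\<omega>} (d \<omega>) \<longrightarrow>
        dist (x /\<^sub>R norm x) \<omega>' < dA \<omega> \<longrightarrow> G x = F \<omega> x)))" ..
  obtain \<delta> where \<delta>: "0 < \<delta>" "\<delta> \<le> \<eta> / 200" "\<And>\<omega>. \<omega> \<in> T \<Longrightarrow> \<delta> \<le> dA \<omega>"
    by (rule finite_lower_bound[OF T(1), of dA "\<eta> / 200"]) (use * \<eta>(1) in auto)
  obtain r where r: "0 < r" "r \<le> R0 / 3" "\<And>\<omega>. \<omega> \<in> T \<Longrightarrow> r \<le> rA \<omega>"
    by (rule finite_lower_bound[OF T(1), of rA "R0 / 3"]) (use * R0(1) in auto)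
  show "\<exists>\<delta>>0. \<exists>r>0. \<forall>\<rho>. 0 < \<rho> \<and> \<rho> \<le> r \<longrightarrow> (\<exists>F S.
      Cm_on m UNIV F \<and> (\<forall>x. jet_bound m \<rho> (\<epsilon> * \<rho> ^ m) F x) \<and>
      (\<forall>j\<in>J. Cm_on m UNIV (S j) \<and> (\<forall>x. jet_bound m \<rho> (A + 1) (S j) x)) \<and>
      (\<forall>x \<omega>. \<rho> / 2 < norm x \<longrightarrow> norm x < 2 * \<rho> \<longrightarrow> \<omega> \<in> Allow m I \<longrightarrow> dist (x /\<^sub>R norm x) \<omega> < \<delta> \<longrightarrow>
        poly_eval p x = F x + (\<Sum>j\<in>J. S j x * poly_eval (case_prod Q j) x)))"
  proof (rule exI[of _ \<delta>], rule conjI[OF \<delta>(1)], rule exI[of _ r], rule conjI[OF r(1)], intro allI impI)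
    fix \<rho> assume "0 < \<rho> \<and> \<rho> \<le> r"
    then have \<rho>: "0 < \<rho>" "\<rho> \<le> r" by auto
    have "\<forall>\<omega>\<in>T. \<exists>G. Cm_on m UNIV G \<and> (\<forall>x. jet_bound m \<rho> (\<epsilon>' * \<rho> ^ m) G x) \<and>
      (\<forall>x \<omega>'. \<rho> / 2 < norm x \<longrightarrow> norm x < 2 * \<rho> \<longrightarrow> \<omega>' \<in> Allow m I \<inter> dir_nbhd {\<omega>} (d \<omega>) \<longrightarrow>
        dist (x /\<^sub>R norm x) \<omega>' < dA \<omega> \<longrightarrow> G x = F \<omega> x)"
    proof
      fix \<omega> assume \<omega>: "\<omega> \<in> T"
      then have "\<rho> \<le> rA \<omega>" using r(3) \<rho> by force
      then show "\<exists>G. Cm_on m UNIV G \<and> (\<forall>x. jet_bound m \<rho> (\<epsilon>' * \<rho> ^ m) G x) \<and>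
        (\<forall>x \<omega>'. \<rho> / 2 < norm x \<longrightarrow> norm x < 2 * \<rho> \<longrightarrow> \<omega>' \<in> Allow m I \<inter> dir_nbhd {\<omega>} (d \<omega>) \<longrightarrow>
          dist (x /\<^sub>R norm x) \<omega>' < dA \<omega> \<longrightarrow> G x = F \<omega> x)"
        using *[THEN bspec, OF \<omega>] \<rho>(1) by blast
    qed
    from bchoice[OF this] obtain G where G: "\<forall>\<omega>\<in>T. Cm_on m UNIV (G \<omega>) \<and> (\<forall>x. jet_bound m \<rho> (\<epsilon>' * \<rho> ^ m) (G \<omega>) x) \<and>
      (\<forall>x \<omega>'. \<rho> / 2 < norm x \<longrightarrow> norm x < 2 * \<rho> \<longrightarrow> \<omega>' \<in> Allow m I \<inter> dir_nbhd {\<omega>} (d \<omega>) \<longrightarrow>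
        dist (x /\<^sub>R norm x) \<omega>' < dA \<omega> \<longrightarrow> G \<omega> x = F \<omega> x)" ..
    have "\<exists>F' S'. Cm_on m UNIV F' \<and> (\<forall>x. jet_bound m \<rho> (K * (N * (2 ^ m * C * (\<epsilon>' * \<rho> ^ m)))) F' x) \<and>
      (\<forall>j\<in>J. Cm_on m UNIV (S' j) \<and> (\<forall>x. jet_bound m \<rho> A (S' j) x)) \<and>
      (\<forall>x \<omega>. \<rho> / 2 < norm x \<longrightarrow> norm x < 2 * \<rho> \<longrightarrow> \<omega> \<in> Allow m I \<longrightarrow> dist (x /\<^sub>R norm x) \<omega> < \<delta> \<longrightarrow>
        poly_eval p x = F' x + (\<Sum>j\<in>J. S' j x * poly_eval (case_prod Q j) x))"
    proof (rule scale_exists[of \<rho> \<delta> \<epsilon>' G])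
      fix \<omega> x \<omega>' assume a: "\<omega> \<in> T" "\<rho> / 2 < norm x" "norm x < 2 * \<rho>"
        "\<omega>' \<in> Allow m I \<inter> dir_nbhd {\<omega>} (d \<omega>)" "dist (x /\<^sub>R norm x) \<omega>' < \<delta>"
      then have "dist (x /\<^sub>R norm x) \<omega>' < dA \<omega>" using \<delta>(3) by force
      with G a show "G \<omega> x = F \<omega> x" by blast
    qed (use \<rho> r \<delta> \<epsilon>' G in auto)
    then obtain F' S' where F': "Cm_on m UNIV F'" "\<forall>x. jet_bound m \<rho> (K * (N * (2 ^ m * C * (\<epsilon>' * \<rho> ^ m)))) F' x"
      and S': "\<forall>j\<in>J. Cm_on m UNIV (S' j) \<and> (\<forall>x. jet_bound m \<rho> A (S' j) x)"
      and eq: "\<forall>x \<omega>. \<rho> / 2 < norm x \<longrightarrow> norm x < 2 * \<rho> \<longrightarrow> \<omega> \<in> Allow m I \<longrightarrow> dist (x /\<^sub>R norm x) \<omega> < \<delta> \<longrightarrow>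
        poly_eval p x = F' x + (\<Sum>j\<in>J. S' j x * poly_eval (case_prod Q j) x)"
      by (elim exE conjE) (rule that)
    have "D * \<epsilon>' * \<rho> ^ m \<le> \<epsilon> * \<rho> ^ m" using \<epsilon>'(2) \<rho> by (intro mult_right_mono) auto
    then have "K * (N * (2 ^ m * C * (\<epsilon>' * \<rho> ^ m))) \<le> \<epsilon> * \<rho> ^ m" by (simp add: D_def mult.assoc)
    then have "\<forall>x. jet_bound m \<rho> (\<epsilon> * \<rho> ^ m) F' x" using F'(2) jet_bound_mono \<rho>(1) by blast
    moreover have "\<forall>j\<in>J. Cm_on m UNIV (S' j) \<and> (\<forall>x. jet_bound m \<rho> (A + 1) (S' j) x)"
      using S' jet_bound_mono[of m \<rho> A _ _ "A + 1"] \<rho>(1) by auto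
    ultimately show "\<exists>F S. Cm_on m UNIV F \<and> (\<forall>x. jet_bound m \<rho> (\<epsilon> * \<rho> ^ m) F x) \<and>
      (\<forall>j\<in>J. Cm_on m UNIV (S j) \<and> (\<forall>x. jet_bound m \<rho> (A + 1) (S j) x)) \<and>
      (\<forall>x \<omega>. \<rho> / 2 < norm x \<longrightarrow> norm x < 2 * \<rho> \<longrightarrow> \<omega> \<in> Allow m I \<longrightarrow> dist (x /\<^sub>R norm x) \<omega> < \<delta> \<longrightarrow>
        poly_eval p x = F x + (\<Sum>j\<in>J. S j x * poly_eval (case_prod Q j) x))"
      using F'(1) eq by (intro exI conjI)
  qed
qed

end

theorem corollary3p18:
  fixes m :: nat and I :: "'n::finite rpoly set" and p :: "'n rpoly"
  assumes "m \<ge> 1"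
    and "ideal I (jet_ring m)" and "I \<subseteq> jets0 m"
    and "p \<in> jets0 m"
    and "\<forall>\<omega>\<in>Allow m I. strongly_implies m I p \<omega>"
  shows "implies_jet m I p"
proof -
  have "\<forall>\<omega>\<in>Allow m I. \<exists>\<delta> r L Q F S B. strong_data m I p \<omega> \<delta> r L Q F S B"
    using assms(5) strongly_implies_data by blast
  then obtain d R L Q F S B
    where data: "\<And>\<omega>. \<omega> \<in> Allow m I \<Longrightarrow> strong_data m I p \<omega> (d \<omega>) (R \<omega>) (L \<omega>) (Q \<omega>) (F \<omega>) (S \<omega>) (B \<omega>)"
    by metis
  note D = strong_dataD[OF data]
  \<comment> \<open>Quarter radii leave room for patches of positive size. The finite cover drawn
    from these balls is fixed before \<epsilon>, hence so are the polynomials and constants built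
    from it.\<close>
  have "Allow m I \<subseteq> (\<Union>\<omega>\<in>Allow m I. ball \<omega> (d \<omega> / 4))" using D(1) by force
  then obtain T where T: "finite T" "T \<subseteq> Allow m I" "Allow m I \<subseteq> (\<Union>\<omega>\<in>T. ball \<omega> (d \<omega> / 4))"
    using compactE_image[OF compact_Allow[of m I], of "Allow m I" "\<lambda>\<omega>. ball \<omega> (d \<omega> / 4)"]
    by (metis open_ball)
  have pos: "0 < d \<omega>" "0 < R \<omega>" if "\<omega> \<in> T" for \<omega> using D(1,2) T(2) that by auto
  obtain \<eta> where \<eta>: "0 < \<eta>" "\<eta> \<le> 1" "\<And>\<omega>. \<omega> \<in> T \<Longrightarrow> \<eta> \<le> d \<omega>"
    by (rule finite_lower_bound[OF T(1), of d 1]) (use pos in auto)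
  obtain R0 :: real where R0: "0 < R0" "R0 \<le> 1" "\<And>\<omega>. \<omega> \<in> T \<Longrightarrow> R0 \<le> R \<omega>"
    by (rule finite_lower_bound[OF T(1), of R 1]) (use pos in auto)
  \<comment> \<open>Inserting 1 gives the maximum a value when the cover is empty.\<close>
  define B0 where "B0 = Max (insert 1 (B ` T))"
  have "1 \<le> B0" "B \<omega> \<le> B0" if "\<omega> \<in> T" for \<omega>
    unfolding B0_def using T(1) that by (intro Max_ge; simp)+
  moreover have "1 \<le> B0" unfolding B0_def using T(1) by (intro Max_ge) auto
  moreover obtain C N where "C \<ge> 0"
    and "\<And>s R. s > 0 \<Longrightarrow> \<exists>(Z :: (real ^ 'n) set) \<phi>. unit_partition m C N s R Z \<phi>"
    using unit_partition_exists[of m, where 'n='n] by blast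
  ultimately interpret strong_cover m I p T d R L Q F S B C N \<eta> R0 B0
    using T \<eta> R0 data by unfold_locales auto
  show ?thesis by (rule implies)
qed

end
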